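(* Let $A$ be a factorizable ribbon Hopf algebra with ribbon element $v$ and nonzero right integral $\rho$, and let $\mathfrak S^n,\mathfrak T^n$ be the cochain automorphisms of the Hochschild cochain complex $C(A,A)$ defined below. Then: (1) $\mathfrak S^n\circ\mathfrak T^n\circ\mathfrak S^n=\rho(v)\,(\mathfrak T^n)^{-1}\circ\mathfrak S^n\circ(\mathfrak T^n)^{-1}$ for all $n$; (2) the cochain map with components $(\mathfrak S^n)^4$ is cochain homotopic to the cochain map with components $\big((\rho\otimes\rho)(Q)\big)^2\,\mathrm{id}_{C^n(A,A)}$.
   Context: $A$ is a finite-dimensional Hopf algebra over a field $K$ with coproduct $\Delta(a)=a_{(1)}\otimes a_{(2)}$ (iterated: $a_{(1)}\otimes a_{(2)}\otimes a_{(3)}$), counit $\varepsilon$, bijective antipode $S$, quasitriangular with R-matrix $R=R_1\otimes R_2$ (invertible, $\Delta^{\mathrm{cop}}(a)=R\Delta(a)R^{-1}$, $(\Delta\otimes\mathrm{id})(R)=R_{13}R_{23}$, $(\mathrm{id}\otimes\Delta)(R)=R_{13}R_{12}$), monodromy matrix $Q=\tau(R)R=R_2R'_1\otimes R_1R'_2=Q_1\otimes Q_2$, Drinfel'd element $u=S(R_2)R_1$, and ribbon element $v$ in the convention: $v$ central invertible, $S(v)=v$, $\varepsilon(v)=1$, $v^2=(uS(u))^{-1}$, $\Delta(v)=(v\otimes v)Q$. Factorizable: $\bar\Phi\colon A^*\to A$, $\varphi\mapsto\varphi(Q_1)Q_2$, is bijective. $\rho\in A^*$ is a nonzero right integral ($\rho(a_{(1)})a_{(2)}=\rho(a)1_A$),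 and $\iota\colon A\to A^*$, $\iota(a)(b)=\rho(ab)$. Hochschild cochain complex $C(A,A)$: $C^n(A,A)=\mathrm{Hom}_K(A^{\otimes n},A)$ ($C^0=A$, $C^n=0$ for $n<0$), differential $d^{n-1}(f)(a_1\otimes\cdots\otimes a_n)=a_1f(a_2\otimes\cdots\otimes a_n)+\sum_{i=1}^{n-1}(-1)^if(a_1\otimes\cdots\otimes a_ia_{i+1}\otimes\cdots\otimes a_n)+(-1)^nf(a_1\otimes\cdots\otimes a_{n-1})a_n$. Define $\mathfrak T^n(f)(a_1\otimes\cdots\otimes a_n)=v\,f(a_1\otimes\cdots\otimes a_n)$ and $\mathfrak S^n:=S^n\circ\bar\Phi^n\circ\iota^n$, where $\iota^n(f)=\iota\circ f$; for $g\in\mathrm{Hom}_K(A^{\otimes n},A^* )$, $\bar\Phi^n(g)(a_1\otimes\cdots\otimes a_n)=g(a_{1(2)}\otimes\cdots\otimes a_{n(2)})\big(Q_1S^{-1}(a_{n(1)})\cdots S^{-1}(a_{1(1)})\big)a_{1(3)}\cdots a_{n(3)}Q_2$; for $h\in\mathrm{Hom}_K(A^{\otimes n},A)$, $S^n(h)(a_1\otimes\cdots\otimes a_n)=a_{1(1)}\cdots a_{n(1)}S\big(h(a_{1(2)}\otimes\cdots\otimes a_{n(2)})\big)a_{1(3)}\cdots a_{n(3)}$ (empty products are $1$ for $n=0$). Equivalently, $\mathfrak S^n(f)(a_1\otimes\cdots\otimes a_n)=\rho\big(S(a_{n(2)})\cdots S(a_{1(2)})f(a_{1(3)}\otimes\cdots\otimes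 a_{n(3)})Q_1\big)a_{1(1)}\cdots a_{n(1)}S(Q_2)$. These $\mathfrak S^n,\mathfrak T^n$ are components of cochain automorphisms of $C(A,A)$. *)

theory Defs
  imports Main
begin

text \<open>
  Coordinate model of a finite-dimensional Hopf algebra A over a field 'k.
  A has basis e_0, ..., e_(d-1) with d = dim H.  An element of A is a coefficient
  function x :: nat => 'k (x i = coefficient of e_i, zero for i >= d).
  An element of A tensor A is a coefficient function X :: nat => nat => 'k,
  and of A tensor A tensor A a function nat => nat => nat => 'k.
  A linear functional phi on A (element of A dual) is given by its values on the basis.
  A cochain f in C^n(A,A) = Hom_K(A^(tensor n), A) is given by its values on basis tuples:
  f [i1,...,in] is the coefficient vector of f(e_i1 tensor ... tensor e_in).
\<close>

record 'k hopf =
  dim   :: nat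
  mu    :: "nat \<Rightarrow> nat \<Rightarrow> nat \<Rightarrow> 'k"   (* e_i e_j = sum_k mu i j k e_k *)
  eta   :: "nat \<Rightarrow> 'k"                   (* 1 = sum_k eta k e_k *)
  delta :: "nat \<Rightarrow> nat \<Rightarrow> nat \<Rightarrow> 'k"   (* Delta e_i = sum_{j,k} delta i j k e_j (x) e_k *)
  eps   :: "nat \<Rightarrow> 'k"                   (* counit on basis *)
  ant   :: "nat \<Rightarrow> nat \<Rightarrow> 'k"           (* S e_i = sum_j ant i j e_j *)

type_synonym 'k vec = "nat \<Rightarrow> 'k"
type_synonym 'k ten2 = "nat \<Rightarrow> nat \<Rightarrow> 'k"
type_synonym 'k ten3 = "nat \<Rightarrow> nat \<Rightarrow> nat \<Rightarrow> 'k"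
type_synonym 'k coch = "nat list \<Rightarrow> nat \<Rightarrow> 'k"

definition vecs :: "('k::field, 'z) hopf_scheme \<Rightarrow> 'k vec set" where
  "vecs H = {x. \<forall>i. dim H \<le> i \<longrightarrow> x i = 0}"

definition ten2s :: "('k::field, 'z) hopf_scheme \<Rightarrow> 'k ten2 set" where
  "ten2s H = {X. \<forall>a b. dim H \<le> a \<or> dim H \<le> b \<longrightarrow> X a b = 0}"

definition basis :: "('k::field, 'z) hopf_scheme \<Rightarrow> nat \<Rightarrow> 'k vec" where
  "basis H i = (\<lambda>k. if k = i \<and> i < dim H then 1 else 0)"

definition smul :: "'k::field \<Rightarrow> 'k vec \<Rightarrow> 'k vec" where
  "smul c x = (\<lambda>k. c * x k)"

definition vadd :: "'k::field vec \<Rightarrow> 'k vec \<Rightarrow> 'k vec" where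
  "vadd x y = (\<lambda>k. x k + y k)"

definition vsumover :: "'i set \<Rightarrow> ('i \<Rightarrow> 'k::field vec) \<Rightarrow> 'k vec" where
  "vsumover Z F = (\<lambda>k. \<Sum>z\<in>Z. F z k)"

definition pairs :: "('k::field, 'z) hopf_scheme \<Rightarrow> (nat \<times> nat) set" where
  "pairs H = {..<dim H} \<times> {..<dim H}"

definition mul :: "('k::field, 'z) hopf_scheme \<Rightarrow> 'k vec \<Rightarrow> 'k vec \<Rightarrow> 'k vec" where
  "mul H x y = (\<lambda>k. if k < dim H then
      (\<Sum>i<dim H. \<Sum>j<dim H. x i * y j * mu H i j k) else 0)"

definition one :: "('k::field, 'z) hopf_scheme \<Rightarrow> 'k vec" where
  "one H = (\<lambda>k. if k < dim H then eta H k else 0)"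

definition Sop :: "('k::field, 'z) hopf_scheme \<Rightarrow> 'k vec \<Rightarrow> 'k vec" where
  "Sop H x = (\<lambda>j. if j < dim H then (\<Sum>i<dim H. x i * ant H i j) else 0)"

definition Sinv :: "('k::field, 'z) hopf_scheme \<Rightarrow> 'k vec \<Rightarrow> 'k vec" where
  "Sinv H = the_inv_into (vecs H) (Sop H)"

definition counit :: "('k::field, 'z) hopf_scheme \<Rightarrow> 'k vec \<Rightarrow> 'k" where
  "counit H x = (\<Sum>i<dim H. x i * eps H i)"

definition dual_apply :: "('k::field, 'z) hopf_scheme \<Rightarrow> 'k vec \<Rightarrow> 'k vec \<Rightarrow> 'k" where
  "dual_apply H phi x = (\<Sum>i<dim H. phi i * x i)"

definition prodlist :: "('k::field, 'z) hopf_scheme \<Rightarrow> 'k vec list \<Rightarrow> 'k vec" where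
  "prodlist H xs = foldr (mul H) xs (one H)"

definition tens :: "('k::field, 'z) hopf_scheme \<Rightarrow> 'k vec \<Rightarrow> 'k vec \<Rightarrow> 'k ten2" where
  "tens H x y = (\<lambda>a b. if a < dim H \<and> b < dim H then x a * y b else 0)"

definition cop :: "('k::field, 'z) hopf_scheme \<Rightarrow> 'k vec \<Rightarrow> 'k ten2" where
  "cop H x = (\<lambda>a b. if a < dim H \<and> b < dim H then
      (\<Sum>i<dim H. x i * delta H i a b) else 0)"

definition flip2 :: "'k ten2 \<Rightarrow> 'k ten2" where
  "flip2 X = (\<lambda>a b. X b a)"

definition mul2 :: "('k::field, 'z) hopf_scheme \<Rightarrow> 'k ten2 \<Rightarrow> 'k ten2 \<Rightarrow> 'k ten2" where
  "mul2 H X Y = (\<lambda>p q. if p < dim H \<and> q < dim H then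
      (\<Sum>a<dim H. \<Sum>b<dim H. \<Sum>c<dim H. \<Sum>e<dim H.
          X a b * Y c e * mu H a c p * mu H b e q) else 0)"

definition one2 :: "('k::field, 'z) hopf_scheme \<Rightarrow> 'k ten2" where
  "one2 H = tens H (one H) (one H)"

definition mul3 :: "('k::field, 'z) hopf_scheme \<Rightarrow> 'k ten3 \<Rightarrow> 'k ten3 \<Rightarrow> 'k ten3" where
  "mul3 H X Y = (\<lambda>p q r. if p < dim H \<and> q < dim H \<and> r < dim H then
      (\<Sum>a<dim H. \<Sum>b<dim H. \<Sum>c<dim H. \<Sum>a'<dim H. \<Sum>b'<dim H. \<Sum>c'<dim H.
          X a b c * Y a' b' c' * mu H a a' p * mu H b b' q * mu H c c' r) else 0)"

definition cop_left :: "('k::field, 'z) hopf_scheme \<Rightarrow> 'k ten2 \<Rightarrow> 'k ten3" where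
  "cop_left H X = (\<lambda>p q r. if p < dim H \<and> q < dim H \<and> r < dim H then
      (\<Sum>i<dim H. X i r * delta H i p q) else 0)"

definition cop_right :: "('k::field, 'z) hopf_scheme \<Rightarrow> 'k ten2 \<Rightarrow> 'k ten3" where
  "cop_right H X = (\<lambda>p q r. if p < dim H \<and> q < dim H \<and> r < dim H then
      (\<Sum>i<dim H. X p i * delta H i q r) else 0)"

definition leg12 :: "('k::field, 'z) hopf_scheme \<Rightarrow> 'k ten2 \<Rightarrow> 'k ten3" where
  "leg12 H X = (\<lambda>p q r. if p < dim H \<and> q < dim H \<and> r < dim H then X p q * eta H r else 0)"

definition leg13 :: "('k::field, 'z) hopf_scheme \<Rightarrow> 'k ten2 \<Rightarrow> 'k ten3" where
  "leg13 H X = (\<lambda>p q r. if p < dim H \<and> q < dim H \<and> r < dim H then X p r * eta H q else 0)"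

definition leg23 :: "('k::field, 'z) hopf_scheme \<Rightarrow> 'k ten2 \<Rightarrow> 'k ten3" where
  "leg23 H X = (\<lambda>p q r. if p < dim H \<and> q < dim H \<and> r < dim H then eta H p * X q r else 0)"

definition hopf_algebra :: "('k::field, 'z) hopf_scheme \<Rightarrow> bool" where
  "hopf_algebra H \<longleftrightarrow>
     \<comment> \<open>associative unital algebra\<close>
     (\<forall>x\<in>vecs H. \<forall>y\<in>vecs H. \<forall>z\<in>vecs H. mul H (mul H x y) z = mul H x (mul H y z)) \<and>
     (\<forall>x\<in>vecs H. mul H (one H) x = x \<and> mul H x (one H) = x) \<and>
     \<comment> \<open>coassociativity: (Delta (x) id) Delta = (id (x) Delta) Delta\<close>
     (\<forall>x\<in>vecs H. cop_left H (cop H x) = cop_right H (cop H x)) \<and>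
     \<comment> \<open>counit: (eps (x) id) Delta = id = (id (x) eps) Delta\<close>
     (\<forall>i<dim H. vsumover (pairs H) (\<lambda>(a,b). smul (delta H i a b * eps H a) (basis H b)) = basis H i) \<and>
     (\<forall>i<dim H. vsumover (pairs H) (\<lambda>(a,b). smul (delta H i a b * eps H b) (basis H a)) = basis H i) \<and>
     \<comment> \<open>Delta and eps are algebra morphisms\<close>
     (\<forall>x\<in>vecs H. \<forall>y\<in>vecs H. cop H (mul H x y) = mul2 H (cop H x) (cop H y)) \<and>
     cop H (one H) = one2 H \<and>
     (\<forall>x\<in>vecs H. \<forall>y\<in>vecs H. counit H (mul H x y) = counit H x * counit H y) \<and>
     counit H (one H) = 1 \<and>
     \<comment> \<open>antipode: S(a_(1)) a_(2) = eps(a) 1 = a_(1) S(a_(2))\<close>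
     (\<forall>i<dim H. vsumover (pairs H)
         (\<lambda>(a,b). smul (delta H i a b) (mul H (Sop H (basis H a)) (basis H b)))
        = smul (eps H i) (one H)) \<and>
     (\<forall>i<dim H. vsumover (pairs H)
         (\<lambda>(a,b). smul (delta H i a b) (mul H (basis H a) (Sop H (basis H b))))
        = smul (eps H i) (one H)) \<and>
     \<comment> \<open>bijective antipode\<close>
     bij_betw (Sop H) (vecs H) (vecs H)"

definition quasitriangular :: "('k::field, 'z) hopf_scheme \<Rightarrow> 'k ten2 \<Rightarrow> bool" where
  "quasitriangular H R \<longleftrightarrow>
     R \<in> ten2s H \<and>
     (\<exists>Rinv\<in>ten2s H. mul2 H R Rinv = one2 H \<and> mul2 H Rinv R = one2 H \<and>
        (\<forall>x\<in>vecs H. flip2 (cop H x) = mul2 H (mul2 H R (cop H x)) Rinv)) \<and>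
     cop_left H R = mul3 H (leg13 H R) (leg23 H R) \<and>
     cop_right H R = mul3 H (leg13 H R) (leg12 H R)"

definition monodromy :: "('k::field, 'z) hopf_scheme \<Rightarrow> 'k ten2 \<Rightarrow> 'k ten2" where
  "monodromy H R = mul2 H (flip2 R) R"

definition drinfeld_u :: "('k::field, 'z) hopf_scheme \<Rightarrow> 'k ten2 \<Rightarrow> 'k vec" where
  "drinfeld_u H R = vsumover (pairs H) (\<lambda>(a,b). smul (R a b) (mul H (Sop H (basis H b)) (basis H a)))"

definition ribbon_element :: "('k::field, 'z) hopf_scheme \<Rightarrow> 'k ten2 \<Rightarrow> 'k vec \<Rightarrow> bool" where
  "ribbon_element H R v \<longleftrightarrow>
     v \<in> vecs H \<and>
     (\<forall>x\<in>vecs H. mul H v x = mul H x v) \<and>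
     (\<exists>w\<in>vecs H. mul H v w = one H \<and> mul H w v = one H) \<and>
     Sop H v = v \<and> counit H v = 1 \<and>
     (let u = drinfeld_u H R; uSu = mul H u (Sop H u) in
        mul H (mul H v v) uSu = one H \<and> mul H uSu (mul H v v) = one H) \<and>
     cop H v = mul2 H (tens H v v) (monodromy H R)"

definition Phibar :: "('k::field, 'z) hopf_scheme \<Rightarrow> 'k ten2 \<Rightarrow> 'k vec \<Rightarrow> 'k vec" where
  "Phibar H R phi = vsumover (pairs H) (\<lambda>(a,b). smul (monodromy H R a b * phi a) (basis H b))"

definition factorizable :: "('k::field, 'z) hopf_scheme \<Rightarrow> 'k ten2 \<Rightarrow> bool" where
  "factorizable H R \<longleftrightarrow> bij_betw (Phibar H R) (vecs H) (vecs H)"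

definition nonzero_right_integral :: "('k::field, 'z) hopf_scheme \<Rightarrow> 'k vec \<Rightarrow> bool" where
  "nonzero_right_integral H rho \<longleftrightarrow>
     rho \<in> vecs H \<and> (\<exists>i<dim H. rho i \<noteq> 0) \<and>
     (\<forall>i<dim H. vsumover (pairs H) (\<lambda>(a,b). smul (delta H i a b * rho a) (basis H b))
                 = smul (rho i) (one H))"

definition factorizable_ribbon_hopf ::
  "('k::field, 'z) hopf_scheme \<Rightarrow> 'k ten2 \<Rightarrow> 'k vec \<Rightarrow> bool" where
  "factorizable_ribbon_hopf H R v \<longleftrightarrow>
     hopf_algebra H \<and> quasitriangular H R \<and> ribbon_element H R v \<and> factorizable H R"

definition tuples :: "nat \<Rightarrow> nat \<Rightarrow> nat list set" where
  "tuples d n = {xs. length xs = n \<and> set xs \<subseteq> {..<d}}"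

text \<open>C^n(A,A) (and, with the same representation, Hom(A^(tensor n), A^*))\<close>
definition cochains :: "('k::field, 'z) hopf_scheme \<Rightarrow> nat \<Rightarrow> 'k coch set" where
  "cochains H n = {f. \<forall>xs k. xs \<notin> tuples (dim H) n \<or> dim H \<le> k \<longrightarrow> f xs k = 0}"

definition rc :: "('k::field, 'z) hopf_scheme \<Rightarrow> nat \<Rightarrow> (nat list \<Rightarrow> 'k vec) \<Rightarrow> 'k coch" where
  "rc H n F = (\<lambda>xs k. if xs \<in> tuples (dim H) n \<and> k < dim H then F xs k else 0)"

definition cadd :: "'k::field coch \<Rightarrow> 'k coch \<Rightarrow> 'k coch" where
  "cadd f g = (\<lambda>xs k. f xs k + g xs k)"

definition cdiff :: "'k::field coch \<Rightarrow> 'k coch \<Rightarrow> 'k coch" where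
  "cdiff f g = (\<lambda>xs k. f xs k - g xs k)"

definition csmul :: "'k::field \<Rightarrow> 'k coch \<Rightarrow> 'k coch" where
  "csmul c f = (\<lambda>xs k. c * f xs k)"

definition czero :: "'k::field coch" where
  "czero = (\<lambda>xs k. 0)"

definition hoch_d :: "('k::field, 'z) hopf_scheme \<Rightarrow> nat \<Rightarrow> 'k coch \<Rightarrow> 'k coch" where
  "hoch_d H n f = rc H (Suc n) (\<lambda>xs.
     vadd (vadd (mul H (basis H (hd xs)) (f (tl xs)))
                (vsumover {1..n} (\<lambda>i. smul ((-1) ^ i)
                   (vsumover {..<dim H} (\<lambda>k. smul (mu H (xs ! (i - 1)) (xs ! i) k)
                        (f (take (i - 1) xs @ k # drop (i + 1) xs)))))))
          (smul ((-1) ^ Suc n) (mul H (f (butlast xs)) (basis H (last xs)))))"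

definition frakT :: "('k::field, 'z) hopf_scheme \<Rightarrow> 'k vec \<Rightarrow> nat \<Rightarrow> 'k coch \<Rightarrow> 'k coch" where
  "frakT H v n f = rc H n (\<lambda>xs. mul H v (f xs))"

definition delta3 :: "('k::field, 'z) hopf_scheme \<Rightarrow> nat \<Rightarrow> nat \<Rightarrow> nat \<Rightarrow> nat \<Rightarrow> 'k" where
  "delta3 H i j k l = (\<Sum>m<dim H. delta H i m l * delta H m j k)"

definition coef3 :: "('k::field, 'z) hopf_scheme \<Rightarrow> nat list \<Rightarrow> nat list \<Rightarrow> nat list \<Rightarrow> nat list \<Rightarrow> 'k" where
  "coef3 H xs js ks ls = (\<Prod>t<length xs. delta3 H (xs ! t) (js ! t) (ks ! t) (ls ! t))"

definition T3 :: "('k::field, 'z) hopf_scheme \<Rightarrow> nat \<Rightarrow> (nat list \<times> nat list \<times> nat list) set" where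
  "T3 H n = tuples (dim H) n \<times> tuples (dim H) n \<times> tuples (dim H) n"

definition iota_n :: "('k::field, 'z) hopf_scheme \<Rightarrow> 'k vec \<Rightarrow> nat \<Rightarrow> 'k coch \<Rightarrow> 'k coch" where
  "iota_n H rho n f = rc H n (\<lambda>xs b. dual_apply H rho (mul H (f xs) (basis H b)))"

definition Phibar_n :: "('k::field, 'z) hopf_scheme \<Rightarrow> 'k ten2 \<Rightarrow> nat \<Rightarrow> 'k coch \<Rightarrow> 'k coch" where
  "Phibar_n H R n g = rc H n (\<lambda>xs. vsumover (T3 H n) (\<lambda>(js, ks, ls).
     smul (coef3 H xs js ks ls)
       (vsumover (pairs H) (\<lambda>(a, b).
          smul (monodromy H R a b *
                dual_apply H (g ks)
                  (mul H (basis H a) (prodlist H (rev (map (\<lambda>j. Sinv H (basis H j)) js)))))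
               (mul H (prodlist H (map (basis H) ls)) (basis H b))))))"

definition S_n :: "('k::field, 'z) hopf_scheme \<Rightarrow> nat \<Rightarrow> 'k coch \<Rightarrow> 'k coch" where
  "S_n H n h = rc H n (\<lambda>xs. vsumover (T3 H n) (\<lambda>(js, ks, ls).
     smul (coef3 H xs js ks ls)
       (mul H (mul H (prodlist H (map (basis H) js)) (Sop H (h ks)))
              (prodlist H (map (basis H) ls)))))"

definition frakS :: "('k::field, 'z) hopf_scheme \<Rightarrow> 'k ten2 \<Rightarrow> 'k vec \<Rightarrow> nat \<Rightarrow> 'k coch \<Rightarrow> 'k coch" where
  "frakS H R rho n f = S_n H n (Phibar_n H R n (iota_n H rho n f))"

end

(* Write S(a) = rho(a Q_1) S(Q_2) in degree 0, let T be multiplication by v and P(x) = rho(x_(1) v) x_(2).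
   Because Q = (v^-1 (x) v^-1) Delta(v), the identity rho(x y_(1)) S(y_(2)) = rho(x_(1) y) x_(2) turns S
   into T^-1 P T^-1, while (id (x) Delta)(Q) = R_21 Q_13 R_12 and Q_1 rho(S(Q_2) v) = rho(v) v^-1 give
   P S = rho(v) S T^-1.  Together these are the first relation.

   For the second one let S' be S with Q^-1 in place of Q.  Then S = kappa S' with
   kappa(b) = R_2 u S^-1(b) R_1, and kappa^2(b) = S(w_(1)) b w_(2) for w = v^-1.  The composite S' S is
   T conv(theta) T^-1 for a functional theta.  By the first relation S^2 commutes with T, hence so does S' S,
   and factorizability then forces theta to be a multiple lam of the counit.  So S^4 = lam^2 kappa^2, and
   comparing the integrals rho(Q_1) Q_2 and Q_1 rho(S(Q_2)) gives lam^2 = ((rho (x) rho)(Q))^2.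

   In degree n the map f |-> f(a_(2)) S^-1(a_(1)), a_(i) standing for products over all arguments, conjugates
   the n-th component to composition with its degree 0 version, and the Hochschild complex to the complex
   with left action a.x = a_(2) x S^-1(a_(1)) and trivial right action.  There kappa^2 is the action of the
   central element w, and the alternating sum of the insertions of w between the arguments is a homotopy from
   this action to multiplication by eps(w) = 1. *)
theory Submission
  imports Defs
begin

section \<open>Multilinear forms on the coordinate space\<close>

text \<open>Two nondegeneracies drive everything: that of the form rho(ab), deduced from the
  integral property, and that of Q, which is factorizability. The integrals in A are built from rho
  through Q, and their properties come from these two facts. The obstacle is to recognise theta as a
  multiple of the counit. The word S T S T S can be contracted with the first relation at either
  end; comparing the results and dividing by rho(v), which is nonzero because Q is nondegenerate,
  makes S^2 commute with T. Commuting with w is a strong condition because Delta(w) contains Q^-1: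
  it determines theta(Q^-1_1) Q^-1_2. The scalar is lam = rho(v) rho(w), and S^2 = lam kappa in
  degree 0. The adjoint action kappa^2 need not be the identity on cochains, hence the homotopy;
  eps(w) = 1 is what leaves the identity at its other end. The twist by S^-1 makes the right action
  trivial, so that the last face becomes a counit.\<close>

text \<open>Vectors are arbitrary functions on the naturals; the operations of Defs ignore the
  coordinates beyond the dimension, and so do linear forms in the sense of lin.\<close>

definition trunc :: "('k::field, 'z) hopf_scheme \<Rightarrow> 'k vec \<Rightarrow> 'k vec" where
  "trunc H x = (\<lambda>k. if k < dim H then x k else 0)"

definition lin :: "('k::field, 'z) hopf_scheme \<Rightarrow> ('k vec \<Rightarrow> 'k) \<Rightarrow> bool" where
  "lin H F \<longleftrightarrow> (\<forall>x. F x = (\<Sum>i<dim H. x i * F (basis H i)))"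

text \<open>Testing through functionals reduces linearity to \<open>lin\<close> and puts no
  condition on coordinates beyond the dimension.\<close>

definition vlin :: "('k::field, 'z) hopf_scheme \<Rightarrow> ('k vec \<Rightarrow> 'k vec) \<Rightarrow> bool" where
  "vlin H t \<longleftrightarrow> (\<forall>phi. lin H (\<lambda>x. dual_apply H phi (t x)))"

text \<open>An identity in a tensor power of A is stated as equality of all multilinear forms on both
  sides: teval H (cop H a) F is the Sweedler sum of F over the two legs of the coproduct of a.\<close>

definition teval :: "('k::field, 'z) hopf_scheme \<Rightarrow> 'k ten2 \<Rightarrow> ('k vec \<Rightarrow> 'k vec \<Rightarrow> 'k) \<Rightarrow> 'k" where
  "teval H X F = (\<Sum>i<dim H. \<Sum>j<dim H. X i j * F (basis H i) (basis H j))"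

definition tevalv :: "('k::field, 'z) hopf_scheme \<Rightarrow> 'k ten2 \<Rightarrow> ('k vec \<Rightarrow> 'k vec \<Rightarrow> 'k vec) \<Rightarrow> 'k vec" where
  "tevalv H X G = (\<lambda>k. if k < dim H then teval H X (\<lambda>x y. G x y k) else 0)"

definition teval3 :: "('k::field, 'z) hopf_scheme \<Rightarrow> 'k ten3 \<Rightarrow> ('k vec \<Rightarrow> 'k vec \<Rightarrow> 'k vec \<Rightarrow> 'k) \<Rightarrow> 'k" where
  "teval3 H X F = (\<Sum>i<dim H. \<Sum>j<dim H. \<Sum>k<dim H. X i j k * F (basis H i) (basis H j) (basis H k))"

definition bilin :: "('k::field, 'z) hopf_scheme \<Rightarrow> ('k vec \<Rightarrow> 'k vec \<Rightarrow> 'k) \<Rightarrow> bool" where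
  "bilin H F \<longleftrightarrow> (\<forall>y. lin H (\<lambda>x. F x y)) \<and> (\<forall>x. lin H (\<lambda>y. F x y))"

lemma basis_sum: "k < dim H \<Longrightarrow> (\<Sum>i<dim H. x i * basis H i k) = x k"
  by (simp add: basis_def if_distrib[of "(*) _"] sum.delta cong: if_cong conj_cong)

lemma lin_expand: "lin H F \<Longrightarrow> F x = (\<Sum>i<dim H. x i * F (basis H i))"
  unfolding lin_def by blast

lemma lin_trunc: "lin H F \<Longrightarrow> F (trunc H x) = F x"
  by (subst (1 2) lin_expand[of H F]) (simp_all add: trunc_def)

lemma dual_apply_trunc[simp]: "dual_apply H phi (trunc H x) = dual_apply H phi x"
  by (simp add: dual_apply_def trunc_def)
lemma mul_trunc1[simp]: "mul H (trunc H x) y = mul H x y"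
  by (simp add: mul_def trunc_def cong: if_cong)
lemma mul_trunc2[simp]: "mul H x (trunc H y) = mul H x y"
  by (simp add: mul_def trunc_def cong: if_cong)
lemma cop_trunc[simp]: "cop H (trunc H x) = cop H x"
  by (simp add: cop_def trunc_def cong: if_cong)
lemma Sop_trunc[simp]: "Sop H (trunc H x) = Sop H x"
  by (simp add: Sop_def trunc_def cong: if_cong)
lemma counit_trunc[simp]: "counit H (trunc H x) = counit H x"
  by (simp add: counit_def trunc_def)
lemma trunc_vecs[simp]: "trunc H x \<in> vecs H" by (simp add: trunc_def vecs_def)
lemma trunc_id: "x \<in> vecs H \<Longrightarrow> trunc H x = x" by (auto simp: trunc_def vecs_def fun_eq_iff not_less)
lemma mul_vecs[simp]: "mul H x y \<in> vecs H" by (simp add: mul_def vecs_def)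
lemma one_vecs[simp]: "one H \<in> vecs H" by (simp add: one_def vecs_def)
lemma Sop_vecs[simp]: "Sop H x \<in> vecs H" by (simp add: Sop_def vecs_def)
lemma tevalv_vecs[simp]: "tevalv H X G \<in> vecs H" by (simp add: tevalv_def vecs_def)
lemma basis_vecs[simp]: "basis H i \<in> vecs H" by (simp add: basis_def vecs_def)
lemma smul_vecs: "x \<in> vecs H \<Longrightarrow> smul c x \<in> vecs H" by (simp add: smul_def vecs_def)
lemma vadd_vecs: "x \<in> vecs H \<Longrightarrow> y \<in> vecs H \<Longrightarrow> vadd x y \<in> vecs H" by (simp add: vadd_def vecs_def)

lemma dual_basis: "i < dim H \<Longrightarrow> dual_apply H (basis H i) x = x i"
  by (simp add: dual_apply_def basis_def if_distrib[of "\<lambda>x. x * _"] sum.delta cong: if_cong conj_cong)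

lemma vec_eqI:
  assumes "x \<in> vecs H" "y \<in> vecs H" "\<And>phi. dual_apply H phi x = dual_apply H phi y"
  shows "x = y"
proof
  fix k show "x k = y k"
    using assms(1,2) assms(3)[of "basis H k"] dual_basis[of k H]
    by (cases "k < dim H") (auto simp: vecs_def not_less)
qed

lemma dual_apply_tevalv: "dual_apply H phi (tevalv H X G) = teval H X (\<lambda>x y. dual_apply H phi (G x y))"
proof -
  have "dual_apply H phi (tevalv H X G)
      = (\<Sum>k<dim H. \<Sum>i<dim H. \<Sum>j<dim H. phi k * (X i j * G (basis H i) (basis H j) k))"
    by (simp add: dual_apply_def tevalv_def teval_def sum_distrib_left)
  also have "\<dots> = (\<Sum>i<dim H. \<Sum>k<dim H. \<Sum>j<dim H. phi k * (X i j * G (basis H i) (basis H j) k))"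
    by (rule sum.swap)
  also have "\<dots> = (\<Sum>i<dim H. \<Sum>j<dim H. \<Sum>k<dim H. phi k * (X i j * G (basis H i) (basis H j) k))"
    by (rule sum.cong[OF refl]) (rule sum.swap)
  also have "\<dots> = teval H X (\<lambda>x y. dual_apply H phi (G x y))"
    by (simp add: dual_apply_def teval_def sum_distrib_left mult_ac)
  finally show ?thesis .
qed

lemma lin_dual0: "lin H (dual_apply H phi)"
  by (simp add: lin_def dual_apply_def[of H phi] dual_apply_def[of H phi "basis H _"] basis_def if_distrib[of "(*) _"] sum.delta mult_ac cong: if_cong conj_cong)

lemma lin_comp: "lin H F \<Longrightarrow> vlin H t \<Longrightarrow> lin H (\<lambda>x. F (t x))"
proof -
  assume F: "lin H F" and t: "vlin H t"
  have tk: "t x k = (\<Sum>i<dim H. x i * t (basis H i) k)" if "k < dim H" for x k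
    using lin_expand[OF t[unfolded vlin_def, rule_format, of "basis H k"], of x] unfolding dual_basis[OF that] .
  show "lin H (\<lambda>x. F (t x))"
    unfolding lin_def
  proof
    fix x
    have "F (t x) = (\<Sum>k<dim H. (\<Sum>i<dim H. x i * t (basis H i) k) * F (basis H k))"
      unfolding lin_expand[OF F, of "t x"] by (intro sum.cong refl) (subst tk, simp_all)
    also have "\<dots> = (\<Sum>i<dim H. \<Sum>k<dim H. x i * (t (basis H i) k * F (basis H k)))"
      by (simp add: sum_distrib_right mult.assoc) (rule sum.swap)
    also have "\<dots> = (\<Sum>i<dim H. x i * F (t (basis H i)))"
      by (intro sum.cong refl) (subst lin_expand[OF F, of "t _"], simp add: sum_distrib_left)
    finally show "F (t x) = (\<Sum>i<dim H. x i * F (t (basis H i)))" .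
  qed
qed

lemma vlin_comp: "vlin H F \<Longrightarrow> vlin H t \<Longrightarrow> vlin H (\<lambda>x. F (t x))"
  using lin_comp unfolding vlin_def by blast

lemma lin_dual: "vlin H t \<Longrightarrow> lin H (\<lambda>x. dual_apply H phi (t x))"
  by (simp add: vlin_def)

lemma vlin_id: "vlin H (\<lambda>x. x)" by (simp add: vlin_def lin_dual0)

lemma linI: "(\<And>x. F x = (\<Sum>i<dim H. x i * F (basis H i))) \<Longrightarrow> lin H F"
  unfolding lin_def by blast

lemma lin_add: "lin H F \<Longrightarrow> lin H G \<Longrightarrow> lin H (\<lambda>x. F x + G x)"
  by (rule linI, subst lin_expand[of H F], assumption, subst lin_expand[of H G], assumption) (simp add: algebra_simps sum.distrib)
lemma lin_diff: "lin H F \<Longrightarrow> lin H G \<Longrightarrow> lin H (\<lambda>x. F x - G x)"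
  by (rule linI, subst lin_expand[of H F], assumption, subst lin_expand[of H G], assumption) (simp add: algebra_simps sum_subtractf)
lemma lin_mulc1: "lin H F \<Longrightarrow> lin H (\<lambda>x. F x * c)"
  by (rule linI, subst lin_expand[of H F], assumption) (simp add: sum_distrib_right mult.assoc)
lemma lin_mulc2: "lin H F \<Longrightarrow> lin H (\<lambda>x. c * F x)"
  using lin_mulc1[of H F c] by (simp add: mult.commute)
lemma lin_zero: "lin H (\<lambda>x. 0)" by (simp add: lin_def)
lemma lin_sum: "(\<And>i. i \<in> A \<Longrightarrow> lin H (F i)) \<Longrightarrow> lin H (\<lambda>x. \<Sum>i\<in>A. F i x)"
  by (induction A rule: infinite_finite_induct) (auto intro: lin_add lin_zero)
lemma lin_teval: "(\<And>p q. lin H (\<lambda>x. G x p q)) \<Longrightarrow> lin H (\<lambda>x. teval H X (G x))"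
  unfolding teval_def by (intro lin_sum lin_mulc2)
lemma lin_counit0: "lin H (counit H)"
  by (simp add: lin_def counit_def[of H] counit_def[of H "basis H _"] basis_def if_distrib[of "\<lambda>x. x * _"] sum.delta cong: if_cong conj_cong)
lemma lin_counit: "vlin H t \<Longrightarrow> lin H (\<lambda>x. counit H (t x))"
  by (rule lin_comp[OF lin_counit0])

lemma vlinI: "(\<And>k. k < dim H \<Longrightarrow> lin H (\<lambda>x. t x k)) \<Longrightarrow> vlin H t"
  unfolding vlin_def dual_apply_def by (auto intro!: lin_sum lin_mulc2)
lemma lin_coord: "k < dim H \<Longrightarrow> lin H (\<lambda>x. x k)"
  by (simp add: lin_def basis_sum)

lemma lin_coordt: "vlin H t \<Longrightarrow> k < dim H \<Longrightarrow> lin H (\<lambda>x. t x k)"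
  by (rule lin_comp[OF lin_coord])

lemma vlin_mul1: "vlin H t \<Longrightarrow> vlin H (\<lambda>x. mul H (t x) c)"
  by (rule vlinI) (auto simp: mul_def intro!: lin_sum lin_mulc1 lin_coordt)
lemma vlin_mul2: "vlin H t \<Longrightarrow> vlin H (\<lambda>x. mul H c (t x))"
  by (rule vlinI) (auto simp: mul_def intro!: lin_sum lin_mulc1 lin_mulc2 lin_coordt)
lemma vlin_Sop: "vlin H t \<Longrightarrow> vlin H (\<lambda>x. Sop H (t x))"
  by (rule vlinI) (auto simp: Sop_def intro!: lin_sum lin_mulc1 lin_mulc2 lin_coordt)
lemma vlin_tevalv: "(\<And>p q. vlin H (\<lambda>x. G x p q)) \<Longrightarrow> vlin H (\<lambda>x. tevalv H X (G x))"
  by (simp add: vlin_def dual_apply_tevalv lin_teval)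
lemma vlin_trunc: "vlin H t \<Longrightarrow> vlin H (\<lambda>x. trunc H (t x))"
  by (simp add: vlin_def)
lemma dual_apply_smul: "dual_apply H phi (smul c x) = c * dual_apply H phi x"
  by (simp add: dual_apply_def smul_def sum_distrib_left mult_ac)
lemma dual_apply_vadd: "dual_apply H phi (vadd x y) = dual_apply H phi x + dual_apply H phi y"
  by (simp add: dual_apply_def vadd_def algebra_simps sum.distrib)
lemma vlin_smul1: "lin H F \<Longrightarrow> vlin H (\<lambda>x. smul (F x) c)"
  by (simp add: vlin_def dual_apply_smul lin_mulc1)
lemma vlin_smul2: "vlin H t \<Longrightarrow> vlin H (\<lambda>x. smul c (t x))"
  by (simp add: vlin_def dual_apply_smul lin_mulc2)
lemma vlin_vadd: "vlin H t \<Longrightarrow> vlin H s \<Longrightarrow> vlin H (\<lambda>x. vadd (t x) (s x))"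
  by (simp add: vlin_def dual_apply_vadd lin_add)

lemma lin_cop: "vlin H t \<Longrightarrow> lin H (\<lambda>x. teval H (cop H (t x)) G)"
proof (rule lin_comp[where F = "\<lambda>x. teval H (cop H x) G"])
  show "lin H (\<lambda>x. teval H (cop H x) G)"
    unfolding teval_def by (intro lin_sum lin_mulc1) (auto simp: cop_def intro!: lin_sum lin_mulc1 lin_coord)
qed
lemma vlin_cop: "vlin H t \<Longrightarrow> vlin H (\<lambda>x. tevalv H (cop H (t x)) G)"
  by (simp add: vlin_def dual_apply_tevalv lin_cop)

lemmas lin_intros = lin_cop vlin_cop lin_teval vlin_tevalv lin_dual lin_counit lin_mulc1 lin_mulc2 lin_add lin_diff
  vlin_id vlin_mul1 vlin_mul2 vlin_Sop vlin_trunc vlin_smul1 vlin_smul2 vlin_vadd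

lemma bilin_left: "bilin H F \<Longrightarrow> vlin H t \<Longrightarrow> lin H (\<lambda>x. F (t x) c)"
  unfolding bilin_def by (auto intro: lin_comp[where F = "\<lambda>x. F x c"])
lemma bilin_right: "bilin H F \<Longrightarrow> vlin H t \<Longrightarrow> lin H (\<lambda>x. F c (t x))"
  unfolding bilin_def by (auto intro: lin_comp)

lemma teval_swap: "teval H X (\<lambda>p q. teval H Y (F p q)) = teval H Y (\<lambda>r s. teval H X (\<lambda>p q. F p q r s))"
proof -
  have *: "teval H X F = (\<Sum>(i,j)\<in>{..<dim H}\<times>{..<dim H}. X i j * F (basis H i) (basis H j))" for X F
    by (simp add: teval_def sum.cartesian_product)
  show ?thesis unfolding * sum_distrib_left case_prod_unfold
    by (subst sum.swap) (simp add: mult_ac)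
qed

lemma teval_mulc1: "teval H X (\<lambda>p q. F p q * c) = teval H X F * c"
  unfolding teval_def sum_distrib_right by (simp only: mult.assoc)
lemma teval_mulc2: "teval H X (\<lambda>p q. c * F p q) = c * teval H X F"
proof -
  have "(\<lambda>p q. c * F p q) = (\<lambda>p q. F p q * c)" by (simp only: mult.commute)
  then show ?thesis using teval_mulc1[of H X F c] by (simp only: mult.commute)
qed
lemma teval_sum: "teval H X (\<lambda>p q. \<Sum>k\<in>K. F k p q) = (\<Sum>k\<in>K. teval H X (F k))"
  unfolding teval_def sum_distrib_left
  by (simp only: sum.swap[of _ K])

text \<open>\<open>F\<close> is represented by its values on the basis, so
  \<open>dual_apply_tevalv\<close> applies. Vectors defined by Sweedler sums, such as
  \<open>kappa\<close> or \<open>S0\<close>, are turned into scalar sums in this way.\<close>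

lemma teval_lin: "lin H F \<Longrightarrow> teval H X (\<lambda>p q. F (G p q)) = F (tevalv H X G)"
proof -
  assume F: "lin H F"
  have "F (tevalv H X G) = dual_apply H (\<lambda>k. F (basis H k)) (tevalv H X G)"
    unfolding dual_apply_def by (subst lin_expand[OF F]) (simp only: mult.commute)
  also have "\<dots> = teval H X (\<lambda>p q. dual_apply H (\<lambda>k. F (basis H k)) (G p q))" by (rule dual_apply_tevalv)
  also have "\<dots> = teval H X (\<lambda>p q. F (G p q))"
    unfolding teval_def by (intro sum.cong refl) (subst (2) lin_expand[OF F], simp add: dual_apply_def mult_ac)
  finally show ?thesis by simp
qed

lemma teval_flip: "teval H (flip2 X) F = teval H X (\<lambda>p q. F q p)"
  unfolding teval_def flip2_def by (rule sum.swap)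

lemma bilin_expand: "bilin H F \<Longrightarrow> F x y = (\<Sum>i<dim H. \<Sum>j<dim H. x i * y j * F (basis H i) (basis H j))"
proof -
  assume F: "bilin H F"
  have "F x y = (\<Sum>i<dim H. x i * F (basis H i) y)" using F unfolding bilin_def lin_def by blast
  moreover have "F (basis H i) y = (\<Sum>j<dim H. y j * F (basis H i) (basis H j))" for i
    using F unfolding bilin_def lin_def by blast
  ultimately show ?thesis by (simp add: sum_distrib_left mult_ac)
qed

lemma teval_tens: "bilin H F \<Longrightarrow> teval H (tens H x y) F = F x y"
  by (simp add: teval_def tens_def bilin_expand)

lemma sum_basis: "(\<Sum>i<dim H. basis H a i * g i) = (if a < dim H then g a else 0)"
  by (simp add: basis_def if_distrib[of "\<lambda>x. x * _"] sum.delta cong: if_cong conj_cong)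

lemma mul_basis: "i < dim H \<Longrightarrow> j < dim H \<Longrightarrow> k < dim H \<Longrightarrow> mul H (basis H i) (basis H j) k = mu H i j k"
  by (simp add: mul_def mult.assoc sum_distrib_left[symmetric] sum_basis)

lemma cop_basis: "i < dim H \<Longrightarrow> j < dim H \<Longrightarrow> k < dim H \<Longrightarrow> cop H (basis H i) j k = delta H i j k"
  by (simp add: cop_def sum_basis)

lemma sum_move2: "(\<Sum>p\<in>P. \<Sum>a\<in>A. \<Sum>b\<in>B. g p a b) = (\<Sum>a\<in>A. \<Sum>b\<in>B. \<Sum>p\<in>P. g p a b)"
  by (rule trans[OF sum.swap], rule sum.cong[OF refl], rule sum.swap)
lemma sum_move4: "(\<Sum>p\<in>P. \<Sum>a\<in>A. \<Sum>b\<in>B. \<Sum>c\<in>C. \<Sum>e\<in>E. g p a b c e)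
    = (\<Sum>a\<in>A. \<Sum>b\<in>B. \<Sum>c\<in>C. \<Sum>e\<in>E. \<Sum>p\<in>P. g p a b c e)"
  by (rule trans[OF sum_move2], intro sum.cong refl, rule sum_move2)
lemma sum_move6: "(\<Sum>p\<in>P. \<Sum>a\<in>A. \<Sum>b\<in>B. \<Sum>c\<in>C. \<Sum>e\<in>E. \<Sum>u\<in>U. \<Sum>v\<in>V. g p a b c e u v)
    = (\<Sum>a\<in>A. \<Sum>b\<in>B. \<Sum>c\<in>C. \<Sum>e\<in>E. \<Sum>u\<in>U. \<Sum>v\<in>V. \<Sum>p\<in>P. g p a b c e u v)"
  by (rule trans[OF sum_move2], intro sum.cong refl, rule sum_move4)

text \<open>Bilinearity allows \<open>F\<close> to be expanded on products of basis vectors through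
  the structure constants; the rest is reordering of finite sums.\<close>

lemma teval_mul2:
  assumes F: "bilin H F"
  shows "teval H (mul2 H X Y) F = teval H X (\<lambda>a b. teval H Y (\<lambda>c e. F (mul H a c) (mul H b e)))"
proof -
  let ?D = "{..<dim H}"
  have 1: "F (mul H (basis H a) (basis H c)) (mul H (basis H b) (basis H e))
      = (\<Sum>p<dim H. \<Sum>q<dim H. mu H a c p * mu H b e q * F (basis H p) (basis H q))"
    if "a < dim H" "b < dim H" "c < dim H" "e < dim H" for a b c e
    using that by (subst bilin_expand[OF F]) (simp add: mul_basis)
  have "teval H (mul2 H X Y) F = (\<Sum>p\<in>?D. \<Sum>q\<in>?D. \<Sum>a\<in>?D. \<Sum>b\<in>?D. \<Sum>c\<in>?D. \<Sum>e\<in>?D.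
      X a b * (Y c e * (mu H a c p * mu H b e q * F (basis H p) (basis H q))))"
    by (simp add: teval_def mul2_def sum_distrib_right mult.assoc)
  also have "\<dots> = (\<Sum>a\<in>?D. \<Sum>b\<in>?D. \<Sum>c\<in>?D. \<Sum>e\<in>?D. \<Sum>p\<in>?D. \<Sum>q\<in>?D.
      X a b * (Y c e * (mu H a c p * mu H b e q * F (basis H p) (basis H q))))"
    by (rule trans[OF sum.cong[OF refl sum_move4] sum_move4])
  also have "\<dots> = (\<Sum>a\<in>?D. \<Sum>b\<in>?D. \<Sum>c\<in>?D. \<Sum>e\<in>?D.
      X a b * (Y c e * F (mul H (basis H a) (basis H c)) (mul H (basis H b) (basis H e))))"
    by (simp add: 1 sum_distrib_left)
  also have "\<dots> = teval H X (\<lambda>a b. teval H Y (\<lambda>c e. F (mul H a c) (mul H b e)))"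
    by (simp add: teval_def sum_distrib_left)
  finally show ?thesis .
qed

section \<open>Threefold tensors\<close>

definition trilin :: "('k::field, 'z) hopf_scheme \<Rightarrow> ('k vec \<Rightarrow> 'k vec \<Rightarrow> 'k vec \<Rightarrow> 'k) \<Rightarrow> bool" where
  "trilin H F \<longleftrightarrow> (\<forall>y z. lin H (\<lambda>x. F x y z)) \<and> (\<forall>x z. lin H (\<lambda>y. F x y z)) \<and> (\<forall>x y. lin H (\<lambda>z. F x y z))"

lemma trilin_expand: "trilin H F \<Longrightarrow> F x y z = (\<Sum>i<dim H. \<Sum>j<dim H. \<Sum>k<dim H. x i * y j * z k * F (basis H i) (basis H j) (basis H k))"
proof -
  assume F: "trilin H F"
  have "F x y z = (\<Sum>i<dim H. x i * F (basis H i) y z)" using F unfolding trilin_def lin_def by blast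
  moreover have "F (basis H i) y z = (\<Sum>j<dim H. \<Sum>k<dim H. y j * z k * F (basis H i) (basis H j) (basis H k))" for i
    using F by (intro bilin_expand) (simp add: bilin_def trilin_def)
  ultimately show ?thesis by (simp add: sum_distrib_left mult_ac)
qed

lemma teval3_mul3:
  assumes F: "trilin H F"
  shows "teval3 H (mul3 H X Y) F = teval3 H X (\<lambda>a b c. teval3 H Y (\<lambda>a' b' c'. F (mul H a a') (mul H b b') (mul H c c')))"
proof -
  let ?D = "{..<dim H}"
  have 1: "F (mul H (basis H a) (basis H a')) (mul H (basis H b) (basis H b')) (mul H (basis H c) (basis H c'))
      = (\<Sum>p<dim H. \<Sum>q<dim H. \<Sum>r<dim H. mu H a a' p * mu H b b' q * mu H c c' r * F (basis H p) (basis H q) (basis H r))"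
    if "a < dim H" "b < dim H" "c < dim H" "a' < dim H" "b' < dim H" "c' < dim H" for a b c a' b' c'
    using that by (subst trilin_expand[OF F]) (simp add: mul_basis)
  have "teval3 H (mul3 H X Y) F = (\<Sum>p\<in>?D. \<Sum>q\<in>?D. \<Sum>r\<in>?D. \<Sum>a\<in>?D. \<Sum>b\<in>?D. \<Sum>c\<in>?D. \<Sum>a'\<in>?D. \<Sum>b'\<in>?D. \<Sum>c'\<in>?D.
      X a b c * (Y a' b' c' * (mu H a a' p * mu H b b' q * mu H c c' r * F (basis H p) (basis H q) (basis H r))))"
    by (simp add: teval3_def mul3_def sum_distrib_right mult.assoc)
  also have "\<dots> = (\<Sum>a\<in>?D. \<Sum>b\<in>?D. \<Sum>c\<in>?D. \<Sum>a'\<in>?D. \<Sum>b'\<in>?D. \<Sum>c'\<in>?D. \<Sum>p\<in>?D. \<Sum>q\<in>?D. \<Sum>r\<in>?D.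
      X a b c * (Y a' b' c' * (mu H a a' p * mu H b b' q * mu H c c' r * F (basis H p) (basis H q) (basis H r))))"
    by (rule trans[OF sum.cong[OF refl trans[OF sum.cong[OF refl sum_move6] sum_move6]] sum_move6])
  also have "\<dots> = teval3 H X (\<lambda>a b c. teval3 H Y (\<lambda>a' b' c'. F (mul H a a') (mul H b b') (mul H c c')))"
    by (simp add: teval3_def 1 sum_distrib_left)
  finally show ?thesis .
qed

lemma one_expand: "lin H F \<Longrightarrow> F (one H) = (\<Sum>r<dim H. eta H r * F (basis H r))"
  by (subst lin_expand[of H F]) (auto simp: one_def)

lemma teval3_leg12: "(\<And>p q. lin H (F p q)) \<Longrightarrow> teval3 H (leg12 H X) F = teval H X (\<lambda>p q. F p q (one H))"
  by (simp add: teval3_def teval_def leg12_def one_expand sum_distrib_left mult_ac)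
lemma teval3_leg13:
  assumes F: "\<And>p q. lin H (\<lambda>r. F p r q)" shows "teval3 H (leg13 H X) F = teval H X (\<lambda>p q. F p (one H) q)"
proof -
  have "teval H X (\<lambda>p q. F p (one H) q) = (\<Sum>i<dim H. \<Sum>j<dim H. \<Sum>r<dim H. X i j * (eta H r * F (basis H i) (basis H r) (basis H j)))"
    using one_expand[OF F] by (simp add: teval_def sum_distrib_left)
  also have "\<dots> = (\<Sum>i<dim H. \<Sum>r<dim H. \<Sum>j<dim H. X i j * (eta H r * F (basis H i) (basis H r) (basis H j)))"
    by (rule sum.cong[OF refl]) (rule sum.swap)
  finally show ?thesis by (simp add: teval3_def leg13_def mult.assoc)
qed
lemma teval3_leg23:
  assumes F: "\<And>p q. lin H (\<lambda>r. F r p q)" shows "teval3 H (leg23 H X) F = teval H X (\<lambda>p q. F (one H) p q)"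
proof -
  have "teval H X (\<lambda>p q. F (one H) p q) = (\<Sum>i<dim H. \<Sum>j<dim H. \<Sum>r<dim H. X i j * (eta H r * F (basis H r) (basis H i) (basis H j)))"
    using one_expand[OF F] by (simp add: teval_def sum_distrib_left)
  also have "\<dots> = (\<Sum>i<dim H. \<Sum>r<dim H. \<Sum>j<dim H. X i j * (eta H r * F (basis H r) (basis H i) (basis H j)))"
    by (rule sum.cong[OF refl]) (rule sum.swap)
  also have "\<dots> = (\<Sum>r<dim H. \<Sum>i<dim H. \<Sum>j<dim H. X i j * (eta H r * F (basis H r) (basis H i) (basis H j)))"
    by (rule sum.swap)
  finally show ?thesis by (simp add: teval3_def leg23_def mult.left_commute mult.assoc)
qed

lemma teval3_cop_left: "teval3 H (cop_left H X) F = teval H X (\<lambda>x r. teval H (cop H x) (\<lambda>p q. F p q r))"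
proof -
  let ?D = "{..<dim H}"
  have "teval3 H (cop_left H X) F = (\<Sum>p\<in>?D. \<Sum>q\<in>?D. \<Sum>r\<in>?D. \<Sum>i\<in>?D. X i r * (delta H i p q * F (basis H p) (basis H q) (basis H r)))"
    by (simp add: teval3_def cop_left_def sum_distrib_right mult.assoc)
  also have "\<dots> = (\<Sum>r\<in>?D. \<Sum>i\<in>?D. \<Sum>p\<in>?D. \<Sum>q\<in>?D. X i r * (delta H i p q * F (basis H p) (basis H q) (basis H r)))"
    by (rule trans[OF sum.cong[OF refl sum_move2] sum_move2])
  also have "\<dots> = (\<Sum>i\<in>?D. \<Sum>r\<in>?D. \<Sum>p\<in>?D. \<Sum>q\<in>?D. X i r * (delta H i p q * F (basis H p) (basis H q) (basis H r)))"
    by (rule sum.swap)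
  finally show ?thesis by (simp add: teval_def cop_basis sum_distrib_left)
qed

lemma teval3_cop_right: "teval3 H (cop_right H X) F = teval H X (\<lambda>p x. teval H (cop H x) (\<lambda>q r. F p q r))"
proof -
  let ?D = "{..<dim H}"
  have *: "(\<Sum>q\<in>?D. \<Sum>r\<in>?D. \<Sum>i\<in>?D. X p i * (delta H i q r * F (basis H p) (basis H q) (basis H r)))
    = (\<Sum>i\<in>?D. \<Sum>q\<in>?D. \<Sum>r\<in>?D. X p i * (delta H i q r * F (basis H p) (basis H q) (basis H r)))" for p
  proof -
    have "(\<Sum>q\<in>?D. \<Sum>r\<in>?D. \<Sum>i\<in>?D. X p i * (delta H i q r * F (basis H p) (basis H q) (basis H r)))
      = (\<Sum>q\<in>?D. \<Sum>i\<in>?D. \<Sum>r\<in>?D. X p i * (delta H i q r * F (basis H p) (basis H q) (basis H r)))"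
      by (rule sum.cong[OF refl]) (rule sum.swap)
    also have "\<dots> = (\<Sum>i\<in>?D. \<Sum>q\<in>?D. \<Sum>r\<in>?D. X p i * (delta H i q r * F (basis H p) (basis H q) (basis H r)))"
      by (rule sum.swap)
    finally show ?thesis .
  qed
  show ?thesis
    using * by (simp add: teval3_def cop_right_def teval_def cop_basis sum_distrib_left sum_distrib_right mult.assoc)
qed

lemma lin_eqI:
  assumes "lin H F" "lin H G" "\<And>i. i < dim H \<Longrightarrow> F (basis H i) = G (basis H i)"
  shows "F x = G x"
  by (subst lin_expand[OF assms(1)], subst lin_expand[OF assms(2)]) (simp add: assms(3))

lemma vsum_pairs: "vsumover (pairs H) (\<lambda>(a,b). smul (X a b) (G a b)) = (\<lambda>k. \<Sum>a<dim H. \<Sum>b<dim H. X a b * G a b k)"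
  by (simp add: vsumover_def pairs_def smul_def sum.cartesian_product case_prod_unfold)

lemma tevalv_vsum:
  assumes "\<And>a b. a < dim H \<Longrightarrow> b < dim H \<Longrightarrow> G (basis H a) (basis H b) \<in> vecs H"
  shows "vsumover (pairs H) (\<lambda>(a,b). smul (X a b) (G (basis H a) (basis H b))) = tevalv H X G"
proof
  fix k show "vsumover (pairs H) (\<lambda>(a,b). smul (X a b) (G (basis H a) (basis H b))) k = tevalv H X G k"
    using assms by (auto simp: vsum_pairs tevalv_def teval_def vecs_def not_less intro!: sum.neutral)
qed

lemma tevalv_cop_basis:
  assumes "i < dim H" "\<And>x y. G x y \<in> vecs H"
  shows "tevalv H (cop H (basis H i)) G = vsumover (pairs H) (\<lambda>(a,b). smul (delta H i a b) (G (basis H a) (basis H b)))"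
  using assms by (subst tevalv_vsum) (auto simp: tevalv_def teval_def cop_basis)

lemma bilin_trunc:
  assumes "bilin H F" shows "F (trunc H x) y = F x y" "F x (trunc H y) = F x y"
  using assms lin_trunc[of H "\<lambda>x. F x y" x] lin_trunc[of H "F x" y] by (simp_all add: bilin_def)

lemma counit_basis: "i < dim H \<Longrightarrow> counit H (basis H i) = eps H i"
  by (simp add: counit_def sum_basis)

section \<open>Hopf algebras\<close>

locale hopf =
  fixes H :: "('k::field, 'z) hopf_scheme"
  assumes hopf: "hopf_algebra H"
begin

abbreviation mult (infixl "\<cdot>" 70) where "x \<cdot> y \<equiv> mul H x y"
abbreviation one' ("\<one>") where "\<one> \<equiv> one H"
abbreviation S where "S \<equiv> Sop H"
abbreviation \<epsilon> where "\<epsilon> \<equiv> counit H"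
abbreviation ev where "ev \<equiv> dual_apply H"
abbreviation D where "D x F \<equiv> teval H (cop H x) F"

text \<open>The axioms speak about \<open>vecs H\<close> only. The operations cannot see coordinates
  beyond the dimension, so passing through \<open>trunc\<close> removes the side condition and
  leaves an unconditional rewrite rule.\<close>

lemma assoc: "x \<cdot> y \<cdot> z = x \<cdot> (y \<cdot> z)"
proof -
  have "trunc H x \<cdot> trunc H y \<cdot> trunc H z = trunc H x \<cdot> (trunc H y \<cdot> trunc H z)"
    using hopf unfolding hopf_algebra_def by (blast intro: trunc_vecs)
  then show ?thesis by simp
qed

lemma one_l: "\<one> \<cdot> x = trunc H x" and one_r: "x \<cdot> \<one> = trunc H x"
proof -
  have "\<one> \<cdot> trunc H x = trunc H x" "trunc H x \<cdot> \<one> = trunc H x"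
    using hopf unfolding hopf_algebra_def by (blast intro: trunc_vecs)+
  then show "\<one> \<cdot> x = trunc H x" "x \<cdot> \<one> = trunc H x" by simp_all
qed

text \<open>\<open>F\<close> is arbitrary: both sides evaluate it at basis vectors only, so equality
  of the coefficient tensors suffices and rewriting never has to check linearity.\<close>

lemma coassoc: "D a (\<lambda>x z. D x (\<lambda>p q. F p q z)) = D a (\<lambda>p x. D x (\<lambda>q z. F p q z))"
proof -
  have "cop_left H (cop H (trunc H a)) = cop_right H (cop H (trunc H a))"
    using hopf unfolding hopf_algebra_def by (blast intro: trunc_vecs)
  then have "cop_left H (cop H a) = cop_right H (cop H a)" by simp
  from arg_cong[OF this, of "\<lambda>X. teval3 H X F"] show ?thesis
    by (simp add: teval3_cop_left teval3_cop_right)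
qed

lemma teval_basis: "i < dim H \<Longrightarrow> D (basis H i) F = (\<Sum>a<dim H. \<Sum>b<dim H. delta H i a b * F (basis H a) (basis H b))"
  by (simp add: teval_def cop_basis)

lemma counit_l: assumes F: "lin H F" shows "D a (\<lambda>x y. \<epsilon> x * F y) = F a"
proof (rule lin_eqI[where x = a])
  fix i assume i: "i < dim H"
  have "vsumover (pairs H) (\<lambda>(a,b). smul (delta H i a b * eps H a) (basis H b)) = basis H i"
    using hopf i unfolding hopf_algebra_def by blast
  then have "(\<lambda>k. \<Sum>a<dim H. \<Sum>b<dim H. delta H i a b * eps H a * basis H b k) = basis H i"
    by (simp only: vsum_pairs[where G = "\<lambda>a b. basis H b"])
  then have *: "(\<Sum>a<dim H. \<Sum>b<dim H. delta H i a b * eps H a * basis H b k) = basis H i k" for k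
    by (rule fun_cong)
  have "tevalv H (cop H (basis H i)) (\<lambda>x y. smul (\<epsilon> x) y) = basis H i"
  proof
    fix k show "tevalv H (cop H (basis H i)) (\<lambda>x y. smul (\<epsilon> x) y) k = basis H i k"
      using *[of k] basis_vecs[of H i] i by (auto simp: tevalv_def teval_basis counit_basis smul_def mult.assoc vecs_def not_less)
  qed
  moreover have "teval H (cop H (basis H i)) (\<lambda>x y. F (smul (\<epsilon> x) y)) = F (tevalv H (cop H (basis H i)) (\<lambda>x y. smul (\<epsilon> x) y))"
    by (rule teval_lin[OF F])
  moreover have "F (smul c y) = c * F y" for c y
    by (subst (1 2) lin_expand[OF F]) (simp add: smul_def sum_distrib_left mult.assoc)
  ultimately show "D (basis H i) (\<lambda>x y. \<epsilon> x * F y) = F (basis H i)" by simp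
qed (simp_all add: lin_intros F)

lemma counit_r: assumes F: "lin H F" shows "D a (\<lambda>x y. \<epsilon> y * F x) = F a"
proof (rule lin_eqI[where x = a])
  fix i assume i: "i < dim H"
  have "vsumover (pairs H) (\<lambda>(a,b). smul (delta H i a b * eps H b) (basis H a)) = basis H i"
    using hopf i unfolding hopf_algebra_def by blast
  then have "(\<lambda>k. \<Sum>a<dim H. \<Sum>b<dim H. delta H i a b * eps H b * basis H a k) = basis H i"
    by (simp only: vsum_pairs[where G = "\<lambda>a b. basis H a"])
  then have *: "(\<Sum>a<dim H. \<Sum>b<dim H. delta H i a b * eps H b * basis H a k) = basis H i k" for k
    by (rule fun_cong)
  have "tevalv H (cop H (basis H i)) (\<lambda>x y. smul (\<epsilon> y) x) = basis H i"
  proof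
    fix k show "tevalv H (cop H (basis H i)) (\<lambda>x y. smul (\<epsilon> y) x) k = basis H i k"
      using *[of k] basis_vecs[of H i] i by (auto simp: tevalv_def teval_basis counit_basis smul_def mult.assoc vecs_def not_less)
  qed
  moreover have "teval H (cop H (basis H i)) (\<lambda>x y. F (smul (\<epsilon> y) x)) = F (tevalv H (cop H (basis H i)) (\<lambda>x y. smul (\<epsilon> y) x))"
    by (rule teval_lin[OF F])
  moreover have "F (smul c y) = c * F y" for c y
    by (subst (1 2) lin_expand[OF F]) (simp add: smul_def sum_distrib_left mult.assoc)
  ultimately show "D (basis H i) (\<lambda>x y. \<epsilon> y * F x) = F (basis H i)" by simp
qed (simp_all add: lin_intros F)

lemma counit_l': "lin H F \<Longrightarrow> D a (\<lambda>x y. F y * \<epsilon> x) = F a"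
  using counit_l[of F a] by (simp add: mult.commute)
lemma counit_r': "lin H F \<Longrightarrow> D a (\<lambda>x y. F x * \<epsilon> y) = F a"
  using counit_r[of F a] by (simp add: mult.commute)

lemma D_mul: assumes F: "bilin H F" shows "D (x \<cdot> y) F = D x (\<lambda>p q. D y (\<lambda>r s. F (p \<cdot> r) (q \<cdot> s)))"
proof -
  have "cop H (mul H (trunc H x) (trunc H y)) = mul2 H (cop H (trunc H x)) (cop H (trunc H y))"
    using hopf unfolding hopf_algebra_def by (blast intro: trunc_vecs)
  then show ?thesis by (simp add: teval_mul2[OF F])
qed

lemma D_one: assumes F: "bilin H F" shows "D \<one> F = F \<one> \<one>"
proof -
  have "cop H \<one> = one2 H" using hopf unfolding hopf_algebra_def by blast
  then show ?thesis by (simp add: one2_def teval_tens[OF F])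
qed

lemma eps_mul: "\<epsilon> (x \<cdot> y) = \<epsilon> x * \<epsilon> y"
proof -
  have "\<epsilon> (mul H (trunc H x) (trunc H y)) = \<epsilon> (trunc H x) * \<epsilon> (trunc H y)"
    using hopf unfolding hopf_algebra_def by (blast intro: trunc_vecs)
  then show ?thesis by simp
qed

lemma eps_one: "\<epsilon> \<one> = 1" using hopf unfolding hopf_algebra_def by blast

lemma lin_smul: "lin H F \<Longrightarrow> F (smul c y) = c * F y"
  by (subst (1 2) lin_expand[of H F]) (simp_all add: smul_def sum_distrib_left mult.assoc)

lemma ant_l: assumes F: "lin H F" shows "D a (\<lambda>x y. F (S x \<cdot> y)) = \<epsilon> a * F \<one>"
proof (rule lin_eqI[where x = a])
  fix i assume i: "i < dim H"
  have *: "vsumover (pairs H) (\<lambda>(a,b). smul (delta H i a b) (mul H (Sop H (basis H a)) (basis H b))) = smul (eps H i) (one H)"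
    using hopf i unfolding hopf_algebra_def by blast
  have "tevalv H (cop H (basis H i)) (\<lambda>x y. S x \<cdot> y) = smul (eps H i) (one H)"
    using * by (simp add: tevalv_cop_basis i)
  then show "D (basis H i) (\<lambda>x y. F (S x \<cdot> y)) = \<epsilon> (basis H i) * F \<one>"
    by (simp add: teval_lin[OF F] lin_smul[OF F] counit_basis i)
qed (simp_all add: lin_intros F)

lemma ant_r: assumes F: "lin H F" shows "D a (\<lambda>x y. F (x \<cdot> S y)) = \<epsilon> a * F \<one>"
proof (rule lin_eqI[where x = a])
  fix i assume i: "i < dim H"
  have *: "vsumover (pairs H) (\<lambda>(a,b). smul (delta H i a b) (mul H (basis H a) (Sop H (basis H b)))) = smul (eps H i) (one H)"
    using hopf i unfolding hopf_algebra_def by blast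
  have "tevalv H (cop H (basis H i)) (\<lambda>x y. x \<cdot> S y) = smul (eps H i) (one H)"
    using * by (simp add: tevalv_cop_basis i)
  then show "D (basis H i) (\<lambda>x y. F (x \<cdot> S y)) = \<epsilon> (basis H i) * F \<one>"
    by (simp add: teval_lin[OF F] lin_smul[OF F] counit_basis i)
qed (simp_all add: lin_intros F)
text \<open>Instances of \<open>ant_l\<close> inside right-nested products, spelled out for the
  simplifier because the form \<open>F\<close> in \<open>ant_l\<close> would have to be
  guessed.\<close>

lemma dual_ant_l:
  "D a (\<lambda>x y. ev f (S x \<cdot> y)) = \<epsilon> a * ev f \<one>"
  "D a (\<lambda>x y. ev f (S x \<cdot> (y \<cdot> c))) = \<epsilon> a * ev f c"
  "D a (\<lambda>x y. ev f (b \<cdot> (S x \<cdot> y))) = \<epsilon> a * ev f b"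
  "D a (\<lambda>x y. ev f (b \<cdot> (S x \<cdot> (y \<cdot> c)))) = \<epsilon> a * ev f (b \<cdot> c)"
  "D a (\<lambda>x y. ev f (b \<cdot> (b1 \<cdot> (S x \<cdot> y)))) = \<epsilon> a * ev f (b \<cdot> b1)"
  "D a (\<lambda>x y. ev f (b \<cdot> (b1 \<cdot> (S x \<cdot> (y \<cdot> c))))) = \<epsilon> a * ev f (b \<cdot> (b1 \<cdot> c))"
  "D a (\<lambda>x y. ev f (b \<cdot> (b1 \<cdot> (b2 \<cdot> (S x \<cdot> y))))) = \<epsilon> a * ev f (b \<cdot> (b1 \<cdot> b2))"
  "D a (\<lambda>x y. ev f (b \<cdot> (b1 \<cdot> (b2 \<cdot> (S x \<cdot> (y \<cdot> c)))))) = \<epsilon> a * ev f (b \<cdot> (b1 \<cdot> (b2 \<cdot> c)))"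
  using ant_l[of "\<lambda>z. ev f z" a]
    ant_l[of "\<lambda>z. ev f (z \<cdot> c)" a]
    ant_l[of "\<lambda>z. ev f (b \<cdot> z)" a]
    ant_l[of "\<lambda>z. ev f (b \<cdot> (z \<cdot> c))" a]
    ant_l[of "\<lambda>z. ev f (b \<cdot> (b1 \<cdot> z))" a]
    ant_l[of "\<lambda>z. ev f (b \<cdot> (b1 \<cdot> (z \<cdot> c)))" a]
    ant_l[of "\<lambda>z. ev f (b \<cdot> (b1 \<cdot> (b2 \<cdot> z)))" a]
    ant_l[of "\<lambda>z. ev f (b \<cdot> (b1 \<cdot> (b2 \<cdot> (z \<cdot> c))))" a]
  by (simp_all add: lin_intros lin_dual0 one_l one_r assoc)

lemma dual_ant_r:
  "D a (\<lambda>x y. ev f (x \<cdot> S y)) = \<epsilon> a * ev f \<one>"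
  "D a (\<lambda>x y. ev f (x \<cdot> (S y \<cdot> c))) = \<epsilon> a * ev f c"
  "D a (\<lambda>x y. ev f (b \<cdot> (x \<cdot> S y))) = \<epsilon> a * ev f b"
  "D a (\<lambda>x y. ev f (b \<cdot> (x \<cdot> (S y \<cdot> c)))) = \<epsilon> a * ev f (b \<cdot> c)"
  "D a (\<lambda>x y. ev f (b \<cdot> (b1 \<cdot> (x \<cdot> S y)))) = \<epsilon> a * ev f (b \<cdot> b1)"
  "D a (\<lambda>x y. ev f (b \<cdot> (b1 \<cdot> (x \<cdot> (S y \<cdot> c))))) = \<epsilon> a * ev f (b \<cdot> (b1 \<cdot> c))"
  "D a (\<lambda>x y. ev f (b \<cdot> (b1 \<cdot> (b2 \<cdot> (x \<cdot> S y))))) = \<epsilon> a * ev f (b \<cdot> (b1 \<cdot> b2))"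
  "D a (\<lambda>x y. ev f (b \<cdot> (b1 \<cdot> (b2 \<cdot> (x \<cdot> (S y \<cdot> c)))))) = \<epsilon> a * ev f (b \<cdot> (b1 \<cdot> (b2 \<cdot> c)))"
  using ant_r[of "\<lambda>z. ev f z" a]
    ant_r[of "\<lambda>z. ev f (z \<cdot> c)" a]
    ant_r[of "\<lambda>z. ev f (b \<cdot> z)" a]
    ant_r[of "\<lambda>z. ev f (b \<cdot> (z \<cdot> c))" a]
    ant_r[of "\<lambda>z. ev f (b \<cdot> (b1 \<cdot> z))" a]
    ant_r[of "\<lambda>z. ev f (b \<cdot> (b1 \<cdot> (z \<cdot> c)))" a]
    ant_r[of "\<lambda>z. ev f (b \<cdot> (b1 \<cdot> (b2 \<cdot> z)))" a]
    ant_r[of "\<lambda>z. ev f (b \<cdot> (b1 \<cdot> (b2 \<cdot> (z \<cdot> c))))" a]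
  by (simp_all add: lin_intros lin_dual0 one_l one_r assoc)

lemmas lin_rules0 = lin_intros bilin_def lin_dual0 lin_counit0
lemmas teval_scalar = teval_mulc1 teval_mulc2
lemmas counit_rules = counit_l counit_r counit_l' counit_r'

text \<open>Uniqueness of convolution inverses: both sides invert the multiplication on A (x) A, one
  from the left and one from the right. The product S(x_(1) y_(1)) x_(2) y_(2) S(y_(3)) S(x_(3)) is
  collapsed at the front and at the back.\<close>

lemma S_mul: "S (x \<cdot> y) = S y \<cdot> S x"
proof (rule vec_eqI)
  fix f
  have "ev f (S y \<cdot> S x) = D x (\<lambda>a q. D y (\<lambda>b s. D (a \<cdot> b) (\<lambda>u v. ev f (S u \<cdot> (v \<cdot> (S s \<cdot> S q))))))"
    by (simp add: dual_ant_l eps_mul mult.assoc counit_rules teval_scalar lin_rules0)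
  also have "\<dots> = D x (\<lambda>a q. D y (\<lambda>b s. D a (\<lambda>p q'. D b (\<lambda>r s'. ev f (S (p \<cdot> r) \<cdot> (q' \<cdot> (s' \<cdot> (S s \<cdot> S q))))))))"
    by (simp add: D_mul lin_rules0 assoc)
  also have "\<dots> = D x (\<lambda>a q. D a (\<lambda>p q'. D y (\<lambda>b s. D b (\<lambda>r s'. ev f (S (p \<cdot> r) \<cdot> (q' \<cdot> (s' \<cdot> (S s \<cdot> S q))))))))"
    by (subst teval_swap) (rule refl)
  also have "\<dots> = D x (\<lambda>p a. D a (\<lambda>q' q. D y (\<lambda>r b. D b (\<lambda>s' s. ev f (S (p \<cdot> r) \<cdot> (q' \<cdot> (s' \<cdot> (S s \<cdot> S q))))))))"
    by (simp only: coassoc)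
  also have "\<dots> = ev f (S (x \<cdot> y))"
    by (simp add: dual_ant_r teval_scalar counit_rules lin_rules0)
  finally show "ev f (S (x \<cdot> y)) = ev f (S y \<cdot> S x)" by simp
qed simp_all

lemma S_one: "S \<one> = \<one>"
proof (rule vec_eqI)
  fix f have "D \<one> (\<lambda>x y. ev f (S x \<cdot> y)) = ev f (S \<one> \<cdot> \<one>)" by (rule D_one) (simp add: lin_rules0)
  then show "ev f (S \<one>) = ev f \<one>" by (simp add: dual_ant_l eps_one one_r)
qed simp_all

lemma eps_S: "\<epsilon> (S a) = \<epsilon> a"
proof -
  have "\<epsilon> (S a) = D a (\<lambda>x y. \<epsilon> (S x \<cdot> y))" by (simp add: eps_mul counit_rules lin_rules0)
  also have "\<dots> = \<epsilon> a" by (simp add: ant_l lin_rules0 eps_one)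
  finally show ?thesis .
qed

text \<open>Uniqueness of convolution inverses again, now for Delta as a map from A to A (x) A:
  Delta(S(a_(1))) Delta(a_(2)) (S(a_(4)) (x) S(a_(3))) collapses at either end.\<close>

lemma D_S: assumes F: "bilin H F" shows "D (S a) F = D a (\<lambda>x y. F (S y) (S x))"
proof -
  note F1 = bilin_left[OF F] and F2 = bilin_right[OF F]
  have G: "bilin H (\<lambda>p q. D c (\<lambda>x y. F (p \<cdot> S y) (q \<cdot> S x)))" for c
    by (simp add: lin_rules0 F1 F2)
  note Ft = bilin_trunc[OF F]
  have "D a (\<lambda>x y. F (S y) (S x)) = D a (\<lambda>b c. \<epsilon> b * D c (\<lambda>x y. F (S y) (S x)))"
    by (simp add: counit_rules lin_rules0)
  also have "\<dots> = D a (\<lambda>b c. D b (\<lambda>b1 b2. D (S b1 \<cdot> b2) (\<lambda>p q. D c (\<lambda>x y. F (p \<cdot> S y) (q \<cdot> S x)))))"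
    by (subst ant_l[where F = "\<lambda>z. D z (\<lambda>p q. D _ (\<lambda>x y. F (p \<cdot> S y) (q \<cdot> S x)))"])
      (simp_all add: lin_rules0 D_one F1 F2 one_l Ft)
  also have "\<dots> = D a (\<lambda>b c. D b (\<lambda>b1 b2. D (S b1) (\<lambda>p r. D b2 (\<lambda>q s. D c (\<lambda>x y. F (p \<cdot> (q \<cdot> S y)) (r \<cdot> (s \<cdot> S x)))))))"
    by (simp add: D_mul lin_rules0 F1 F2 assoc)
  also have "\<dots> = D a (\<lambda>b1 b. D b (\<lambda>b2 c. D (S b1) (\<lambda>p r. D b2 (\<lambda>q s. D c (\<lambda>x y. F (p \<cdot> (q \<cdot> S y)) (r \<cdot> (s \<cdot> S x)))))))"
    by (rule coassoc)
  also have "\<dots> = D a (\<lambda>b1 b. D (S b1) (\<lambda>p r. D b (\<lambda>b2 c. D b2 (\<lambda>q s. D c (\<lambda>x y. F (p \<cdot> (q \<cdot> S y)) (r \<cdot> (s \<cdot> S x)))))))"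
    by (subst teval_swap) (rule refl)
  also have "\<dots> = D a (\<lambda>b1 b. D (S b1) (\<lambda>p r. D b (\<lambda>q n. D n (\<lambda>t y. D t (\<lambda>s x. F (p \<cdot> (q \<cdot> S y)) (r \<cdot> (s \<cdot> S x)))))))"
    by (simp only: coassoc)
  also have "\<dots> = D a (\<lambda>b1 b. D (S b1) (\<lambda>p r. D b (\<lambda>q n. F (p \<cdot> (q \<cdot> S n)) r)))"
  proof -
    have "D t (\<lambda>s x. F e (r \<cdot> (s \<cdot> S x))) = \<epsilon> t * F e r" for t e r
      using ant_r[of "\<lambda>z. F e (r \<cdot> z)" t] by (simp add: lin_rules0 F2 one_r Ft)
    then show ?thesis by (simp add: counit_rules lin_rules0 F1)
  qed
  also have "\<dots> = D a (\<lambda>b1 b. D (S b1) (\<lambda>p r. \<epsilon> b * F p r))"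
  proof -
    have "D b (\<lambda>s x. F (p \<cdot> (s \<cdot> S x)) e) = \<epsilon> b * F p e" for b e p
      using ant_r[of "\<lambda>z. F (p \<cdot> z) e" b] by (simp add: lin_rules0 F1 one_r Ft)
    then show ?thesis by simp
  qed
  also have "\<dots> = D (S a) F" by (simp add: teval_scalar counit_rules lin_rules0)
  finally show ?thesis by simp
qed

end

lemma trilin_1: "trilin H F \<Longrightarrow> vlin H t \<Longrightarrow> lin H (\<lambda>x. F (t x) b c)"
  unfolding trilin_def by (auto intro: lin_comp[where F = "\<lambda>x. F x b c"])
lemma trilin_2: "trilin H F \<Longrightarrow> vlin H t \<Longrightarrow> lin H (\<lambda>x. F a (t x) c)"
  unfolding trilin_def by (auto intro: lin_comp[where F = "\<lambda>x. F a x c"])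
lemma trilin_3: "trilin H F \<Longrightarrow> vlin H t \<Longrightarrow> lin H (\<lambda>x. F a b (t x))"
  unfolding trilin_def by (auto intro: lin_comp[where F = "\<lambda>x. F a b x"])
lemma trilin_trunc:
  assumes "trilin H F" shows "F (trunc H x) y z = F x y z" "F x (trunc H y) z = F x y z" "F x y (trunc H z) = F x y z"
  using assms lin_trunc[of H "\<lambda>x. F x y z" x] lin_trunc[of H "\<lambda>y. F x y z" y] lin_trunc[of H "F x y" z] by (simp_all add: trilin_def)

section \<open>The inverse antipode\<close>

context hopf
begin

text \<open>Sinv is unspecified outside vecs H, hence the truncation.\<close>

definition Si :: "'k vec \<Rightarrow> 'k vec" where "Si x = Sinv H (trunc H x)"

lemma S_bij: "bij_betw S (vecs H) (vecs H)" using hopf unfolding hopf_algebra_def by blast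

lemma Si_vecs[simp]: "Si x \<in> vecs H"
  using the_inv_into_into[of S "vecs H" "trunc H x" "vecs H"] S_bij
  by (simp add: Si_def Sinv_def bij_betw_def)

lemma S_Si[simp]: "S (Si x) = trunc H x"
  using f_the_inv_into_f[of S "vecs H" "trunc H x"] S_bij
  by (simp add: Si_def Sinv_def bij_betw_def)

lemma S_inj: "x \<in> vecs H \<Longrightarrow> y \<in> vecs H \<Longrightarrow> S x = S y \<Longrightarrow> x = y"
  using S_bij by (auto simp: bij_betw_def dest: inj_onD)

lemma Si_S[simp]: "Si (S x) = trunc H x"
  by (rule S_inj) (simp_all add: trunc_id)

lemma Si_trunc[simp]: "Si (trunc H x) = Si x"
  by (rule S_inj) (simp_all add: trunc_id)

text \<open>\<open>the_inv_into\<close> carries no linearity by itself. The linear extension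
  \<open>y\<close> of the values on the basis is also sent by \<open>S\<close> to
  \<open>trunc H x\<close>, so injectivity identifies it with \<open>Si x\<close>.\<close>

lemma vlin_Si0: "vlin H Si"
proof (rule vlinI)
  fix k assume k: "k < dim H"
  show "lin H (\<lambda>x. Si x k)"
  proof (rule linI)
    fix x
    define y where "y = (\<lambda>k. if k < dim H then \<Sum>i<dim H. x i * Si (basis H i) k else 0)"
    have "S y = trunc H x"
    proof
      fix j show "S y j = trunc H x j"
      proof (cases "j < dim H")
        case True
        have "S y j = (\<Sum>k<dim H. \<Sum>i<dim H. x i * (Si (basis H i) k * ant H k j))"
          using True by (simp add: Sop_def y_def sum_distrib_right mult.assoc)
        also have "\<dots> = (\<Sum>i<dim H. \<Sum>k<dim H. x i * (Si (basis H i) k * ant H k j))"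
          by (rule sum.swap)
        also have "\<dots> = (\<Sum>i<dim H. x i * S (Si (basis H i)) j)"
          by (simp only: Sop_def True if_True sum_distrib_left)
        also have "\<dots> = (\<Sum>i<dim H. x i * basis H i j)" by (simp add: trunc_id)
        finally show ?thesis using True by (simp add: basis_sum trunc_def)
      qed (simp_all add: Sop_def trunc_def)
    qed
    moreover have "y \<in> vecs H" by (simp add: y_def vecs_def)
    ultimately have "Si x = y" using S_inj[of "Si x" y] by simp
    then show "Si x k = (\<Sum>i<dim H. x i * Si (basis H i) k)" using k by (simp only: y_def if_True)
  qed
qed

lemma vlin_Si: "vlin H t \<Longrightarrow> vlin H (\<lambda>x. Si (t x))"
  by (rule vlin_comp[OF vlin_Si0])

lemmas lin_rules = lin_rules0 vlin_Si trilin_def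

lemma Si_mul: "Si (x \<cdot> y) = Si y \<cdot> Si x"
  by (rule S_inj) (simp_all add: S_mul trunc_id)
lemma Si_one: "Si \<one> = \<one>"
  by (rule S_inj) (simp_all add: S_one trunc_id)
lemma eps_Si: "\<epsilon> (Si x) = \<epsilon> x"
  using eps_S[of "Si x"] by simp

lemma D_Si: assumes F: "bilin H F" shows "D (Si a) F = D a (\<lambda>x y. F (Si y) (Si x))"
proof -
  have "D (S (Si a)) (\<lambda>x y. F (Si y) (Si x)) = D (Si a) (\<lambda>x y. F (Si (S x)) (Si (S y)))"
    by (rule D_S) (simp add: lin_rules bilin_left[OF F] bilin_right[OF F])
  then show ?thesis by (simp add: bilin_trunc[OF F])
qed

text \<open>S^-1 is an antipode for the opposite coproduct: this is \<open>ant_r\<close> at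
  \<open>Si a\<close>, with the legs reversed by \<open>D_S\<close>.\<close>

lemma anti_l: assumes F: "lin H F" shows "D a (\<lambda>x y. F (Si y \<cdot> x)) = \<epsilon> a * F \<one>"
proof -
  have "D (S (Si a)) (\<lambda>x y. F (Si y \<cdot> x)) = D (Si a) (\<lambda>x y. F (x \<cdot> S y))"
    by (subst D_S) (simp_all add: lin_rules lin_comp[OF F])
  then show ?thesis using ant_r[OF F, of "Si a"] by (simp add: eps_Si)
qed

lemma anti_r: assumes F: "lin H F" shows "D a (\<lambda>x y. F (y \<cdot> Si x)) = \<epsilon> a * F \<one>"
proof -
  have "D (S (Si a)) (\<lambda>x y. F (y \<cdot> Si x)) = D (Si a) (\<lambda>x y. F (S x \<cdot> y))"
    by (subst D_S) (simp_all add: lin_rules lin_comp[OF F])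
  then show ?thesis using ant_l[OF F, of "Si a"] by (simp add: eps_Si)
qed

end

section \<open>Quasitriangular structures\<close>

locale quasitri = hopf +
  fixes R Ri :: "'a ten2"
  assumes R_inv: "mul2 H R Ri = one2 H" "mul2 H Ri R = one2 H"
    and R_qc: "\<And>x. x \<in> vecs H \<Longrightarrow> flip2 (cop H x) = mul2 H (mul2 H R (cop H x)) Ri"
    and R_hexl: "cop_left H R = mul3 H (leg13 H R) (leg23 H R)"
    and R_hexr: "cop_right H R = mul3 H (leg13 H R) (leg12 H R)"
begin

lemma R_Ri: assumes F: "bilin H F" shows "teval H R (\<lambda>a b. teval H Ri (\<lambda>c e. F (a \<cdot> c) (b \<cdot> e))) = F \<one> \<one>"
  using arg_cong[OF R_inv(1), of "\<lambda>X. teval H X F"] by (simp add: teval_mul2[OF F] one2_def teval_tens[OF F])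
lemma Ri_R: assumes F: "bilin H F" shows "teval H Ri (\<lambda>a b. teval H R (\<lambda>c e. F (a \<cdot> c) (b \<cdot> e))) = F \<one> \<one>"
  using arg_cong[OF R_inv(2), of "\<lambda>X. teval H X F"] by (simp add: teval_mul2[OF F] one2_def teval_tens[OF F])

lemma hexl: assumes F: "trilin H F"
  shows "teval H R (\<lambda>x r. D x (\<lambda>p q. F p q r)) = teval H R (\<lambda>a c. teval H R (\<lambda>b c'. F a b (c \<cdot> c')))"
  using arg_cong[OF R_hexl, of "\<lambda>X. teval3 H X F"]
  by (simp add: teval3_cop_left teval3_mul3[OF F] teval3_leg13 teval3_leg23 trilin_trunc[OF F] one_l one_r lin_rules
    trilin_1[OF F] trilin_2[OF F] trilin_3[OF F])

lemma hexr: assumes F: "trilin H F"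
  shows "teval H R (\<lambda>p x. D x (\<lambda>q r. F p q r)) = teval H R (\<lambda>a c. teval H R (\<lambda>a' b. F (a \<cdot> a') b c))"
  using arg_cong[OF R_hexr, of "\<lambda>X. teval3 H X F"]
  by (simp add: teval3_cop_right teval3_mul3[OF F] teval3_leg13 teval3_leg12 trilin_trunc[OF F] one_l one_r lin_rules
    trilin_1[OF F] trilin_2[OF F] trilin_3[OF F])

text \<open>Multiplying the intertwining axiom by R from the right removes R^-1; in this form a
  coproduct is pulled through R.\<close>

lemma RD: assumes F: "bilin H F"
  shows "teval H R (\<lambda>a b. D x (\<lambda>p q. F (a \<cdot> p) (b \<cdot> q))) = D x (\<lambda>p q. teval H R (\<lambda>a b. F (q \<cdot> a) (p \<cdot> b)))"
proof -
  note F1 = bilin_left[OF F] and F2 = bilin_right[OF F]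
  let ?F = "\<lambda>p q. teval H R (\<lambda>a b. F (p \<cdot> a) (q \<cdot> b))"
  have L: "bilin H ?F" by (simp add: lin_rules F1 F2)
  have "flip2 (cop H (trunc H x)) = mul2 H (mul2 H R (cop H (trunc H x))) Ri" by (rule R_qc) simp
  then have "teval H (flip2 (cop H x)) ?F = teval H (mul2 H (mul2 H R (cop H x)) Ri) ?F" by simp
  also have "\<dots> = teval H R (\<lambda>a b. D x (\<lambda>p q. teval H Ri (\<lambda>c e. teval H R (\<lambda>c' e'. F (a \<cdot> (p \<cdot> (c \<cdot> c'))) (b \<cdot> (q \<cdot> (e \<cdot> e')))))))"
    by (simp add: teval_mul2 lin_rules F1 F2 assoc)
  also have "\<dots> = teval H R (\<lambda>a b. D x (\<lambda>p q. F (a \<cdot> p) (b \<cdot> q)))"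
  proof -
    have "teval H Ri (\<lambda>c e. teval H R (\<lambda>c' e'. F (a \<cdot> (p \<cdot> (c \<cdot> c'))) (b \<cdot> (q \<cdot> (e \<cdot> e'))))) = F (a \<cdot> p) (b \<cdot> q)" for a b p q
      using Ri_R[of "\<lambda>u v. F (a \<cdot> (p \<cdot> u)) (b \<cdot> (q \<cdot> v))"] by (simp add: lin_rules F1 F2 one_r)
    then show ?thesis by simp
  qed
  finally show ?thesis by (simp add: teval_flip)
qed

text \<open>Put c = (eps (x) id)(R). The counit on the first leg of (Delta (x) id)(R) = R13 R23
  gives R = (1 (x) c) R, and invertibility of R yields c = 1.\<close>

lemma R_epsl: assumes F: "lin H F" shows "teval H R (\<lambda>x y. \<epsilon> x * F y) = F \<one>"
proof -
  have F': "\<And>t. vlin H t \<Longrightarrow> lin H (\<lambda>x. F (t x))" by (rule lin_comp[OF F])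
  have "F \<one> = teval H R (\<lambda>x y. teval H Ri (\<lambda>u v. \<epsilon> (x \<cdot> u) * F (y \<cdot> v)))"
    by (subst R_Ri[where F = "\<lambda>x y. \<epsilon> x * F y"]) (simp_all add: lin_rules F F' eps_one)
  also have "\<dots> = teval H R (\<lambda>x c. D x (\<lambda>p q. \<epsilon> p * teval H Ri (\<lambda>u v. \<epsilon> (q \<cdot> u) * F (c \<cdot> v))))"
    by (simp add: counit_rules lin_rules F')
  also have "\<dots> = teval H R (\<lambda>a c. teval H R (\<lambda>b c'. \<epsilon> a * teval H Ri (\<lambda>u v. \<epsilon> (b \<cdot> u) * F (c \<cdot> (c' \<cdot> v)))))"
    by (subst hexl) (simp_all add: lin_rules F' assoc)
  also have "\<dots> = teval H R (\<lambda>a c. \<epsilon> a * F c)"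
    by (subst teval_mulc2, subst R_Ri[where F = "\<lambda>x y. \<epsilon> x * F (_ \<cdot> y)"]) (simp_all add: lin_rules F' eps_one one_r lin_trunc[OF F])
  finally show ?thesis by simp
qed

lemma R_epsr: assumes F: "lin H F" shows "teval H R (\<lambda>x y. \<epsilon> y * F x) = F \<one>"
proof -
  have F': "\<And>t. vlin H t \<Longrightarrow> lin H (\<lambda>x. F (t x))" by (rule lin_comp[OF F])
  have "F \<one> = teval H R (\<lambda>x y. teval H Ri (\<lambda>u v. \<epsilon> (y \<cdot> v) * F (x \<cdot> u)))"
    by (subst R_Ri[where F = "\<lambda>x y. \<epsilon> y * F x"]) (simp_all add: lin_rules F F' eps_one)
  also have "\<dots> = teval H R (\<lambda>x c. D c (\<lambda>p q. \<epsilon> q * teval H Ri (\<lambda>u v. \<epsilon> (p \<cdot> v) * F (x \<cdot> u))))"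
    by (simp add: counit_rules lin_rules F')
  also have "\<dots> = teval H R (\<lambda>a c. teval H R (\<lambda>a' b. \<epsilon> c * teval H Ri (\<lambda>u v. \<epsilon> (b \<cdot> v) * F (a \<cdot> (a' \<cdot> u)))))"
    by (subst hexr) (simp_all add: lin_rules F' assoc)
  also have "\<dots> = teval H R (\<lambda>a c. \<epsilon> c * F a)"
    by (subst teval_mulc2, subst R_Ri[where F = "\<lambda>x y. \<epsilon> y * F (_ \<cdot> x)"]) (simp_all add: lin_rules F' eps_one one_r lin_trunc[OF F])
  finally show ?thesis by simp
qed

text \<open>By the first hexagon, the antipode axiom and \<open>R_epsl\<close>, (S (x) id)(R) is a
  left inverse of R, hence equal to the inverse.\<close>

lemma Ri_S: assumes F: "bilin H F" shows "teval H Ri F = teval H R (\<lambda>x y. F (S x) y)"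
proof -
  note F1 = bilin_left[OF F] and F2 = bilin_right[OF F] and Ft = bilin_trunc[OF F]
  have "teval H R (\<lambda>x y. F (S x) y) = teval H R (\<lambda>x y. teval H R (\<lambda>a b. teval H Ri (\<lambda>c e. F (S x \<cdot> (a \<cdot> c)) (y \<cdot> (b \<cdot> e)))))"
    by (subst R_Ri[where F = "\<lambda>u v. F (S _ \<cdot> u) (_ \<cdot> v)"]) (simp_all add: lin_rules F1 F2 one_r Ft)
  also have "\<dots> = teval H Ri (\<lambda>c e. teval H R (\<lambda>x y. teval H R (\<lambda>a b. F (S x \<cdot> (a \<cdot> c)) (y \<cdot> (b \<cdot> e)))))"
    by (simp only: teval_swap[of H R Ri])
  also have "\<dots> = teval H Ri (\<lambda>c e. teval H R (\<lambda>x r. D x (\<lambda>p q. F (S p \<cdot> q \<cdot> c) (r \<cdot> e))))"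
    by (subst hexl) (simp_all add: lin_rules F1 F2 assoc)
  also have "\<dots> = teval H Ri (\<lambda>c e. teval H R (\<lambda>x r. \<epsilon> x * F c (r \<cdot> e)))"
    by (subst ant_l[where F = "\<lambda>z. F (z \<cdot> _) _"]) (simp_all add: lin_rules F1 F2 one_l Ft)
  also have "\<dots> = teval H Ri F"
    by (subst R_epsl) (simp_all add: lin_rules F1 F2 one_l Ft)
  finally show ?thesis by simp
qed

lemma R_SS: assumes F: "bilin H F" shows "teval H R (\<lambda>x y. F (S x) (S y)) = teval H R F"
proof -
  note F1 = bilin_left[OF F] and F2 = bilin_right[OF F] and Ft = bilin_trunc[OF F]
  \<comment> \<open>(id (x) S)(R^-1) is a right inverse of R^-1 and therefore equals R; substituting
    R^-1 = (S (x) id)(R) gives the claim.\<close>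
  have 1: "teval H Ri (\<lambda>a b. teval H Ri (\<lambda>c e. G (a \<cdot> c) (b \<cdot> S e))) = G \<one> \<one>" if G: "bilin H G" for G
  proof -
    note G1 = bilin_left[OF G] and G2 = bilin_right[OF G]
    have "teval H Ri (\<lambda>a b. teval H Ri (\<lambda>c e. G (a \<cdot> c) (b \<cdot> S e)))
        = teval H R (\<lambda>a b. teval H R (\<lambda>c e. G (S (c \<cdot> a)) (b \<cdot> S e)))"
      by (simp add: Ri_S lin_rules G1 G2 S_mul)
    also have "\<dots> = teval H R (\<lambda>c e. teval H R (\<lambda>a b. G (S (c \<cdot> a)) (b \<cdot> S e)))" by (rule teval_swap)
    also have "\<dots> = teval H R (\<lambda>p x. D x (\<lambda>q r. G (S p) (q \<cdot> S r)))"
      by (subst hexr) (simp_all add: lin_rules G1 G2)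
    also have "\<dots> = teval H R (\<lambda>p x. \<epsilon> x * G (S p) \<one>)"
      by (subst ant_r[where F = "\<lambda>z. G _ z"]) (simp_all add: lin_rules G1 G2)
    also have "\<dots> = G \<one> \<one>"
      by (subst R_epsr) (simp_all add: lin_rules G1 G2 S_one)
    finally show ?thesis .
  qed
  have "teval H R F = teval H R (\<lambda>x y. teval H Ri (\<lambda>a b. teval H Ri (\<lambda>c e. F (x \<cdot> (a \<cdot> c)) (y \<cdot> (b \<cdot> S e)))))"
    by (subst 1[where G = "\<lambda>u v. F (_ \<cdot> u) (_ \<cdot> v)"]) (simp_all add: lin_rules F1 F2 one_r Ft)
  also have "\<dots> = teval H Ri (\<lambda>c e. teval H R (\<lambda>x y. teval H Ri (\<lambda>a b. F (x \<cdot> (a \<cdot> c)) (y \<cdot> (b \<cdot> S e)))))"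
    by (subst (3) teval_swap, subst (1) teval_swap) (rule refl)
  also have "\<dots> = teval H Ri (\<lambda>c e. F c (S e))"
    using R_Ri[of "\<lambda>u v. F (u \<cdot> _) (v \<cdot> S _)"] by (simp add: assoc[symmetric] lin_rules F1 F2 one_l Ft)
  also have "\<dots> = teval H R (\<lambda>x y. F (S x) (S y))"
    by (subst Ri_S) (simp_all add: lin_rules F1 F2)
  finally show ?thesis by simp
qed

section \<open>The monodromy matrix and the Drinfeld element\<close>

abbreviation Q where "Q \<equiv> monodromy H R"
text \<open>Qm is the inverse of Q.\<close>

definition Qm where "Qm = mul2 H Ri (flip2 Ri)"

lemma teval_Q: "bilin H F \<Longrightarrow> teval H Q F = teval H R (\<lambda>a b. teval H R (\<lambda>c e. F (b \<cdot> c) (a \<cdot> e)))"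
  by (simp add: monodromy_def teval_mul2 teval_flip)
lemma teval_Qm: "bilin H F \<Longrightarrow> teval H Qm F = teval H Ri (\<lambda>a b. teval H Ri (\<lambda>c e. F (a \<cdot> e) (b \<cdot> c)))"
  by (simp add: Qm_def teval_mul2 teval_flip)

text \<open>Pulling a coproduct through R exchanges its legs, and Q = R21 R exchanges them
  twice.\<close>

lemma QD: assumes F: "bilin H F"
  shows "teval H Q (\<lambda>a b. D x (\<lambda>p q. F (a \<cdot> p) (b \<cdot> q))) = D x (\<lambda>p q. teval H Q (\<lambda>a b. F (p \<cdot> a) (q \<cdot> b)))"
proof -
  note F1 = bilin_left[OF F] and F2 = bilin_right[OF F] and Ft = bilin_trunc[OF F]
  have "teval H Q (\<lambda>a b. D x (\<lambda>p q. F (a \<cdot> p) (b \<cdot> q)))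
      = teval H R (\<lambda>a b. teval H R (\<lambda>c e. D x (\<lambda>p q. F (b \<cdot> (c \<cdot> p)) (a \<cdot> (e \<cdot> q)))))"
    by (subst teval_Q) (simp_all add: lin_rules F1 F2 assoc)
  also have "\<dots> = teval H R (\<lambda>a b. D x (\<lambda>p q. teval H R (\<lambda>c e. F (b \<cdot> (q \<cdot> c)) (a \<cdot> (p \<cdot> e)))))"
    by (subst RD[where F = "\<lambda>u v. F (_ \<cdot> u) (_ \<cdot> v)"]) (simp_all add: lin_rules F1 F2)
  also have "\<dots> = D x (\<lambda>p q. teval H R (\<lambda>a b. teval H R (\<lambda>c e. F (p \<cdot> (b \<cdot> c)) (q \<cdot> (a \<cdot> e)))))"
    using RD[of "\<lambda>u v. teval H R (\<lambda>c e. F (v \<cdot> c) (u \<cdot> e))" x] by (simp add: lin_rules F1 F2 assoc)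
  also have "\<dots> = D x (\<lambda>p q. teval H Q (\<lambda>a b. F (p \<cdot> a) (q \<cdot> b)))"
    by (simp add: teval_Q lin_rules F1 F2)
  finally show ?thesis .
qed

lemma Q_Qm: assumes F: "bilin H F" shows "teval H Q (\<lambda>a b. teval H Qm (\<lambda>c e. F (a \<cdot> c) (b \<cdot> e))) = F \<one> \<one>"
proof -
  note F1 = bilin_left[OF F] and F2 = bilin_right[OF F] and Ft = bilin_trunc[OF F]
  have "teval H Q (\<lambda>a b. teval H Qm (\<lambda>c e. F (a \<cdot> c) (b \<cdot> e)))
     = teval H R (\<lambda>a b. teval H R (\<lambda>c e. teval H Ri (\<lambda>a' b'. teval H Ri (\<lambda>c' e'. F (b \<cdot> (c \<cdot> (a' \<cdot> e'))) (a \<cdot> (e \<cdot> (b' \<cdot> c')))))))"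
    by (simp add: teval_Q teval_Qm lin_rules F1 F2 assoc)
  also have "\<dots> = teval H R (\<lambda>a b. teval H Ri (\<lambda>c' e'. F (b \<cdot> e') (a \<cdot> c')))"
  proof -
    have "teval H R (\<lambda>c e. teval H Ri (\<lambda>a' b'. teval H Ri (\<lambda>c' e'. F (b \<cdot> (c \<cdot> (a' \<cdot> e'))) (a \<cdot> (e \<cdot> (b' \<cdot> c'))))))
      = teval H Ri (\<lambda>c' e'. F (b \<cdot> e') (a \<cdot> c'))" for a b
      using R_Ri[of "\<lambda>u v. teval H Ri (\<lambda>c' e'. F (b \<cdot> (u \<cdot> e')) (a \<cdot> (v \<cdot> c')))"] by (simp add: lin_rules F1 F2 assoc one_l Ft)
    then show ?thesis by simp
  qed
  also have "\<dots> = F \<one> \<one>" using R_Ri[of "\<lambda>u v. F v u"] by (simp add: lin_rules F1 F2)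
  finally show ?thesis .
qed

lemma Qm_Q: assumes F: "bilin H F" shows "teval H Qm (\<lambda>a b. teval H Q (\<lambda>c e. F (a \<cdot> c) (b \<cdot> e))) = F \<one> \<one>"
proof -
  note F1 = bilin_left[OF F] and F2 = bilin_right[OF F] and Ft = bilin_trunc[OF F]
  have "teval H Qm (\<lambda>a b. teval H Q (\<lambda>c e. F (a \<cdot> c) (b \<cdot> e)))
     = teval H Ri (\<lambda>a b. teval H Ri (\<lambda>c e. teval H R (\<lambda>a' b'. teval H R (\<lambda>c' e'. F (a \<cdot> (e \<cdot> (b' \<cdot> c'))) (b \<cdot> (c \<cdot> (a' \<cdot> e')))))))"
    by (simp add: teval_Q teval_Qm lin_rules F1 F2 assoc)
  also have "\<dots> = teval H Ri (\<lambda>a b. teval H R (\<lambda>c' e'. F (a \<cdot> c') (b \<cdot> e')))"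
  proof -
    have "teval H Ri (\<lambda>c e. teval H R (\<lambda>a' b'. teval H R (\<lambda>c' e'. F (a \<cdot> (e \<cdot> (b' \<cdot> c'))) (b \<cdot> (c \<cdot> (a' \<cdot> e'))))))
      = teval H R (\<lambda>c' e'. F (a \<cdot> c') (b \<cdot> e'))" for a b
      using Ri_R[of "\<lambda>u v. teval H R (\<lambda>c' e'. F (a \<cdot> (v \<cdot> c')) (b \<cdot> (u \<cdot> e')))"] by (simp add: lin_rules F1 F2 assoc one_l Ft)
    then show ?thesis by simp
  qed
  also have "\<dots> = F \<one> \<one>" using Ri_R[OF F] .
  finally show ?thesis .
qed

lemma QmD: assumes F: "bilin H F"
  shows "teval H Qm (\<lambda>a b. D x (\<lambda>p q. F (a \<cdot> p) (b \<cdot> q))) = D x (\<lambda>p q. teval H Qm (\<lambda>a b. F (p \<cdot> a) (q \<cdot> b)))"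
proof -
  note F1 = bilin_left[OF F] and F2 = bilin_right[OF F] and Ft = bilin_trunc[OF F]
  have 1: "teval H Q (\<lambda>c e. teval H Qm (\<lambda>c' e'. F (a \<cdot> (p \<cdot> (c \<cdot> c'))) (b \<cdot> (q \<cdot> (e \<cdot> e'))))) = F (a \<cdot> p) (b \<cdot> q)" for a b p q
    using Q_Qm[of "\<lambda>u v. F (a \<cdot> (p \<cdot> u)) (b \<cdot> (q \<cdot> v))"] by (simp add: lin_rules F1 F2 one_r)
  have "teval H Qm (\<lambda>a b. D x (\<lambda>p q. F (a \<cdot> p) (b \<cdot> q)))
      = teval H Qm (\<lambda>a b. D x (\<lambda>p q. teval H Q (\<lambda>c e. teval H Qm (\<lambda>c' e'. F (a \<cdot> (p \<cdot> (c \<cdot> c'))) (b \<cdot> (q \<cdot> (e \<cdot> e')))))))"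
    by (simp only: 1)
  also have "\<dots> = teval H Qm (\<lambda>a b. teval H Q (\<lambda>c e. D x (\<lambda>p q. teval H Qm (\<lambda>c' e'. F (a \<cdot> (c \<cdot> (p \<cdot> c'))) (b \<cdot> (e \<cdot> (q \<cdot> e')))))))"
  proof -
    have "D x (\<lambda>p q. teval H Q (\<lambda>c e. teval H Qm (\<lambda>c' e'. F (a \<cdot> (p \<cdot> (c \<cdot> c'))) (b \<cdot> (q \<cdot> (e \<cdot> e'))))))
      = teval H Q (\<lambda>c e. D x (\<lambda>p q. teval H Qm (\<lambda>c' e'. F (a \<cdot> (c \<cdot> (p \<cdot> c'))) (b \<cdot> (e \<cdot> (q \<cdot> e'))))))" for a b
      using QD[of "\<lambda>u v. teval H Qm (\<lambda>c' e'. F (a \<cdot> (u \<cdot> c')) (b \<cdot> (v \<cdot> e')))" x] by (simp add: lin_rules F1 F2 assoc)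
    then show ?thesis by simp
  qed
  also have "\<dots> = D x (\<lambda>p q. teval H Qm (\<lambda>c' e'. F (p \<cdot> c') (q \<cdot> e')))"
    using Qm_Q[of "\<lambda>u v. D x (\<lambda>p q. teval H Qm (\<lambda>c' e'. F (u \<cdot> (p \<cdot> c')) (v \<cdot> (q \<cdot> e'))))"]
    by (simp add: lin_rules F1 F2 assoc one_l Ft)
  finally show ?thesis .
qed

text \<open>Commutation of \<open>Qm\<close> with coproducts, rewritten as the transfer of an
  adjoint action from one leg to the other. A counit is expanded into S^-1(t) z, so that a complete
  coproduct stands to the left of \<open>Qm\<close> and \<open>QmD\<close> can carry it across;
  there the other antipode pair collapses.\<close>

lemma Qm_equivariant: assumes F: "bilin H F"
  shows "teval H Qm (\<lambda>p q. D r (\<lambda>x y. F p (Si y \<cdot> (q \<cdot> x)))) = D r (\<lambda>x y. teval H Qm (\<lambda>p q. F (y \<cdot> (p \<cdot> Si x)) q))"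
proof -
  note F1 = bilin_left[OF F] and F2 = bilin_right[OF F] and Ft = bilin_trunc[OF F]
  have "D r (\<lambda>x y. teval H Qm (\<lambda>p q. F (y \<cdot> (p \<cdot> Si x)) q))
     = D r (\<lambda>x m. D m (\<lambda>y n. \<epsilon> n * teval H Qm (\<lambda>p q. F (y \<cdot> (p \<cdot> Si x)) q)))"
    by (simp add: counit_rules lin_rules F1 F2)
  also have "\<dots> = D r (\<lambda>x m. D m (\<lambda>y n. D n (\<lambda>z t. teval H Qm (\<lambda>p q. F (y \<cdot> (p \<cdot> Si x)) (Si t \<cdot> (z \<cdot> q))))))"
    using anti_l[of "\<lambda>z. teval H Qm (\<lambda>p q. F (_ \<cdot> (p \<cdot> Si _)) (z \<cdot> q))"]
    by (simp add: lin_rules F1 F2 one_l Ft assoc)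
  also have "\<dots> = D r (\<lambda>x m. D m (\<lambda>k t. D k (\<lambda>y z. teval H Qm (\<lambda>p q. F (y \<cdot> (p \<cdot> Si x)) (Si t \<cdot> (z \<cdot> q))))))"
    by (simp only: coassoc)
  also have "\<dots> = D r (\<lambda>x m. D m (\<lambda>k t. teval H Qm (\<lambda>p q. D k (\<lambda>y z. F (p \<cdot> (y \<cdot> Si x)) (Si t \<cdot> (q \<cdot> z))))))"
    using QmD[of "\<lambda>u v. F (u \<cdot> Si _) (Si _ \<cdot> v)"] by (simp add: lin_rules F1 F2 assoc)
  also have "\<dots> = teval H Qm (\<lambda>p q. D r (\<lambda>x m. D m (\<lambda>k t. D k (\<lambda>y z. F (p \<cdot> (y \<cdot> Si x)) (Si t \<cdot> (q \<cdot> z))))))"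
    by (subst (2) teval_swap, subst teval_swap) (rule refl)
  also have "\<dots> = teval H Qm (\<lambda>p q. D r (\<lambda>h n. D h (\<lambda>x y. D n (\<lambda>z t. F (p \<cdot> (y \<cdot> Si x)) (Si t \<cdot> (q \<cdot> z))))))"
    by (simp only: coassoc)
  also have "\<dots> = teval H Qm (\<lambda>p q. D r (\<lambda>h n. \<epsilon> h * D n (\<lambda>z t. F p (Si t \<cdot> (q \<cdot> z)))))"
    using anti_r[of "\<lambda>k. D _ (\<lambda>z t. F (_ \<cdot> k) (Si t \<cdot> (_ \<cdot> z)))"]
    by (simp add: lin_rules F1 F2 one_r Ft)
  also have "\<dots> = teval H Qm (\<lambda>p q. D r (\<lambda>x y. F p (Si y \<cdot> (q \<cdot> x))))"
    by (simp add: counit_rules lin_rules F1 F2)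
  finally show ?thesis by simp
qed

abbreviation u where "u \<equiv> drinfeld_u H R"

lemma u_vecs[simp]: "u \<in> vecs H"
  unfolding drinfeld_u_def by (subst tevalv_vsum[where G = "\<lambda>x y. S y \<cdot> x"]) simp_all

lemma lin_u: "lin H F \<Longrightarrow> teval H R (\<lambda>x y. F (S y \<cdot> x)) = F u"
  unfolding drinfeld_u_def by (subst tevalv_vsum[where G = "\<lambda>x y. S y \<cdot> x"]) (simp_all, rule teval_lin)

lemma u_S2: "u \<cdot> x = S (S x) \<cdot> u"
proof (rule vec_eqI)
  fix f
  \<comment> \<open>S(x_(2)) u x_(1) = eps(x) u: apply \<open>RD\<close> under the map a (x) b |->
    S(b) a that produces u from R, then the antipode axiom.\<close>
  have 1: "D x (\<lambda>p q. ev f (a \<cdot> (S q \<cdot> (u \<cdot> p)))) = \<epsilon> x * ev f (a \<cdot> u)" for a x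
  proof -
    have "D x (\<lambda>p q. ev f (a \<cdot> (S q \<cdot> (u \<cdot> p)))) = D x (\<lambda>p q. teval H R (\<lambda>c e. ev f (a \<cdot> (S (e \<cdot> q) \<cdot> (c \<cdot> p)))))"
      using lin_u[of "\<lambda>z. ev f (a \<cdot> (S _ \<cdot> (z \<cdot> _)))"] by (simp add: lin_rules S_mul assoc)
    also have "\<dots> = teval H R (\<lambda>c e. D x (\<lambda>p q. ev f (a \<cdot> (S (e \<cdot> q) \<cdot> (c \<cdot> p)))))" by (rule teval_swap)
    also have "\<dots> = D x (\<lambda>p q. teval H R (\<lambda>c e. ev f (a \<cdot> (S (p \<cdot> e) \<cdot> (q \<cdot> c)))))"
      using RD[of "\<lambda>u v. ev f (a \<cdot> (S v \<cdot> u))" x] by (simp add: lin_rules)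
    also have "\<dots> = teval H R (\<lambda>c e. D x (\<lambda>p q. ev f (a \<cdot> (S e \<cdot> (S p \<cdot> (q \<cdot> c))))))"
      by (subst teval_swap) (simp add: S_mul assoc)
    also have "\<dots> = \<epsilon> x * ev f (a \<cdot> u)"
      using lin_u[of "\<lambda>z. ev f (a \<cdot> z)"] by (simp add: lin_rules dual_ant_l teval_scalar)
    finally show ?thesis .
  qed
  have "ev f (S (S x) \<cdot> u) = D x (\<lambda>p q. \<epsilon> p * ev f (S (S q) \<cdot> u))" by (simp add: counit_rules lin_rules)
  also have "\<dots> = D x (\<lambda>p q. D p (\<lambda>r s. ev f (S (S q) \<cdot> (S s \<cdot> (u \<cdot> r)))))" by (simp only: 1)
  also have "\<dots> = D x (\<lambda>r m. D m (\<lambda>s q. ev f (S (S q) \<cdot> (S s \<cdot> (u \<cdot> r)))))" by (rule coassoc)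
  also have "\<dots> = D x (\<lambda>r m. D m (\<lambda>s q. ev f (S (s \<cdot> S q) \<cdot> (u \<cdot> r))))" by (simp add: S_mul assoc)
  also have "\<dots> = ev f (u \<cdot> x)"
    using ant_r[of "\<lambda>z. ev f (S z \<cdot> (u \<cdot> _))"] by (simp add: lin_rules counit_rules S_one one_l)
  finally show "ev f (u \<cdot> x) = ev f (S (S x) \<cdot> u)" by simp
qed simp_all

text \<open>kappa is, up to side conventions, the antipode of the transmuted braided Hopf algebra; this is
  why its square is an adjoint action.\<close>

definition kappa where "kappa b = tevalv H R (\<lambda>r s. s \<cdot> (u \<cdot> (Si b \<cdot> r)))"

lemma kappa_vecs[simp]: "kappa b \<in> vecs H" by (simp add: kappa_def)

lemma vlin_kappa: "vlin H t \<Longrightarrow> vlin H (\<lambda>x. kappa (t x))"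
  by (simp add: kappa_def lin_rules)

lemma lin_kappa: "lin H F \<Longrightarrow> F (kappa b) = teval H R (\<lambda>r s. F (s \<cdot> (u \<cdot> (Si b \<cdot> r))))"
  unfolding kappa_def by (rule teval_lin[symmetric])

text \<open>Here \<open>kappa\<close> appears as an adjoint action of the first leg of R, the shape
  that \<open>Qm_equivariant\<close> can transfer. The first hexagon splits R into two copies, and
  (S (x) S)(R) = R turns R_2 S^-1(R_1) of one copy into S(R_2) R_1 = u.\<close>

lemma kappa_alt: assumes F: "lin H F"
  shows "F (kappa b) = teval H R (\<lambda>r s. D r (\<lambda>x y. F (s \<cdot> (Si y \<cdot> (Si b \<cdot> x)))))"
proof -
  note F' = lin_comp[OF F]
  have "teval H R (\<lambda>r s. D r (\<lambda>x y. F (s \<cdot> (Si y \<cdot> (Si b \<cdot> x)))))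
     = teval H R (\<lambda>a c. teval H R (\<lambda>y c'. F (c \<cdot> (c' \<cdot> (Si y \<cdot> (Si b \<cdot> a))))))"
    by (subst hexl) (simp_all add: lin_rules F' assoc)
  also have "\<dots> = teval H R (\<lambda>a c. teval H R (\<lambda>y c'. F (c \<cdot> (S c' \<cdot> (y \<cdot> (Si b \<cdot> a))))))"
    using R_SS[of "\<lambda>y c'. F (_ \<cdot> (c' \<cdot> (Si y \<cdot> (Si b \<cdot> _))))"] by (simp add: lin_rules F')
  also have "\<dots> = teval H R (\<lambda>a c. F (c \<cdot> (u \<cdot> (Si b \<cdot> a))))"
    using lin_u[of "\<lambda>z. F (_ \<cdot> (z \<cdot> (Si b \<cdot> _)))"] by (simp add: lin_rules F' assoc)
  finally show ?thesis by (simp add: lin_kappa[OF F])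
qed

lemma R_Qm: assumes F: "bilin H F"
  shows "teval H R (\<lambda>b c. teval H Qm (\<lambda>p q. F (b \<cdot> p) (c \<cdot> q))) = teval H Ri (\<lambda>x y. F y x)"
proof -
  note F1 = bilin_left[OF F] and F2 = bilin_right[OF F] and Ft = bilin_trunc[OF F]
  have "teval H R (\<lambda>b c. teval H Qm (\<lambda>p q. F (b \<cdot> p) (c \<cdot> q)))
     = teval H R (\<lambda>b c. teval H Ri (\<lambda>p q. teval H Ri (\<lambda>x y. F (b \<cdot> (p \<cdot> y)) (c \<cdot> (q \<cdot> x)))))"
    by (simp add: teval_Qm lin_rules F1 F2)
  also have "\<dots> = teval H Ri (\<lambda>x y. F y x)"
    using R_Ri[of "\<lambda>u v. teval H Ri (\<lambda>x y. F (u \<cdot> y) (v \<cdot> x))"] by (simp add: lin_rules F1 F2 one_l Ft assoc)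
  finally show ?thesis .
qed

text \<open>The source of S = kappa S'. After the adjoint action has moved to the first leg of
  \<open>Qm\<close>, the hexagon gives two copies of R. One cancels against the factor R^-1 of
  \<open>Qm\<close> and leaves R21^-1; the antipode makes this R21, and with the other copy it forms
  Q.\<close>

lemma Q_kappa: assumes F: "bilin H F"
  shows "teval H Q (\<lambda>p q. F p (S q)) = teval H Qm (\<lambda>p q. F p (kappa (S q)))"
proof -
  note F1 = bilin_left[OF F] and F2 = bilin_right[OF F] and Ft = bilin_trunc[OF F]
  have "teval H Qm (\<lambda>p q. F p (kappa (S q))) = teval H Qm (\<lambda>p q. teval H R (\<lambda>r s. D r (\<lambda>x y. F p (s \<cdot> (Si y \<cdot> (q \<cdot> x))))))"
    using kappa_alt[of "F _"] by (simp add: lin_rules F1 F2)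
  also have "\<dots> = teval H R (\<lambda>r s. teval H Qm (\<lambda>p q. D r (\<lambda>x y. F p (s \<cdot> (Si y \<cdot> (q \<cdot> x))))))"
    by (rule teval_swap)
  also have "\<dots> = teval H R (\<lambda>r s. D r (\<lambda>x y. teval H Qm (\<lambda>p q. F (y \<cdot> (p \<cdot> Si x)) (s \<cdot> q))))"
    using Qm_equivariant[of "\<lambda>p q. F p (_ \<cdot> q)"] by (simp add: lin_rules F1 F2)
  also have "\<dots> = teval H R (\<lambda>a c. teval H R (\<lambda>b c'. teval H Qm (\<lambda>p q. F (b \<cdot> (p \<cdot> Si a)) (c \<cdot> (c' \<cdot> q)))))"
    by (subst hexl) (simp_all add: lin_rules F1 F2 assoc)
  also have "\<dots> = teval H R (\<lambda>a c. teval H R (\<lambda>x y. F (y \<cdot> Si a) (c \<cdot> S x)))"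
    using R_Qm[of "\<lambda>u v. F (u \<cdot> Si _) (_ \<cdot> v)"] by (simp add: lin_rules F1 F2 assoc Ri_S)
  also have "\<dots> = teval H R (\<lambda>a c. teval H R (\<lambda>x y. F (y \<cdot> a) (S c \<cdot> S x)))"
    using R_SS[of "\<lambda>a c. teval H R (\<lambda>x y. F (y \<cdot> Si a) (c \<cdot> S x))"] by (simp add: lin_rules F1 F2)
  also have "\<dots> = teval H R (\<lambda>x y. teval H R (\<lambda>a c. F (y \<cdot> a) (S c \<cdot> S x)))" by (rule teval_swap)
  also have "\<dots> = teval H Q (\<lambda>p q. F p (S q))" by (simp add: teval_Q lin_rules F1 F2 S_mul)
  finally show ?thesis by simp
qed

lemma Q_SS: assumes F: "bilin H F" shows "teval H Q (\<lambda>p q. F (S p) (S q)) = teval H Q (\<lambda>p q. F q p)"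
proof -
  note F1 = bilin_left[OF F] and F2 = bilin_right[OF F] and Ft = bilin_trunc[OF F]
  have "teval H Q (\<lambda>p q. F (S p) (S q)) = teval H R (\<lambda>a b. teval H R (\<lambda>c e. F (S c \<cdot> S b) (S e \<cdot> S a)))"
    by (simp add: teval_Q lin_rules F1 F2 S_mul)
  also have "\<dots> = teval H R (\<lambda>a b. teval H R (\<lambda>c e. F (c \<cdot> b) (e \<cdot> a)))"
    using R_SS[of "\<lambda>a b. teval H R (\<lambda>c e. F (S c \<cdot> b) (S e \<cdot> a))"] R_SS[of "\<lambda>c e. F (c \<cdot> _) (e \<cdot> _)"]
    by (simp add: lin_rules F1 F2)
  also have "\<dots> = teval H R (\<lambda>c e. teval H R (\<lambda>a b. F (c \<cdot> b) (e \<cdot> a)))" by (rule teval_swap)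
  also have "\<dots> = teval H Q (\<lambda>p q. F q p)" by (simp add: teval_Q lin_rules F1 F2)
  finally show ?thesis .
qed

end

section \<open>The ribbon element and the integral\<close>

locale ribbon_int = quasitri +
  fixes v w rho :: "'a vec"
  assumes v_vecs[simp]: "v \<in> vecs H" and w_vecs[simp]: "w \<in> vecs H"
    and v_central: "\<And>x. x \<in> vecs H \<Longrightarrow> v \<cdot> x = x \<cdot> v"
    and vw: "v \<cdot> w = \<one>" and wv: "w \<cdot> v = \<one>"
    and S_v: "S v = v" and eps_v: "\<epsilon> v = 1"
    and v_u: "v \<cdot> v \<cdot> (u \<cdot> S u) = \<one>"
    and cop_v: "cop H v = mul2 H (tens H v v) Q"
    and Phibar_inj: "inj_on (Phibar H R) (vecs H)"
    and rho_nz: "\<exists>i<dim H. rho i \<noteq> 0"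
    and rho_int: "\<And>i. i < dim H \<Longrightarrow> vsumover (pairs H) (\<lambda>(a,b). smul (delta H i a b * rho a) (basis H b))
                 = smul (rho i) \<one>"
begin

abbreviation \<rho> where "\<rho> \<equiv> ev rho"

lemma v_c: "x \<cdot> v = v \<cdot> x" "x \<cdot> (v \<cdot> y) = v \<cdot> (x \<cdot> y)"
proof -
  show 1: "x \<cdot> v = v \<cdot> x" for x using v_central[of "trunc H x"] by simp
  show "x \<cdot> (v \<cdot> y) = v \<cdot> (x \<cdot> y)" using 1[of x] by (metis assoc)
qed

lemma w_c: "x \<cdot> w = w \<cdot> x" "x \<cdot> (w \<cdot> y) = w \<cdot> (x \<cdot> y)"
proof -
  show 1: "x \<cdot> w = w \<cdot> x" for x
  proof -
    have "w \<cdot> x = w \<cdot> (x \<cdot> (v \<cdot> w))" by (simp add: vw one_r)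
    also have "\<dots> = (w \<cdot> v) \<cdot> (x \<cdot> w)" by (simp only: v_c(2) assoc)
    finally show ?thesis by (simp add: wv one_l trunc_id)
  qed
  show "x \<cdot> (w \<cdot> y) = w \<cdot> (x \<cdot> y)" using 1[of x] by (metis assoc)
qed

lemma vwc: "v \<cdot> (w \<cdot> x) = trunc H x" "w \<cdot> (v \<cdot> x) = trunc H x"
  by (simp_all add: assoc[symmetric] vw wv one_l)

lemma S_w: "S w = w"
proof -
  have "S w \<cdot> v = \<one>" using S_mul[of v w] by (simp add: vw S_one S_v)
  then have "S w \<cdot> v \<cdot> w = w" by (simp add: one_l trunc_id)
  then show ?thesis by (simp add: assoc vw one_r trunc_id)
qed
lemma eps_w: "\<epsilon> w = 1" using eps_mul[of v w] by (simp add: vw eps_one eps_v)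

lemma D_v: assumes F: "bilin H F" shows "D v F = teval H Q (\<lambda>p q. F (v \<cdot> p) (v \<cdot> q))"
  unfolding cop_v teval_mul2[OF F] by (subst teval_tens) (simp_all add: lin_rules bilin_left[OF F] bilin_right[OF F])

lemma Q_v: assumes F: "bilin H F" shows "teval H Q F = D v (\<lambda>p q. F (w \<cdot> p) (w \<cdot> q))"
  by (subst D_v) (simp_all add: lin_rules bilin_left[OF F] bilin_right[OF F] vwc bilin_trunc[OF F])

text \<open>The formula for Delta(v), inverted: insert Q Q^-1 = 1, read Q as (w (x) w) Delta(v), and
  cancel Delta(w) Delta(v) = 1.\<close>

lemma D_w: assumes F: "bilin H F" shows "D w F = teval H Qm (\<lambda>p q. F (w \<cdot> p) (w \<cdot> q))"
proof -
  note F1 = bilin_left[OF F] and F2 = bilin_right[OF F] and Ft = bilin_trunc[OF F]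
  have "D w F = D w (\<lambda>x y. teval H Q (\<lambda>a b. teval H Qm (\<lambda>p q. F (x \<cdot> (a \<cdot> p)) (y \<cdot> (b \<cdot> q)))))"
    by (subst Q_Qm[where F = "\<lambda>a b. F (_ \<cdot> a) (_ \<cdot> b)"]) (simp_all add: lin_rules F1 F2 one_r Ft)
  also have "\<dots> = D w (\<lambda>x y. D v (\<lambda>a b. teval H Qm (\<lambda>p q. F (x \<cdot> (a \<cdot> (w \<cdot> p))) (y \<cdot> (b \<cdot> (w \<cdot> q))))))"
    by (subst Q_v) (simp_all add: lin_rules F1 F2 assoc w_c(2))
  also have "\<dots> = D (w \<cdot> v) (\<lambda>a b. teval H Qm (\<lambda>p q. F (a \<cdot> (w \<cdot> p)) (b \<cdot> (w \<cdot> q))))"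
    by (simp add: D_mul lin_rules F1 F2 assoc)
  also have "\<dots> = teval H Qm (\<lambda>p q. F (w \<cdot> p) (w \<cdot> q))"
    by (simp add: wv D_one lin_rules F1 F2 one_l Ft)
  finally show ?thesis .
qed

lemma Qm_w: assumes F: "bilin H F" shows "teval H Qm F = D w (\<lambda>p q. F (v \<cdot> p) (v \<cdot> q))"
  by (subst D_w) (simp_all add: lin_rules bilin_left[OF F] bilin_right[OF F] vwc bilin_trunc[OF F])

lemma uSu: "u \<cdot> S u = w \<cdot> w"
proof -
  have "w \<cdot> (w \<cdot> (v \<cdot> v \<cdot> (u \<cdot> S u))) = w \<cdot> (w \<cdot> \<one>)" by (simp only: v_u)
  then show ?thesis by (simp add: assoc vwc one_r trunc_id)
qed

text \<open>\<open>u_S2\<close> at u itself gives S(S(u)) u = u u. The ribbon axiom makes u right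
  invertible, since u S(u) = w^2, so u cancels.\<close>

lemma S2u: "S (S u) = u"
proof -
  have "S (S u) \<cdot> (u \<cdot> S u) = u \<cdot> (u \<cdot> S u)" using u_S2[of u] by (simp add: assoc[symmetric])
  then have "S (S u) \<cdot> (w \<cdot> w) = u \<cdot> (w \<cdot> w)" by (simp add: uSu)
  then have "S (S u) \<cdot> (w \<cdot> w) \<cdot> (v \<cdot> v) = u \<cdot> (w \<cdot> w) \<cdot> (v \<cdot> v)" by simp
  then show ?thesis by (simp add: assoc vwc wv one_r trunc_id)
qed

lemma Si_u: "Si u = S u"
  by (rule S_inj) (simp_all add: S2u trunc_id)

lemma kappa_mulw: "kappa (w \<cdot> x) = w \<cdot> kappa x"
proof (rule vec_eqI)
  fix f
  have "Si w = w" by (rule S_inj) (simp_all add: S_w trunc_id)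
  then have "ev f (kappa (w \<cdot> x)) = teval H R (\<lambda>r s. ev f (w \<cdot> (s \<cdot> (u \<cdot> (Si x \<cdot> r)))))"
    by (simp add: lin_kappa[OF lin_dual0] Si_mul w_c assoc)
  then show "ev f (kappa (w \<cdot> x)) = ev f (w \<cdot> kappa x)"
    using lin_kappa[of "\<lambda>z. ev f (w \<cdot> z)" x] by (simp add: lin_rules)
qed simp_all

text \<open>The two factors u combine to u S(u) = w^2, and the two copies of R with their antipodes
  combine to Q^-1. Distributing w^2 over the legs gives (w (x) w) Q^-1 = Delta(w).\<close>

lemma kappa_kappa: assumes F: "lin H F" shows "F (kappa (kappa b)) = D w (\<lambda>x y. F (S x \<cdot> (b \<cdot> y)))"
proof -
  note F' = lin_comp[OF F]
  \<comment> \<open>S^-1 reverses the inner product and turns its u into S(u). Moving the outer u to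
    the right by \<open>u_S2\<close> then costs S^2 on the factors in between, which cancels their
    inverse antipodes.\<close>
  have e: "s \<cdot> (u \<cdot> (Si (s' \<cdot> (u \<cdot> (Si b \<cdot> r'))) \<cdot> r)) = s \<cdot> (S r' \<cdot> (b \<cdot> (w \<cdot> (w \<cdot> (Si s' \<cdot> r)))))" for r s r' s'
  proof -
    have "u \<cdot> (Si (s' \<cdot> (u \<cdot> (Si b \<cdot> r'))) \<cdot> r) = u \<cdot> (Si r' \<cdot> Si (Si b)) \<cdot> (S u \<cdot> (Si s' \<cdot> r))"
      by (simp add: Si_mul Si_u assoc)
    also have "\<dots> = S r' \<cdot> b \<cdot> (u \<cdot> (S u \<cdot> (Si s' \<cdot> r)))"
      by (subst u_S2) (simp add: S_mul assoc)
    also have "\<dots> = S r' \<cdot> (b \<cdot> (w \<cdot> (w \<cdot> (Si s' \<cdot> r))))"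
      using arg_cong[OF uSu, of "\<lambda>z. z \<cdot> (Si s' \<cdot> r)"] by (simp add: assoc)
    finally show ?thesis by simp
  qed
  have "F (kappa (kappa b)) = teval H R (\<lambda>r s. teval H R (\<lambda>r' s'. F (s \<cdot> (S r' \<cdot> (b \<cdot> (w \<cdot> (w \<cdot> (Si s' \<cdot> r))))))))"
    using lin_kappa[of "\<lambda>z. F (_ \<cdot> (u \<cdot> (Si z \<cdot> _)))" b] by (simp add: lin_kappa[OF F] lin_rules F' e)
  also have "\<dots> = teval H R (\<lambda>r s. teval H R (\<lambda>r' s'. F (S s \<cdot> (S (S r') \<cdot> (b \<cdot> (w \<cdot> (w \<cdot> (s' \<cdot> S r))))))))"
    using R_SS[of "\<lambda>r s. teval H R (\<lambda>r' s'. F (s \<cdot> (S r' \<cdot> (b \<cdot> (w \<cdot> (w \<cdot> (Si s' \<cdot> r)))))))"]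
      R_SS[of "\<lambda>r' s'. F (S _ \<cdot> (S r' \<cdot> (b \<cdot> (w \<cdot> (w \<cdot> (Si s' \<cdot> S _))))))"]
    by (simp add: lin_rules F')
  also have "\<dots> = teval H R (\<lambda>r' s'. teval H R (\<lambda>r s. F (S s \<cdot> (S (S r') \<cdot> (b \<cdot> (w \<cdot> (w \<cdot> (s' \<cdot> S r))))))))"
    by (rule teval_swap)
  also have "\<dots> = teval H Qm (\<lambda>p q. F (S p \<cdot> (b \<cdot> (w \<cdot> (w \<cdot> q)))))"
    by (simp add: teval_Qm Ri_S lin_rules F' S_mul assoc)
  also have "\<dots> = D w (\<lambda>x y. F (S x \<cdot> (b \<cdot> y)))"
    by (simp add: D_w lin_rules F' S_mul S_w w_c(2)[of b, symmetric] assoc)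
  finally show ?thesis .
qed

text \<open>kappa^2 is the adjoint action of w, and the adjoint action of v undoes it because w v =
  1.\<close>

lemma kappa_inj: assumes "x \<in> vecs H" "y \<in> vecs H" "kappa x = kappa y" shows "x = y"
proof -
  have K: "ev f x = D v (\<lambda>p q. ev f (S p \<cdot> (kappa (kappa x) \<cdot> q)))" for f x
  proof -
    have "ev f x = D (w \<cdot> v) (\<lambda>p q. ev f (S p \<cdot> (x \<cdot> q)))"
      by (simp add: wv D_one lin_rules S_one one_l one_r)
    also have "\<dots> = D w (\<lambda>a b. D v (\<lambda>p q. ev f (S p \<cdot> (S a \<cdot> (x \<cdot> (b \<cdot> q))))))"
      by (simp add: D_mul lin_rules S_mul assoc)
    also have "\<dots> = D v (\<lambda>p q. D w (\<lambda>a b. ev f (S p \<cdot> ((S a \<cdot> (x \<cdot> b)) \<cdot> q))))"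
      by (subst teval_swap) (simp add: assoc)
    also have "\<dots> = D v (\<lambda>p q. ev f (S p \<cdot> (kappa (kappa x) \<cdot> q)))"
      using kappa_kappa[of "\<lambda>z. ev f (S _ \<cdot> (z \<cdot> _))" x] by (simp add: lin_rules)
    finally show ?thesis .
  qed
  show ?thesis
  proof (rule vec_eqI[OF assms(1,2)])
    fix f show "ev f x = ev f y" by (simp only: K[of f x] K[of f y] assms(3))
  qed
qed

section \<open>The integral: shift identity and nondegeneracy\<close>

lemma rho_basis: "i < dim H \<Longrightarrow> \<rho> (basis H i) = rho i"
  by (simp add: dual_apply_def basis_def if_distrib[of "(*) _"] sum.delta cong: if_cong conj_cong)

lemma right_integral: assumes F: "lin H F" shows "D x (\<lambda>p q. \<rho> p * F q) = \<rho> x * F \<one>"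
proof (rule lin_eqI[where x = x])
  fix i assume i: "i < dim H"
  have "tevalv H (cop H (basis H i)) (\<lambda>p q. smul (\<rho> p) q) = smul (rho i) \<one>"
  proof -
    have b0: "basis H b k = 0" if "\<not> k < dim H" for b k using that by (simp add: basis_def)
    have "vsumover (pairs H) (\<lambda>(a,b). smul (delta H i a b) (smul (\<rho> (basis H a)) (basis H b)))
        = vsumover (pairs H) (\<lambda>(a,b). smul (delta H i a b * rho a) (basis H b))"
      unfolding vsumover_def pairs_def by (rule ext, rule sum.cong) (auto simp: smul_def rho_basis)
    moreover have "tevalv H (cop H (basis H i)) (\<lambda>p q. smul (\<rho> p) q) = vsumover (pairs H) (\<lambda>(a,b). smul (delta H i a b) (smul (\<rho> (basis H a)) (basis H b)))"
      unfolding tevalv_def vsumover_def by (rule ext) (auto simp: teval_basis[OF i] pairs_def smul_def sum.cartesian_product case_prod_unfold b0 intro!: sum.neutral)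
    ultimately show ?thesis using rho_int[OF i] by simp
  qed
  moreover have "teval H (cop H (basis H i)) (\<lambda>p q. F (smul (\<rho> p) q)) = F (tevalv H (cop H (basis H i)) (\<lambda>p q. smul (\<rho> p) q))"
    by (rule teval_lin[OF F])
  ultimately show "D (basis H i) (\<lambda>p q. \<rho> p * F q) = \<rho> (basis H i) * F \<one>"
    by (simp add: lin_smul[OF F] rho_basis i)
qed (simp_all add: lin_rules F)

text \<open>Both sides come from rho(x_(1) y_(1)) x_(2) y_(2) S(y_(3)): either y_(2) S(y_(3))
  collapses, or the integral property is applied to x y_(1).\<close>

lemma rho_shift: assumes F: "lin H F"
  shows "D y (\<lambda>p q. \<rho> (x \<cdot> p) * F (S q)) = D x (\<lambda>p q. \<rho> (p \<cdot> y) * F q)"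
proof -
  note F' = lin_comp[OF F]
  have "D x (\<lambda>p q. \<rho> (p \<cdot> y) * F q) = D x (\<lambda>p q. D y (\<lambda>r s. \<epsilon> s * (\<rho> (p \<cdot> r) * F q)))"
    by (simp add: counit_rules lin_rules)
  also have "\<dots> = D x (\<lambda>p q. D y (\<lambda>r s. D s (\<lambda>s1 s2. \<rho> (p \<cdot> r) * F (q \<cdot> (s1 \<cdot> S s2)))))"
    using ant_r[of "\<lambda>z. F (_ \<cdot> z)"] by (simp add: teval_scalar lin_rules F' one_r lin_trunc[OF F] mult_ac)
  also have "\<dots> = D x (\<lambda>p q. D y (\<lambda>t s2. D t (\<lambda>r s1. \<rho> (p \<cdot> r) * F (q \<cdot> (s1 \<cdot> S s2)))))"
    by (simp only: coassoc)
  also have "\<dots> = D y (\<lambda>t s2. D (x \<cdot> t) (\<lambda>p q. \<rho> p * F (q \<cdot> S s2)))"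
    by (subst teval_swap) (simp add: D_mul lin_rules F' assoc)
  also have "\<dots> = D y (\<lambda>p q. \<rho> (x \<cdot> p) * F (S q))"
    by (subst right_integral) (simp_all add: lin_rules F' one_l lin_trunc[OF F])
  finally show ?thesis by simp
qed

lemma rho_ex: "\<exists>b. \<rho> b \<noteq> 0"
proof -
  obtain i where i: "i < dim H" "rho i \<noteq> 0" using rho_nz by blast
  then show ?thesis using rho_basis by metis
qed

lemma lin_expand_swap: "lin H F \<Longrightarrow> F y = (\<Sum>k<dim H. F (basis H k) * y k)"
  by (subst lin_expand[of H F]) (simp_all add: mult.commute)

text \<open>The left radical of the form rho(ab) is a right ideal and, by rho_shift, a right coideal.
  As it contains eps(a) 1 for each of its elements a, the counit vanishes on it, so a = eps(a_(1)) a_(2) = 0.\<close>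

lemma rho_nondegenerate_left: assumes a: "a \<in> vecs H" "\<And>b. \<rho> (a \<cdot> b) = 0" shows "a = (\<lambda>k. 0)"
proof -
  obtain b0 where b0: "\<rho> b0 \<noteq> 0" using rho_ex by blast
  have Z: "D a (\<lambda>p q. \<rho> (p \<cdot> b) * F q) = 0" if "lin H F" "\<And>b. \<rho> (a \<cdot> b) = 0" for a b F
    using rho_shift[OF that(1), of b a] that(2) by (simp add: teval_scalar teval_def)
  have eps0: "\<epsilon> a = 0" if a: "\<And>b. \<rho> (a \<cdot> b) = 0" for a
  proof -
    have "\<epsilon> a * \<rho> b0 = D a (\<lambda>p q. \<rho> (p \<cdot> (S q \<cdot> b0)))" by (simp add: dual_ant_r)
    \<comment> \<open>Expansion in the basis separates the two legs of the coproduct, so that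
      \<open>Z\<close> kills every summand.\<close>
    also have "\<dots> = D a (\<lambda>p q. \<Sum>k<dim H. \<rho> (p \<cdot> basis H k) * (S q \<cdot> b0) k)"
      by (subst lin_expand_swap[where F = "\<lambda>z. \<rho> (_ \<cdot> z)"]) (simp_all add: lin_rules)
    also have "\<dots> = (\<Sum>k<dim H. D a (\<lambda>p q. \<rho> (p \<cdot> basis H k) * (S q \<cdot> b0) k))" by (rule teval_sum)
    also have "\<dots> = 0" by (intro sum.neutral ballI Z a) (auto intro!: lin_coordt simp: lin_rules)
    finally show ?thesis using b0 by simp
  qed
  show ?thesis
  proof (rule vec_eqI)
    fix f
    let ?a = "tevalv H (cop H a) (\<lambda>p q. smul (ev f q) p)"
    have "\<epsilon> ?a = 0"
    proof (rule eps0)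
      fix b show "\<rho> (?a \<cdot> b) = 0"
        using Z[of "ev f" a b] a(2) teval_lin[of H "\<lambda>z. \<rho> (z \<cdot> b)" "cop H a" "\<lambda>p q. smul (ev f q) p"]
          lin_smul[of "\<lambda>z. \<rho> (z \<cdot> b)"]
        by (simp add: lin_rules mult.commute)
    qed
    moreover have "\<epsilon> ?a = ev f a"
      using teval_lin[of H \<epsilon> "cop H a" "\<lambda>p q. smul (ev f q) p"] lin_smul[of \<epsilon>] by (simp add: lin_rules counit_rules)
    ultimately show "ev f a = ev f (\<lambda>k. 0)" by (simp add: dual_apply_def)
  qed (simp_all add: a, simp add: vecs_def)
qed

text \<open>Mirror image for the right radical: \<open>rho_shift\<close> is used for F o S^-1, and
  the counit is recovered from S^-1(a_(2)) a_(1).\<close>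

lemma rho_nondegenerate_right: assumes a: "a \<in> vecs H" "\<And>b. \<rho> (b \<cdot> a) = 0" shows "a = (\<lambda>k. 0)"
proof -
  obtain b0 where b0: "\<rho> b0 \<noteq> 0" using rho_ex by blast
  have Z: "D a (\<lambda>p q. \<rho> (b \<cdot> p) * F q) = 0" if "lin H F" "\<And>b. \<rho> (b \<cdot> a) = 0" for a b F
    using rho_shift[of "\<lambda>q. F (Si q)" a b] that(2)
    by (simp add: lin_comp[OF that(1)] lin_rules lin_trunc[OF that(1)])
      (simp add: rho_shift[of "\<lambda>q. F (Si q)"] teval_def)
  have eps0: "\<epsilon> a = 0" if a: "\<And>b. \<rho> (b \<cdot> a) = 0" for a
  proof -
    have "\<epsilon> a * \<rho> b0 = D a (\<lambda>p q. \<rho> (b0 \<cdot> (Si q \<cdot> p)))"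
      by (subst anti_l) (simp_all add: lin_rules one_r)
    also have "\<dots> = D a (\<lambda>p q. \<Sum>k<dim H. \<rho> (basis H k \<cdot> p) * (b0 \<cdot> Si q) k)"
      by (subst assoc[symmetric], subst lin_expand_swap[where F = "\<lambda>z. \<rho> (z \<cdot> _)"]) (simp_all add: lin_rules)
    also have "\<dots> = (\<Sum>k<dim H. D a (\<lambda>p q. \<rho> (basis H k \<cdot> p) * (b0 \<cdot> Si q) k))" by (rule teval_sum)
    also have "\<dots> = 0" by (intro sum.neutral ballI Z a) (auto intro!: lin_coordt simp: lin_rules)
    finally show ?thesis using b0 by simp
  qed
  show ?thesis
  proof (rule vec_eqI)
    fix f
    let ?a = "tevalv H (cop H a) (\<lambda>p q. smul (ev f q) p)"
    have "\<epsilon> ?a = 0"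
    proof (rule eps0)
      fix b show "\<rho> (b \<cdot> ?a) = 0"
        using Z[of "ev f" a b] a(2) teval_lin[of H "\<lambda>z. \<rho> (b \<cdot> z)" "cop H a" "\<lambda>p q. smul (ev f q) p"]
          lin_smul[of "\<lambda>z. \<rho> (b \<cdot> z)"]
        by (simp add: lin_rules mult.commute)
    qed
    moreover have "\<epsilon> ?a = ev f a"
      using teval_lin[of H \<epsilon> "cop H a" "\<lambda>p q. smul (ev f q) p"] lin_smul[of \<epsilon>] by (simp add: lin_rules counit_rules)
    ultimately show "ev f a = ev f (\<lambda>k. 0)" by (simp add: dual_apply_def)
  qed (simp_all add: a, simp add: vecs_def)
qed

end

context quasitri
begin

text \<open>The hexagons split the second legs of R21 and R, giving R21 R31 R13 R12; the two inner
  factors are Q13.\<close>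

lemma Q_copr: assumes F: "trilin H F"
  shows "teval H Q (\<lambda>p x. D x (\<lambda>q r. F p q r))
    = teval H R (\<lambda>a b. teval H Q (\<lambda>p q. teval H R (\<lambda>c e. F (b \<cdot> (p \<cdot> c)) (a \<cdot> e) q)))"
proof -
  note F1 = trilin_1[OF F] and F2 = trilin_2[OF F] and F3 = trilin_3[OF F]
  have "teval H Q (\<lambda>p x. D x (\<lambda>q r. F p q r))
     = teval H R (\<lambda>a b. teval H R (\<lambda>c e. D a (\<lambda>q1 r1. D e (\<lambda>q2 r2. F (b \<cdot> c) (q1 \<cdot> q2) (r1 \<cdot> r2)))))"
    by (subst teval_Q) (simp_all add: lin_rules F1 F2 F3 D_mul)
  also have "\<dots> = teval H R (\<lambda>a b. D a (\<lambda>q1 r1. teval H R (\<lambda>c e. D e (\<lambda>q2 r2. F (b \<cdot> c) (q1 \<cdot> q2) (r1 \<cdot> r2)))))"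
    by (subst (2) teval_swap) (rule refl)
  also have "\<dots> = teval H R (\<lambda>a b. teval H R (\<lambda>a' b'. teval H R (\<lambda>c e. D e (\<lambda>q2 r2. F (b \<cdot> b' \<cdot> c) (a \<cdot> q2) (a' \<cdot> r2)))))"
    by (subst hexl) (simp_all add: lin_rules F1 F2 F3)
  also have "\<dots> = teval H R (\<lambda>a b. teval H R (\<lambda>a' b'. teval H R (\<lambda>c e. teval H R (\<lambda>c' e'. F (b \<cdot> ((b' \<cdot> c) \<cdot> c')) (a \<cdot> e') (a' \<cdot> e)))))"
    by (subst hexr) (simp_all add: lin_rules F1 F2 F3 assoc)
  also have "\<dots> = teval H R (\<lambda>a b. teval H Q (\<lambda>p q. teval H R (\<lambda>c e. F (b \<cdot> (p \<cdot> c)) (a \<cdot> e) q)))"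
    by (simp add: teval_Q lin_rules F1 F2 F3)
  finally show ?thesis .
qed

lemma Qm_epsl: "lin H F \<Longrightarrow> teval H Qm (\<lambda>p q. \<epsilon> p * F q) = F \<one>"
proof -
  assume F: "lin H F"
  note F' = lin_comp[OF F]
  have "teval H Qm (\<lambda>p q. \<epsilon> p * F q) = teval H R (\<lambda>a b. \<epsilon> a * teval H R (\<lambda>c e. \<epsilon> e * F (b \<cdot> S c)))"
    by (simp add: teval_Qm Ri_S lin_rules F F' eps_mul eps_S teval_mulc2[symmetric] mult.assoc)
  then show ?thesis by (simp add: R_epsl R_epsr lin_rules F F' one_r one_l lin_trunc[OF F] S_one)
qed

end

lemma smul_smul: "smul (c::'a::field) (smul d x) = smul (c * d) x" by (simp add: smul_def mult.assoc)

context hopf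
begin
lemma lin_vadd: "lin H F \<Longrightarrow> F (vadd x y) = F x + F y"
  by (subst (1 2 3) lin_expand[of H F]) (simp_all add: vadd_def distrib_right sum.distrib)
lemma mul_smul1: "smul c x \<cdot> y = smul c (x \<cdot> y)"
  by (rule vec_eqI[where H = H]) (simp_all add: smul_vecs dual_apply_smul lin_smul[of "\<lambda>x. ev _ (x \<cdot> y)"] lin_rules)
lemma mul_smul2: "x \<cdot> smul c y = smul c (x \<cdot> y)"
  by (rule vec_eqI[where H = H]) (simp_all add: smul_vecs dual_apply_smul lin_smul[of "\<lambda>y. ev _ (x \<cdot> y)"] lin_rules)
lemma S_smul: "S (smul c y) = smul c (S y)"
  by (rule vec_eqI[where H = H]) (simp_all add: smul_vecs dual_apply_smul lin_smul[of "\<lambda>y. ev _ (S y)"] lin_rules)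
end

context ribbon_int
begin

section \<open>The relations in degree 0\<close>

definition S0 where "S0 a = tevalv H Q (\<lambda>p q. smul (\<rho> (a \<cdot> p)) (S q))"
text \<open>The map S' of the overview.\<close>

definition Sb where "Sb a = tevalv H Qm (\<lambda>p q. smul (\<rho> (a \<cdot> p)) (S q))"
text \<open>The parameter is v for \<open>S0\<close> and w for \<open>Sb\<close>, because Q^-1 = (v
  (x) v) Delta(w) mirrors Q = (w (x) w) Delta(v).\<close>

definition P where "P z a = tevalv H (cop H a) (\<lambda>p q. smul (\<rho> (p \<cdot> z)) q)"

lemma S0_vecs[simp]: "S0 a \<in> vecs H" and Sb_vecs[simp]: "Sb a \<in> vecs H" and P_vecs[simp]: "P z a \<in> vecs H"
  by (simp_all add: S0_def Sb_def P_def)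

lemma lin_S0: "lin H F \<Longrightarrow> F (S0 a) = teval H Q (\<lambda>p q. \<rho> (a \<cdot> p) * F (S q))"
  unfolding S0_def by (subst teval_lin[symmetric], assumption) (simp add: lin_smul)
lemma lin_Sb: "lin H F \<Longrightarrow> F (Sb a) = teval H Qm (\<lambda>p q. \<rho> (a \<cdot> p) * F (S q))"
  unfolding Sb_def by (subst teval_lin[symmetric], assumption) (simp add: lin_smul)
lemma lin_P: "lin H F \<Longrightarrow> F (P z a) = D a (\<lambda>p q. \<rho> (p \<cdot> z) * F q)"
  unfolding P_def by (subst teval_lin[symmetric], assumption) (simp add: lin_smul)

lemma vlin_S0: "vlin H t \<Longrightarrow> vlin H (\<lambda>x. S0 (t x))"
  unfolding S0_def by (intro vlin_tevalv) (simp add: lin_rules)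
lemma vlin_scalar: "vlin H t \<Longrightarrow> t (smul c x) = smul c (t x)" if "\<And>x. t x \<in> vecs H" for t
  by (rule vec_eqI[where H = H]) (simp_all add: that smul_vecs dual_apply_smul lin_smul[of "\<lambda>x. ev _ (t x)"] lin_rules)

lemma S0_P: "S0 a = w \<cdot> P v (w \<cdot> a)"
proof (rule vec_eqI)
  fix f
  have "ev f (S0 a) = D v (\<lambda>p q. \<rho> (a \<cdot> (w \<cdot> p)) * ev f (S (w \<cdot> q)))"
    by (simp add: lin_S0 lin_rules Q_v)
  also have "\<dots> = D v (\<lambda>p q. \<rho> (a \<cdot> w \<cdot> p) * ev f (S q \<cdot> w))"
    by (simp add: S_mul S_w assoc)
  also have "\<dots> = D (a \<cdot> w) (\<lambda>p q. \<rho> (p \<cdot> v) * ev f (q \<cdot> w))"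
    by (rule rho_shift) (simp add: lin_rules)
  also have "\<dots> = D (w \<cdot> a) (\<lambda>p q. \<rho> (p \<cdot> v) * ev f (w \<cdot> q))"
    by (simp only: w_c(1))
  also have "\<dots> = ev f (w \<cdot> P v (w \<cdot> a))"
    by (rule lin_P[symmetric]) (simp add: lin_rules)
  finally show "ev f (S0 a) = ev f (w \<cdot> P v (w \<cdot> a))" .
qed simp_all

lemma Sb_P: "Sb a = v \<cdot> P w (v \<cdot> a)"
proof (rule vec_eqI)
  fix f
  have "ev f (Sb a) = D w (\<lambda>p q. \<rho> (a \<cdot> (v \<cdot> p)) * ev f (S (v \<cdot> q)))"
    by (simp add: lin_Sb lin_rules Qm_w)
  also have "\<dots> = D w (\<lambda>p q. \<rho> (a \<cdot> v \<cdot> p) * ev f (S q \<cdot> v))"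
    by (simp add: S_mul S_v assoc)
  also have "\<dots> = D (a \<cdot> v) (\<lambda>p q. \<rho> (p \<cdot> w) * ev f (q \<cdot> v))"
    by (rule rho_shift) (simp add: lin_rules)
  also have "\<dots> = D (v \<cdot> a) (\<lambda>p q. \<rho> (p \<cdot> w) * ev f (v \<cdot> q))"
    by (simp only: v_c(1))
  also have "\<dots> = ev f (v \<cdot> P w (v \<cdot> a))"
    by (rule lin_P[symmetric]) (simp add: lin_rules)
  finally show "ev f (Sb a) = ev f (v \<cdot> P w (v \<cdot> a))" .
qed simp_all

text \<open>In Q = (w (x) w) Delta(v) the second w cancels the v under rho. What is left is
  rho(S(v_(2))) w v_(1), which S(v) = v turns into the integral property evaluated at v.\<close>

lemma gauss_sum: assumes F: "lin H F" shows "teval H Q (\<lambda>p q. \<rho> (S q \<cdot> v) * F p) = \<rho> v * F w"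
proof -
  note F' = lin_comp[OF F]
  have e: "S (w \<cdot> q) \<cdot> v = S q" for q by (simp add: S_mul S_w assoc wv one_r trunc_id)
  have "teval H Q (\<lambda>p q. \<rho> (S q \<cdot> v) * F p) = D v (\<lambda>p q. \<rho> (S q) * F (w \<cdot> p))"
    by (simp add: Q_v lin_rules F' e)
  also have "\<dots> = D (S v) (\<lambda>p q. \<rho> p * F (w \<cdot> Si q))"
    by (simp add: D_S lin_rules F')
  also have "\<dots> = \<rho> v * F w"
    by (subst right_integral) (simp_all add: lin_rules F' S_v Si_one one_r lin_trunc[OF F])
  finally show ?thesis .
qed

text \<open>The coproduct falls on the second leg of Q, where \<open>Q_copr\<close> isolates the
  factor Q13. \<open>gauss_sum\<close> replaces it by the central w, after which the outer R21 and
  R12 meet and form Q again.\<close>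

lemma P_S0: "P v (S0 a) = smul (\<rho> v) (S0 (w \<cdot> a))"
proof (rule vec_eqI)
  fix f
  have "ev f (P v (S0 a)) = D (S0 a) (\<lambda>p q. \<rho> (p \<cdot> v) * ev f q)" by (rule lin_P) (simp add: lin_rules)
  also have "\<dots> = teval H Q (\<lambda>p q. \<rho> (a \<cdot> p) * D (S q) (\<lambda>p q. \<rho> (p \<cdot> v) * ev f q))"
    by (rule lin_S0) (simp add: lin_rules)
  also have "\<dots> = teval H Q (\<lambda>p x. D x (\<lambda>q r. \<rho> (a \<cdot> p) * (\<rho> (S r \<cdot> v) * ev f (S q))))"
    by (simp add: D_S lin_rules teval_mulc2)
  also have "\<dots> = teval H R (\<lambda>x b. teval H Q (\<lambda>p q. teval H R (\<lambda>c e. \<rho> (a \<cdot> (b \<cdot> (p \<cdot> c))) * (\<rho> (S q \<cdot> v) * ev f (S (x \<cdot> e))))))"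
    by (rule Q_copr) (simp add: lin_rules)
  also have "\<dots> = teval H R (\<lambda>x b. teval H Q (\<lambda>p q. \<rho> (S q \<cdot> v) * teval H R (\<lambda>c e. \<rho> (a \<cdot> (b \<cdot> (p \<cdot> c))) * ev f (S (x \<cdot> e)))))"
    by (simp only: teval_mulc2[symmetric] mult.left_commute)
  also have "\<dots> = teval H R (\<lambda>x b. \<rho> v * teval H R (\<lambda>c e. \<rho> (a \<cdot> (b \<cdot> (w \<cdot> c))) * ev f (S (x \<cdot> e))))"
    by (subst gauss_sum) (simp_all add: lin_rules)
  also have "\<dots> = \<rho> v * teval H R (\<lambda>x b. teval H R (\<lambda>c e. \<rho> (a \<cdot> (b \<cdot> (w \<cdot> c))) * ev f (S (x \<cdot> e))))"
    by (rule teval_mulc2)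
  also have "\<dots> = \<rho> v * teval H R (\<lambda>x b. teval H R (\<lambda>c e. \<rho> (w \<cdot> a \<cdot> (b \<cdot> c)) * ev f (S (x \<cdot> e))))"
    by (simp only: assoc w_c(2)[of b for b] w_c(2)[of a])
  also have "\<dots> = \<rho> v * ev f (S0 (w \<cdot> a))"
    by (simp add: lin_S0 lin_rules teval_Q)
  finally show "ev f (P v (S0 a)) = ev f (smul (\<rho> v) (S0 (w \<cdot> a)))" by (simp add: dual_apply_smul)
qed (simp_all add: smul_vecs)

lemma S0_T_S0: "S0 (v \<cdot> S0 a) = smul (\<rho> v) (w \<cdot> S0 (w \<cdot> a))"
proof -
  have "S0 (v \<cdot> S0 a) = w \<cdot> P v (S0 a)" by (simp add: S0_P[of "v \<cdot> _"] vwc trunc_id)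
  then show ?thesis by (simp add: P_S0 mul_smul2)
qed

lemma S0_kappa: "S0 a = kappa (Sb a)"
proof (rule vec_eqI)
  fix f
  show "ev f (S0 a) = ev f (kappa (Sb a))"
    using lin_Sb[of "\<lambda>z. ev f (kappa z)" a] Q_kappa[of "\<lambda>p q. \<rho> (a \<cdot> p) * ev f q"]
    by (simp add: lin_rules lin_S0 vlin_kappa)
qed simp_all

text \<open>Factorizability for linear forms: \<open>phi\<close> records t on the basis and is set
  to zero elsewhere, as \<open>Phibar\<close> is injective only on \<open>vecs H\<close>; it has the
  same image as the zero functional.\<close>

lemma Q_nondegenerate: assumes "lin H t" "\<And>f. teval H Q (\<lambda>p q. t p * ev f q) = 0" shows "t x = 0"
proof -
  define phi where "phi = (\<lambda>i. if i < dim H then t (basis H i) else 0)"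
  have phi: "phi \<in> vecs H" by (simp add: phi_def vecs_def)
  have e: "ev f (Phibar H R \<psi>) = (\<Sum>i<dim H. \<Sum>j<dim H. Q i j * (\<psi> i * ev f (basis H j)))" for f \<psi>
  proof -
    have "Phibar H R \<psi> = (\<lambda>k. \<Sum>a<dim H. \<Sum>b<dim H. Q a b * \<psi> a * basis H b k)"
      unfolding Phibar_def by (rule vsum_pairs[where G = "\<lambda>a b. basis H b"])
    then have "Phibar H R \<psi> = tevalv H (\<lambda>a b. Q a b * \<psi> a) (\<lambda>a b. b)"
      by (auto simp: tevalv_def teval_def fun_eq_iff basis_def intro!: sum.neutral)
    then show ?thesis by (simp add: dual_apply_tevalv) (simp add: teval_def mult.assoc)
  qed
  have v: "Phibar H R \<psi> \<in> vecs H" for \<psi>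
    by (auto simp: Phibar_def vsum_pairs vecs_def basis_def intro!: sum.neutral)
  have "Phibar H R phi = Phibar H R (\<lambda>k. 0)"
  proof (rule vec_eqI)
    fix f show "ev f (Phibar H R phi) = ev f (Phibar H R (\<lambda>k. 0))"
      using assms(2)[of f] by (simp add: e phi_def teval_def)
  qed (simp_all add: v)
  then have "phi = (\<lambda>k. 0)" using Phibar_inj phi by (auto dest!: inj_onD simp: vecs_def)
  then have "t (basis H i) = 0" if "i < dim H" for i using that by (metis phi_def)
  then show ?thesis by (subst lin_expand[OF assms(1)]) simp
qed

lemma Qm_nondegenerate: assumes t: "lin H t" and "\<And>f. teval H Qm (\<lambda>p q. t p * ev f q) = c * ev f \<one>" shows "t x = c * \<epsilon> x"
proof -
  have A: "teval H Qm (\<lambda>p q. t p * F q) = c * F \<one>" if F: "lin H F" for F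
  proof -
    have "F = ev (\<lambda>k. F (basis H k))"
      by (rule ext) (subst lin_expand[OF F], simp add: dual_apply_def mult.commute)
    then show ?thesis using assms(2)[of "\<lambda>k. F (basis H k)"] by simp
  qed
  \<comment> \<open>\<open>Q_kappa\<close> transforms the second leg of Q^-1 into that of Q, so an
    equation known for \<open>Qm\<close> becomes one for Q. Both t and c eps yield c times the same
    value at the unit, and their difference is killed by \<open>Q_nondegenerate\<close>.\<close>
  have B: "teval H Q (\<lambda>p q. t' p * ev f q) = teval H Qm (\<lambda>p q. t' p * ev f (Si (kappa (S q))))" if t': "lin H t'" for t' f
    using Q_kappa[of "\<lambda>p q. t' p * ev f (Si q)"] by (simp add: lin_rules lin_comp[OF t'])
  have "teval H Q (\<lambda>p q. (t p - c * \<epsilon> p) * ev f q) = 0" for f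
  proof -
    have "teval H Q (\<lambda>p q. (t p - c * \<epsilon> p) * ev f q) = teval H Q (\<lambda>p q. t p * ev f q) - c * teval H Q (\<lambda>p q. \<epsilon> p * ev f q)"
      by (simp add: teval_def algebra_simps sum_subtractf sum_distrib_left)
    also have "\<dots> = c * ev f (Si (kappa (S \<one>))) - c * ev f (Si (kappa (S \<one>)))"
      using B[OF t, of f] B[OF lin_counit0, of f] A[of "\<lambda>q. ev f (Si (kappa (S q)))"] Qm_epsl[of "\<lambda>q. ev f (Si (kappa (S q)))"]
      by (simp add: lin_rules vlin_kappa)
    finally show ?thesis by simp
  qed
  then have "t x - c * \<epsilon> x = 0" by (intro Q_nondegenerate[where t = "\<lambda>x. t x - c * \<epsilon> x"]) (simp_all add: lin_rules t)
  then show ?thesis by simp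
qed

text \<open>rho(v Q_1) Q_2 = rho(v_(1)) w v_(2) = rho(v) w. If this vanished, nondegeneracy of Q
  would give rho(v x) = 0 for all x, against the invertibility of v.\<close>

lemma rho_v_nz: "\<rho> v \<noteq> 0"
proof
  assume z: "\<rho> v = 0"
  have "\<rho> (v \<cdot> x) = 0" for x
  proof (rule Q_nondegenerate[where t = "\<lambda>x. \<rho> (v \<cdot> x)"])
    fix f
    have "teval H Q (\<lambda>p q. \<rho> (v \<cdot> p) * ev f q) = D v (\<lambda>p q. \<rho> p * ev f (w \<cdot> q))"
      by (simp add: Q_v lin_rules vwc)
    also have "\<dots> = 0" by (subst right_integral) (simp_all add: lin_rules z)
    finally show "teval H Q (\<lambda>p q. \<rho> (v \<cdot> p) * ev f q) = 0" .
  qed (simp add: lin_rules)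
  then have "\<rho> (v \<cdot> (w \<cdot> x)) = 0" for x by blast
  then show False using rho_ex by (simp add: vwc)
qed

text \<open>By coassociativity \<open>P w\<close> after \<open>P v\<close> is the map a |->
  theta(a_(1)) a_(2). The value at the unit, \<open>lam\<close>, is rho(v) rho(w).\<close>

definition theta where "theta x = D x (\<lambda>p q. \<rho> (p \<cdot> v) * \<rho> (q \<cdot> w))"
definition lam where "lam = theta \<one>"

lemma lin_theta: "vlin H t \<Longrightarrow> lin H (\<lambda>x. theta (t x))" by (simp add: theta_def lin_rules)

lemma P_P: assumes F: "lin H F" shows "F (P w (P v a)) = D a (\<lambda>p q. theta p * F q)"
proof -
  note F' = lin_comp[OF F]
  have "F (P w (P v a)) = D (P v a) (\<lambda>p q. \<rho> (p \<cdot> w) * F q)" by (rule lin_P[OF F])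
  also have "\<dots> = D a (\<lambda>p x. \<rho> (p \<cdot> v) * D x (\<lambda>p q. \<rho> (p \<cdot> w) * F q))" by (rule lin_P) (simp add: lin_rules)
  also have "\<dots> = D a (\<lambda>p x. D x (\<lambda>q r. \<rho> (p \<cdot> v) * \<rho> (q \<cdot> w) * F r))" by (simp add: teval_mulc2 mult.assoc)
  also have "\<dots> = D a (\<lambda>x r. D x (\<lambda>p q. \<rho> (p \<cdot> v) * \<rho> (q \<cdot> w) * F r))" by (rule coassoc[symmetric])
  also have "\<dots> = D a (\<lambda>p q. theta p * F q)" by (simp add: teval_mulc1 theta_def)
  finally show ?thesis .
qed

lemma Sb_S0: "Sb (S0 a) = v \<cdot> P w (P v (w \<cdot> a))"
proof -
  have "P w (v \<cdot> S0 a) = P w (P v (w \<cdot> a))" by (simp add: S0_P vwc trunc_id)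
  then show ?thesis by (simp add: Sb_P)
qed

lemma S0_smul: "S0 (smul c x) = smul c (S0 x)" by (rule vlin_scalar) (simp_all add: vlin_S0 lin_rules)

lemma smul_cancel: "c \<noteq> 0 \<Longrightarrow> smul c x = smul c y \<Longrightarrow> x = y"
  by (auto simp: smul_def fun_eq_iff)

text \<open>In S T S T S the relation \<open>S0_T_S0\<close> contracts either the outer or the inner
  three factors. The results are rho(v) T^-1 S S and rho(v) S S T^-1, and \<open>rho_v_nz\<close>
  cancels the scalar.\<close>

lemma S0_S0_w: "S0 (S0 (w \<cdot> a)) = w \<cdot> S0 (S0 a)"
proof -
  have "S0 (v \<cdot> S0 (v \<cdot> S0 a)) = smul (\<rho> v) (w \<cdot> S0 (w \<cdot> (v \<cdot> S0 a)))" by (rule S0_T_S0)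
  then have "S0 (v \<cdot> S0 (v \<cdot> S0 a)) = smul (\<rho> v) (w \<cdot> S0 (S0 a))" by (simp add: vwc trunc_id)
  moreover have "S0 (v \<cdot> S0 (v \<cdot> S0 a)) = smul (\<rho> v) (S0 (S0 (w \<cdot> a)))"
    by (simp only: S0_T_S0[of a] mul_smul2 S0_smul) (simp add: vwc trunc_id)
  ultimately show ?thesis using smul_cancel[OF rho_v_nz] by metis
qed

text \<open>Cancelling kappa from S0 S0 = kappa Sb S0, both sides of which commute with w.\<close>

lemma P_P_w: "P w (P v (w \<cdot> a)) = w \<cdot> P w (P v a)"
proof -
  have "kappa (Sb (S0 (w \<cdot> x))) = kappa (w \<cdot> Sb (S0 x))" for x
    using S0_S0_w[of x] by (simp add: S0_kappa[of "S0 _"] kappa_mulw)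
  then have "Sb (S0 (w \<cdot> x)) = w \<cdot> Sb (S0 x)" for x by (rule kappa_inj[rotated 2]) simp_all
  from this[of "v \<cdot> a"] have "v \<cdot> P w (P v (w \<cdot> trunc H a)) = P w (P v (trunc H a))"
    by (simp only: Sb_S0 vwc) (simp add: trunc_id)
  then have "w \<cdot> (v \<cdot> P w (P v (w \<cdot> trunc H a))) = w \<cdot> P w (P v (trunc H a))" by simp
  moreover have "P v (trunc H a) = P v a" by (simp add: P_def)
  ultimately show ?thesis by (simp add: vwc trunc_id)
qed

text \<open>Applying the counit to P_P_w gives theta(w x) = theta(x); evaluating it at 1, where
  the coproduct of w is (w (x) w) Qm, gives theta(Qm_1) Qm_2 = theta(1) 1.\<close>

lemma theta_eq: "theta x = lam * \<epsilon> x"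
proof -
  have thw: "theta (w \<cdot> x) = theta x" for x
  proof -
    have "\<epsilon> (P w (P v (w \<cdot> x))) = \<epsilon> (P w (P v x))" by (simp add: P_P_w eps_mul eps_w)
    then show ?thesis by (simp add: P_P counit_rules lin_rules lin_theta[OF vlin_id])
  qed
  show ?thesis
  proof (rule Qm_nondegenerate)
    fix f
    have "ev f (v \<cdot> P w (P v (w \<cdot> \<one>))) = ev f (P w (P v \<one>))" by (simp only: P_P_w vwc) (simp add: trunc_id)
    moreover have "ev f (P w (P v \<one>)) = lam * ev f \<one>" by (simp add: P_P lin_rules D_one lin_theta[OF vlin_id] lam_def)
    moreover have "ev f (v \<cdot> P w (P v (w \<cdot> \<one>))) = teval H Qm (\<lambda>p q. theta p * ev f q)"
      using P_P[of "\<lambda>z. ev f (v \<cdot> z)" w] by (simp add: lin_rules one_r trunc_id D_w lin_theta thw vwc)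
    ultimately show "teval H Qm (\<lambda>p q. theta p * ev f q) = lam * ev f \<one>" by simp
  qed (rule lin_theta[OF vlin_id])
qed

lemma Sb_S0_eq: "Sb (S0 a) = smul lam (trunc H a)"
proof (rule vec_eqI)
  fix f
  have "ev f (Sb (S0 a)) = D (w \<cdot> a) (\<lambda>p q. lam * (\<epsilon> p * ev f (v \<cdot> q)))"
    using P_P[of "\<lambda>z. ev f (v \<cdot> z)" "w \<cdot> a"] by (simp add: Sb_S0 lin_rules theta_eq mult.assoc)
  then show "ev f (Sb (S0 a)) = ev f (smul lam (trunc H a))"
    by (simp add: teval_mulc2 counit_rules lin_rules dual_apply_smul vwc)
qed (simp_all add: smul_vecs)

lemma kappa_smul: "kappa (smul c x) = smul c (kappa x)" by (rule vlin_scalar) (simp_all add: vlin_kappa lin_rules)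

lemma kappa_trunc: "kappa (trunc H x) = kappa x" by (simp add: kappa_def)

lemma S0_4: assumes F: "lin H F"
  shows "F (S0 (S0 (S0 (S0 a)))) = lam\<^sup>2 * D w (\<lambda>x y. F (S x \<cdot> (a \<cdot> y)))"
proof -
  have 2: "S0 (S0 x) = smul lam (kappa x)" for x
    by (simp add: S0_kappa[of "S0 _"] Sb_S0_eq kappa_smul kappa_trunc)
  show ?thesis
    by (simp add: 2 kappa_smul smul_smul lin_smul[OF F] kappa_kappa[OF F] power2_eq_square)
qed

section \<open>Integrals in A and the value of the squared scalar\<close>

definition Lambda where "Lambda = tevalv H Q (\<lambda>p q. smul (\<rho> p) q)"
text \<open>\<open>Lambda\<close> is the Drinfeld map applied to rho; here rho o S is paired with
  the other leg of Q. The two are linked by (S (x) S)(Q) = Q21.\<close>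

definition Lambda' where "Lambda' = tevalv H Q (\<lambda>p q. smul (\<rho> (S q)) p)"

lemma Lambda_vecs[simp]: "Lambda \<in> vecs H" "Lambda' \<in> vecs H" by (simp_all add: Lambda_def Lambda'_def)

lemma lin_Lambda: "lin H F \<Longrightarrow> F Lambda = teval H Q (\<lambda>p q. \<rho> p * F q)"
  unfolding Lambda_def by (subst teval_lin[symmetric], assumption) (simp add: lin_smul)
lemma lin_Lambda': "lin H F \<Longrightarrow> F Lambda' = teval H Q (\<lambda>p q. \<rho> (S q) * F p)"
  unfolding Lambda'_def by (subst teval_lin[symmetric], assumption) (simp add: lin_smul)

lemma S_Lambda': "S Lambda' = Lambda"
proof (rule vec_eqI)
  fix f
  have "ev f (S Lambda') = teval H Q (\<lambda>p q. \<rho> (S q) * ev f (S p))" by (rule lin_Lambda') (simp add: lin_rules)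
  also have "\<dots> = teval H Q (\<lambda>p q. \<rho> p * ev f q)" by (rule Q_SS) (simp add: lin_rules)
  also have "\<dots> = ev f Lambda" by (simp add: lin_Lambda lin_rules)
  finally show "ev f (S Lambda') = ev f Lambda" .
qed simp_all

text \<open>A second evaluation of theta = lam eps: \<open>rho_shift\<close> moves the coproduct
  from x to v, and Delta(v) = (v (x) v) Q produces v \<open>Lambda'\<close>. Replacing x by x w
  removes v, as eps(w) = 1.\<close>

lemma rho_Lambda': "\<rho> (x \<cdot> Lambda') = lam * \<epsilon> x"
proof -
  have 1: "\<rho> (x \<cdot> (v \<cdot> Lambda')) = lam * \<epsilon> x" for x
  proof -
    have "lam * \<epsilon> x = D v (\<lambda>p q. \<rho> (x \<cdot> p) * \<rho> (S q \<cdot> w))"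
      using rho_shift[of "\<lambda>q. \<rho> (q \<cdot> w)" v x] theta_eq[of x] by (simp add: theta_def lin_rules)
    also have "\<dots> = teval H Q (\<lambda>p q. \<rho> (x \<cdot> (v \<cdot> p)) * \<rho> (S q))"
      by (simp add: D_v lin_rules S_mul S_v assoc vw one_r)
    also have "\<dots> = \<rho> (x \<cdot> (v \<cdot> Lambda'))"
      using lin_Lambda'[of "\<lambda>z. \<rho> (x \<cdot> (v \<cdot> z))"] by (simp add: lin_rules mult.commute)
    finally show ?thesis by simp
  qed
  from 1[of "x \<cdot> w"] show ?thesis by (simp add: assoc vwc eps_mul eps_w)
qed

text \<open>The equation S' S = lam at the unit: since S(1) is the antipode of
  \<open>Lambda\<close>, it determines this functional paired with Q^-1, and nondegeneracy does the
  rest.\<close>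

lemma rho_SLam: "\<rho> (S Lambda \<cdot> x) = lam * \<epsilon> x"
proof (rule Qm_nondegenerate)
  fix f
  have s: "S0 \<one> = S Lambda"
  proof (rule vec_eqI)
    fix f show "ev f (S0 \<one>) = ev f (S Lambda)"
      using lin_Lambda[of "\<lambda>z. ev f (S z)"] by (simp add: lin_S0 lin_rules one_l)
  qed simp_all
  have "ev f (Si (Sb (S0 \<one>))) = lam * ev f \<one>"
    using lin_smul[of "\<lambda>z. ev f (Si z)" lam \<one>] by (simp add: Sb_S0_eq lin_rules Si_one trunc_id)
  then show "teval H Qm (\<lambda>p q. \<rho> (S Lambda \<cdot> p) * ev f q) = lam * ev f \<one>"
    using lin_Sb[of "\<lambda>z. ev f (Si z)" "S Lambda"] by (simp add: s lin_rules)
qed (simp add: lin_rules)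

text \<open>By \<open>rho_SLam\<close> the functionals rho(S(Lambda) z b) and eps(z) rho(S(Lambda)
  b) of b agree, so nondegeneracy makes S(Lambda) a right integral; the antipode is then removed by
  injectivity.\<close>

lemma Lambda_int: "z \<cdot> Lambda = smul (\<epsilon> z) Lambda"
proof -
  have "S Lambda \<cdot> z = smul (\<epsilon> z) (S Lambda)" for z
  proof -
    have "vadd (S Lambda \<cdot> z) (smul (- \<epsilon> z) (S Lambda)) = (\<lambda>k. 0)"
    proof (rule rho_nondegenerate_left)
      fix b
      show "\<rho> (vadd (S Lambda \<cdot> z) (smul (- \<epsilon> z) (S Lambda)) \<cdot> b) = 0"
        by (simp add: lin_vadd[of "\<lambda>y. \<rho> (y \<cdot> b)"] lin_smul[of "\<lambda>y. \<rho> (y \<cdot> b)"] lin_rules assoc rho_SLam eps_mul)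
    qed (simp_all add: vadd_vecs smul_vecs)
    then show ?thesis by (simp add: vadd_def smul_def fun_eq_iff)
  qed
  then have "S (z \<cdot> Lambda) = S (smul (\<epsilon> z) Lambda)" by (simp add: S_mul S_smul eps_S)
  then show ?thesis by (rule S_inj[rotated 2]) (simp_all add: smul_vecs)
qed

text \<open>Lambda is a left integral, which makes lam Lambda and rho(Lambda) Lambda' equal; the antipode
  maps Lambda' to Lambda, and rho(S Lambda) = lam.\<close>

lemma lam_square: "lam\<^sup>2 = (\<Sum>a<dim H. \<Sum>b<dim H. Q a b * rho a * rho b)\<^sup>2"
proof -
  have "vadd (smul lam Lambda) (smul (- \<rho> Lambda) Lambda') = (\<lambda>k. 0)"
  proof (rule rho_nondegenerate_right)
    fix b
    show "\<rho> (b \<cdot> vadd (smul lam Lambda) (smul (- \<rho> Lambda) Lambda')) = 0"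
      using lin_Lambda[of \<rho>]
      by (simp add: lin_vadd[of "\<lambda>y. \<rho> (b \<cdot> y)"] lin_smul[of "\<lambda>y. \<rho> (b \<cdot> y)"] lin_rules rho_Lambda' Lambda_int lin_smul[of \<rho>])
  qed (simp_all add: vadd_vecs smul_vecs)
  then have "smul lam Lambda = smul (\<rho> Lambda) Lambda'" by (simp add: vadd_def smul_def fun_eq_iff)
  then have "smul lam (S Lambda) = smul (\<rho> Lambda) Lambda" by (metis S_smul S_Lambda')
  then have "lam * \<rho> (S Lambda) = \<rho> Lambda * \<rho> Lambda" by (metis dual_apply_smul)
  moreover have "\<rho> (S Lambda) = lam" using rho_SLam[of \<one>] by (simp add: one_r eps_one)
  moreover have "\<rho> Lambda = (\<Sum>a<dim H. \<Sum>b<dim H. Q a b * rho a * rho b)"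
    by (simp add: lin_Lambda lin_rules) (simp add: teval_def rho_basis mult.assoc)
  ultimately show ?thesis by (simp add: power2_eq_square)
qed

end

section \<open>Cochains of higher degree\<close>

lemma tuples_0: "tuples d 0 = {[]}" by (auto simp: tuples_def)
lemma tuples_Suc: "tuples d (Suc n) = (\<lambda>(x,xs). x # xs) ` ({..<d} \<times> tuples d n)"
  by (auto simp: tuples_def image_iff length_Suc_conv)
lemma tuples_Cons: "x # xs \<in> tuples d (Suc n) \<longleftrightarrow> x < d \<and> xs \<in> tuples d n"
  by (auto simp: tuples_def)
lemma sum_tuples_Suc: "(\<Sum>xs\<in>tuples d (Suc n). g xs) = (\<Sum>x<d. \<Sum>xs\<in>tuples d n. g (x # xs))"
  unfolding tuples_Suc by (subst sum.reindex) (auto simp: inj_on_def sum.cartesian_product case_prod_unfold)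

context hopf
begin

text \<open>The Sweedler sum of the tensor product Hopf algebra on a tuple of basis vectors.\<close>

fun DL :: "nat list \<Rightarrow> (nat list \<Rightarrow> nat list \<Rightarrow> 'k) \<Rightarrow> 'k" where
  "DL [] G = G [] []"
| "DL (x # xs) G = (\<Sum>i<dim H. \<Sum>j<dim H. delta H x i j * DL xs (\<lambda>as bs. G (i # as) (j # bs)))"

lemma DL_sum: "DL xs (\<lambda>as bs. \<Sum>k\<in>K. G k as bs) = (\<Sum>k\<in>K. DL xs (G k))"
proof (induction xs arbitrary: G)
  case (Cons x xs)
  have "DL (x # xs) (\<lambda>as bs. \<Sum>k\<in>K. G k as bs)
     = (\<Sum>i<dim H. \<Sum>j<dim H. \<Sum>k\<in>K. delta H x i j * DL xs (\<lambda>as bs. G k (i # as) (j # bs)))"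
    by (simp add: Cons.IH sum_distrib_left)
  also have "\<dots> = (\<Sum>k\<in>K. \<Sum>i<dim H. \<Sum>j<dim H. delta H x i j * DL xs (\<lambda>as bs. G k (i # as) (j # bs)))"
    by (rule sum_move2[symmetric])
  finally show ?case by simp
qed simp

lemma DL_mulc: "DL xs (\<lambda>as bs. c * G as bs) = c * DL xs G"
proof (induction xs arbitrary: G)
  case (Cons x xs) then show ?case by (simp add: sum_distrib_left mult.left_commute)
qed simp

lemma DL_add: "DL xs (\<lambda>as bs. G as bs + G' as bs) = DL xs G + DL xs G'"
  by (induction xs arbitrary: G G') (simp_all add: sum.distrib distrib_left)

lemma DL_diff: "DL xs (\<lambda>as bs. G as bs - G' as bs) = DL xs G - DL xs G'"
  by (induction xs arbitrary: G G') (simp_all add: sum_subtractf right_diff_distrib)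

lemma DL_teval: "DL xs (\<lambda>as bs. teval H X (\<lambda>p q. G as bs p q)) = teval H X (\<lambda>p q. DL xs (\<lambda>as bs. G as bs p q))"
  unfolding teval_def by (simp add: DL_sum DL_mulc)

lemma DL_cong:
  assumes "xs \<in> tuples (dim H) n" "\<And>as bs. as \<in> tuples (dim H) n \<Longrightarrow> bs \<in> tuples (dim H) n \<Longrightarrow> G as bs = G' as bs"
  shows "DL xs G = DL xs G'"
  using assms
proof (induction xs arbitrary: n G G')
  case Nil then show ?case by (cases n) (auto simp: tuples_def)
next
  case (Cons x xs)
  then obtain m where n: "n = Suc m" by (cases n) (auto simp: tuples_def)
  have "DL xs (\<lambda>as bs. G (i # as) (j # bs)) = DL xs (\<lambda>as bs. G' (i # as) (j # bs))" if "i < dim H" "j < dim H" for i j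
    using Cons.prems that n by (intro Cons.IH[of m]) (auto simp: tuples_Cons)
  then show ?case by simp
qed

lemma DL_coassoc:
  assumes "set xs \<subseteq> {..<dim H}"
  shows "DL xs (\<lambda>as ls. DL as (\<lambda>js ks. G js ks ls)) = DL xs (\<lambda>js as. DL as (\<lambda>ks ls. G js ks ls))"
  using assms
proof (induction xs arbitrary: G)
  case (Cons x xs)
  let ?n = "{..<dim H}"
  \<comment> \<open>\<open>W\<close> is the contribution of the tail as a function of basis indices.
    \<open>F\<close> is its trilinear extension, needed because \<open>coassoc\<close> speaks about
    vectors and not indices.\<close>
  define W where "W j k l = DL xs (\<lambda>as ls. DL as (\<lambda>js ks. G (j # js) (k # ks) (l # ls)))" for j k l
  define F where "F p q z = (\<Sum>j\<in>?n. p j * (\<Sum>k\<in>?n. q k * (\<Sum>l\<in>?n. z l * W j k l)))" for p q z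
  have Fb: "F (basis H j) (basis H k) (basis H l) = W j k l" if "j < dim H" "k < dim H" "l < dim H" for j k l
    using that by (simp add: F_def sum_basis)
  have x: "x < dim H" using Cons.prems by simp
  have "DL (x # xs) (\<lambda>as ls. DL as (\<lambda>js ks. G js ks ls)) = D (basis H x) (\<lambda>m z. D m (\<lambda>p q. F p q z))"
    by (simp add: teval_basis x DL_sum DL_mulc W_def[symmetric] Fb)
  also have "\<dots> = D (basis H x) (\<lambda>p m. D m (\<lambda>q z. F p q z))" by (rule coassoc)
  also have "\<dots> = DL (x # xs) (\<lambda>js as. DL as (\<lambda>ks ls. G js ks ls))"
    using Cons.prems by (simp add: teval_basis x DL_sum DL_mulc Cons.IH[symmetric] W_def[symmetric] Fb)
  finally show ?case .
qed simp

definition bprod where "bprod js = prodlist H (map (basis H) js)"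
lemma bprod_simps[simp]: "bprod [] = \<one>" "bprod (j # js) = basis H j \<cdot> bprod js" by (simp_all add: bprod_def prodlist_def)
lemma bprod_vecs[simp]: "bprod js \<in> vecs H" by (cases js) simp_all

text \<open>Multiplicativity of Delta. It lets a sum over tuples that depends on products alone be
  treated by one-variable identities, which is how degree n is reduced to degree 0.\<close>

lemma DL_bprod: "bilin H F \<Longrightarrow> set xs \<subseteq> {..<dim H} \<Longrightarrow> DL xs (\<lambda>as bs. F (bprod as) (bprod bs)) = D (bprod xs) F"
proof (induction xs arbitrary: F)
  case Nil then show ?case by (simp add: D_one)
next
  case (Cons x xs)
  note F1 = bilin_left[OF Cons.prems(1)] and F2 = bilin_right[OF Cons.prems(1)]
  have "D (bprod xs) (\<lambda>r s. F (p \<cdot> r) (q \<cdot> s)) = DL xs (\<lambda>as bs. F (p \<cdot> bprod as) (q \<cdot> bprod bs))" for p q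
    using Cons.prems by (subst Cons.IH[of "\<lambda>r s. F (p \<cdot> r) (q \<cdot> s)"]) (simp_all add: lin_rules F1 F2)
  then show ?case using Cons.prems by (simp add: D_mul teval_basis)
qed

lemma DL_counit_l: "set xs \<subseteq> {..<dim H} \<Longrightarrow> DL xs (\<lambda>as bs. \<epsilon> (bprod as) * G bs) = G xs"
proof (induction xs arbitrary: G)
  case Nil then show ?case by (simp add: eps_one)
next
  case (Cons x xs)
  define F where "F q = (\<Sum>j<dim H. q j * G (j # xs))" for q :: "'k vec"
  have Fb: "F (basis H j) = G (j # xs)" if "j < dim H" for j using that by (simp add: F_def sum_basis)
  have L: "lin H F" unfolding F_def by (intro lin_sum lin_mulc1 lin_coord) simp
  have x: "x < dim H" using Cons.prems by simp
  have "DL (x # xs) (\<lambda>as bs. \<epsilon> (bprod as) * G bs) = D (basis H x) (\<lambda>p q. \<epsilon> p * F q)"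
    using Cons by (simp add: eps_mul teval_basis Fb mult.assoc DL_mulc)
  then show ?case using counit_l[OF L] Fb x by simp
qed

lemma DL_counit_r: "set xs \<subseteq> {..<dim H} \<Longrightarrow> DL xs (\<lambda>as bs. \<epsilon> (bprod bs) * G as) = G xs"
proof (induction xs arbitrary: G)
  case Nil then show ?case by (simp add: eps_one)
next
  case (Cons x xs)
  define F where "F q = (\<Sum>j<dim H. q j * G (j # xs))" for q :: "'k vec"
  have Fb: "F (basis H j) = G (j # xs)" if "j < dim H" for j using that by (simp add: F_def sum_basis)
  have L: "lin H F" unfolding F_def by (intro lin_sum lin_mulc1 lin_coord) simp
  have x: "x < dim H" using Cons.prems by simp
  have "DL (x # xs) (\<lambda>as bs. \<epsilon> (bprod bs) * G as) = D (basis H x) (\<lambda>p q. \<epsilon> q * F p)"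
    using Cons by (simp add: eps_mul teval_basis Fb mult.assoc DL_mulc)
  then show ?case using counit_r[OF L] Fb x by simp
qed

lemma prodlist_append: "prodlist H (xs @ ys) = prodlist H xs \<cdot> prodlist H ys"
proof (induction xs)
  case Nil
  have "prodlist H ys \<in> vecs H" by (cases ys) (simp_all add: prodlist_def)
  then show ?case by (simp add: prodlist_def one_l trunc_id)
next
  case (Cons x xs) then show ?case by (simp add: prodlist_def assoc)
qed

lemma prodlist_Sinv: "prodlist H (rev (map (\<lambda>j. Sinv H (basis H j)) js)) = Si (bprod js)"
proof (induction js)
  case Nil then show ?case by (simp add: prodlist_def Si_one)
next
  case (Cons j js)
  have "Sinv H (basis H j) = Si (basis H j)" by (simp add: Si_def trunc_id)
  then show ?case using Cons by (simp add: prodlist_append Si_mul) (simp add: prodlist_def one_r trunc_id)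
qed

text \<open>\<open>delta3\<close> iterates the coproduct on the left leg, so the inner
  \<open>DL\<close> splits \<open>as\<close>. The induction only separates the summation over the
  heads from that over the tails.\<close>

lemma T3_sum:
  assumes "xs \<in> tuples (dim H) n"
  shows "(\<Sum>(js,ks,ls)\<in>T3 H n. coef3 H xs js ks ls * G js ks ls) = DL xs (\<lambda>as ls. DL as (\<lambda>js ks. G js ks ls))"
  using assms
proof (induction xs arbitrary: n G)
  case Nil
  then have "n = 0" by (simp add: tuples_def)
  then show ?case by (simp add: T3_def tuples_0 coef3_def)
next
  case (Cons x xs)
  then obtain m where n: "n = Suc m" and x: "x < dim H" and xs: "xs \<in> tuples (dim H) m"
    by (cases n) (auto simp: tuples_def)
  let ?T = "tuples (dim H) m" and ?n = "{..<dim H}"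
  have T3s: "(\<Sum>(js,ks,ls)\<in>T3 H k. g js ks ls) = (\<Sum>js\<in>tuples (dim H) k. \<Sum>ks\<in>tuples (dim H) k. \<Sum>ls\<in>tuples (dim H) k. g js ks ls)" for k and g :: "nat list \<Rightarrow> nat list \<Rightarrow> nat list \<Rightarrow> 'k"
    by (simp add: T3_def sum.cartesian_product case_prod_unfold)
  have c: "coef3 H (x # xs) (j # js) (k # ks) (l # ls) = delta3 H x j k l * coef3 H xs js ks ls" for j js k ks l ls
    by (simp add: coef3_def prod.lessThan_Suc_shift del: prod.lessThan_Suc)
  have "(\<Sum>(js,ks,ls)\<in>T3 H n. coef3 H (x # xs) js ks ls * G js ks ls)
     = (\<Sum>j\<in>?n. \<Sum>js\<in>?T. \<Sum>k\<in>?n. \<Sum>ks\<in>?T. \<Sum>l\<in>?n. \<Sum>ls\<in>?T. delta3 H x j k l * (coef3 H xs js ks ls * G (j # js) (k # ks) (l # ls)))"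
    unfolding n T3s sum_tuples_Suc by (simp add: c mult.assoc)
  also have "\<dots> = (\<Sum>j\<in>?n. \<Sum>k\<in>?n. \<Sum>l\<in>?n. \<Sum>js\<in>?T. \<Sum>ks\<in>?T. \<Sum>ls\<in>?T. delta3 H x j k l * (coef3 H xs js ks ls * G (j # js) (k # ks) (l # ls)))"
  proof (rule sum.cong[OF refl])
    fix j
    have "(\<Sum>js\<in>?T. \<Sum>k\<in>?n. \<Sum>ks\<in>?T. \<Sum>l\<in>?n. \<Sum>ls\<in>?T. g js k ks l ls)
       = (\<Sum>k\<in>?n. \<Sum>l\<in>?n. \<Sum>js\<in>?T. \<Sum>ks\<in>?T. \<Sum>ls\<in>?T. g js k ks l ls)" for g :: "nat list \<Rightarrow> nat \<Rightarrow> nat list \<Rightarrow> nat \<Rightarrow> nat list \<Rightarrow> 'k"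
    proof -
      have "(\<Sum>js\<in>?T. \<Sum>k\<in>?n. \<Sum>ks\<in>?T. \<Sum>l\<in>?n. \<Sum>ls\<in>?T. g js k ks l ls)
        = (\<Sum>k\<in>?n. \<Sum>js\<in>?T. \<Sum>l\<in>?n. \<Sum>ks\<in>?T. \<Sum>ls\<in>?T. g js k ks l ls)"
        by (rule trans[OF sum.swap]) (intro sum.cong refl, rule sum.swap)
      also have "\<dots> = (\<Sum>k\<in>?n. \<Sum>l\<in>?n. \<Sum>js\<in>?T. \<Sum>ks\<in>?T. \<Sum>ls\<in>?T. g js k ks l ls)"
        by (intro sum.cong refl, rule sum.swap)
      finally show ?thesis .
    qed
    then show "(\<Sum>js\<in>?T. \<Sum>k\<in>?n. \<Sum>ks\<in>?T. \<Sum>l\<in>?n. \<Sum>ls\<in>?T. delta3 H x j k l * (coef3 H xs js ks ls * G (j # js) (k # ks) (l # ls)))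
       = (\<Sum>k\<in>?n. \<Sum>l\<in>?n. \<Sum>js\<in>?T. \<Sum>ks\<in>?T. \<Sum>ls\<in>?T. delta3 H x j k l * (coef3 H xs js ks ls * G (j # js) (k # ks) (l # ls)))" .
  qed
  also have "\<dots> = (\<Sum>j\<in>?n. \<Sum>k\<in>?n. \<Sum>l\<in>?n. delta3 H x j k l * DL xs (\<lambda>as ls. DL as (\<lambda>js ks. G (j # js) (k # ks) (l # ls))))"
    by (simp only: sum_distrib_left[symmetric] Cons.IH[OF xs, unfolded T3s])
  also have "\<dots> = (\<Sum>j\<in>?n. \<Sum>k\<in>?n. \<Sum>l\<in>?n. \<Sum>a\<in>?n. delta H x a l * (delta H a j k * DL xs (\<lambda>as ls. DL as (\<lambda>js ks. G (j # js) (k # ks) (l # ls)))))"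
    by (simp add: delta3_def sum_distrib_right mult.assoc)
  also have "\<dots> = (\<Sum>a\<in>?n. \<Sum>l\<in>?n. \<Sum>j\<in>?n. \<Sum>k\<in>?n. delta H x a l * (delta H a j k * DL xs (\<lambda>as ls. DL as (\<lambda>js ks. G (j # js) (k # ks) (l # ls)))))"
    (is "?L = _")
  proof -
    have "(\<Sum>j\<in>?n. \<Sum>k\<in>?n. \<Sum>l\<in>?n. \<Sum>a\<in>?n. g j k l a) = (\<Sum>a\<in>?n. \<Sum>l\<in>?n. \<Sum>j\<in>?n. \<Sum>k\<in>?n. g j k l a)" for g :: "nat \<Rightarrow> nat \<Rightarrow> nat \<Rightarrow> nat \<Rightarrow> 'k"
    proof -
      have "(\<Sum>j\<in>?n. \<Sum>k\<in>?n. \<Sum>l\<in>?n. \<Sum>a\<in>?n. g j k l a) = (\<Sum>l\<in>?n. \<Sum>a\<in>?n. \<Sum>j\<in>?n. \<Sum>k\<in>?n. g j k l a)"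
        by (rule trans[OF sum.cong[OF refl sum_move2] sum_move2])
      also have "\<dots> = (\<Sum>a\<in>?n. \<Sum>l\<in>?n. \<Sum>j\<in>?n. \<Sum>k\<in>?n. g j k l a)" by (rule sum.swap)
      finally show ?thesis .
    qed
    then show ?thesis .
  qed
  also have "\<dots> = DL (x # xs) (\<lambda>as ls. DL as (\<lambda>js ks. G js ks ls))"
    by (simp add: DL_sum DL_mulc sum_distrib_left)
  finally show ?case .
qed

section \<open>The twist and its inverse\<close>

definition twist where "twist f xs = (\<lambda>k. if k < dim H then DL xs (\<lambda>as bs. (f bs \<cdot> Si (bprod as)) k) else 0)"
definition untwist where "untwist f xs = (\<lambda>k. if k < dim H then DL xs (\<lambda>as bs. (f bs \<cdot> bprod as) k) else 0)"

lemma twist_vecs[simp]: "twist f xs \<in> vecs H" and untwist_vecs[simp]: "untwist f xs \<in> vecs H"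
  by (simp_all add: twist_def untwist_def vecs_def)

lemma dual_apply_DL: "ev f (\<lambda>k. if k < dim H then DL xs (\<lambda>as bs. G as bs k) else 0) = DL xs (\<lambda>as bs. ev f (G as bs))"
  by (simp add: dual_apply_def DL_sum DL_mulc)

lemma lin_dual_apply: assumes F: "lin H F" shows "F = ev (\<lambda>k. F (basis H k))"
  by (rule ext) (subst lin_expand[OF F], simp add: dual_apply_def mult.commute)

lemma lin_twist: assumes F: "lin H F" shows "F (twist f xs) = DL xs (\<lambda>as bs. F (f bs \<cdot> Si (bprod as)))"
  unfolding twist_def by (subst (1 2) lin_dual_apply[OF F]) (rule dual_apply_DL)
lemma lin_untwist: assumes F: "lin H F" shows "F (untwist f xs) = DL xs (\<lambda>as bs. F (f bs \<cdot> bprod as))"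
  unfolding untwist_def by (subst (1 2) lin_dual_apply[OF F]) (rule dual_apply_DL)

text \<open>Coassociativity brings the two correction factors together as S^-1(a_(2)) a_(1), which
  \<open>anti_l\<close> collapses to a counit.\<close>

lemma untwist_twist: assumes xs: "set xs \<subseteq> {..<dim H}" and f: "f xs \<in> vecs H" shows "untwist (twist f) xs = f xs"
proof (rule vec_eqI)
  fix \<phi>
  have "ev \<phi> (untwist (twist f) xs) = DL xs (\<lambda>as m. DL m (\<lambda>ys bs. ev \<phi> (f bs \<cdot> (Si (bprod ys) \<cdot> bprod as))))"
    using lin_twist[of "\<lambda>z. ev \<phi> (z \<cdot> bprod _)" f] by (simp add: lin_untwist lin_rules assoc)
  also have "\<dots> = DL xs (\<lambda>m bs. DL m (\<lambda>as ys. ev \<phi> (f bs \<cdot> (Si (bprod ys) \<cdot> bprod as))))"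
    by (rule DL_coassoc[OF xs, symmetric])
  also have "\<dots> = DL xs (\<lambda>m bs. \<epsilon> (bprod m) * ev \<phi> (f bs))"
  proof (rule DL_cong[of xs "length xs"])
    fix m bs assume "m \<in> tuples (dim H) (length xs)"
    then have m: "set m \<subseteq> {..<dim H}" by (simp add: tuples_def)
    show "DL m (\<lambda>as ys. ev \<phi> (f bs \<cdot> (Si (bprod ys) \<cdot> bprod as))) = \<epsilon> (bprod m) * ev \<phi> (f bs)"
      using anti_l[of "\<lambda>z. ev \<phi> (f bs \<cdot> z)" "bprod m"] DL_bprod[of "\<lambda>x y. ev \<phi> (f bs \<cdot> (Si y \<cdot> x))" m]
      by (simp add: lin_rules m one_r)
  qed (use xs in \<open>simp add: tuples_def\<close>)
  also have "\<dots> = ev \<phi> (f xs)" by (rule DL_counit_l[OF xs])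
  finally show "ev \<phi> (untwist (twist f) xs) = ev \<phi> (f xs)" .
qed (simp_all add: f)

lemma twist_untwist: assumes xs: "set xs \<subseteq> {..<dim H}" and f: "f xs \<in> vecs H" shows "twist (untwist f) xs = f xs"
proof (rule vec_eqI)
  fix \<phi>
  have "ev \<phi> (twist (untwist f) xs) = DL xs (\<lambda>as m. DL m (\<lambda>ys bs. ev \<phi> (f bs \<cdot> (bprod ys \<cdot> Si (bprod as)))))"
    using lin_untwist[of "\<lambda>z. ev \<phi> (z \<cdot> Si (bprod _))" f] by (simp add: lin_twist lin_rules assoc)
  also have "\<dots> = DL xs (\<lambda>m bs. DL m (\<lambda>as ys. ev \<phi> (f bs \<cdot> (bprod ys \<cdot> Si (bprod as)))))"
    by (rule DL_coassoc[OF xs, symmetric])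
  also have "\<dots> = DL xs (\<lambda>m bs. \<epsilon> (bprod m) * ev \<phi> (f bs))"
  proof (rule DL_cong[of xs "length xs"])
    fix m bs assume "m \<in> tuples (dim H) (length xs)"
    then have m: "set m \<subseteq> {..<dim H}" by (simp add: tuples_def)
    show "DL m (\<lambda>as ys. ev \<phi> (f bs \<cdot> (bprod ys \<cdot> Si (bprod as)))) = \<epsilon> (bprod m) * ev \<phi> (f bs)"
      using anti_r[of "\<lambda>z. ev \<phi> (f bs \<cdot> z)" "bprod m"] DL_bprod[of "\<lambda>x y. ev \<phi> (f bs \<cdot> (y \<cdot> Si x))" m]
      by (simp add: lin_rules m one_r)
  qed (use xs in \<open>simp add: tuples_def\<close>)
  also have "\<dots> = ev \<phi> (f xs)" by (rule DL_counit_l[OF xs])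
  finally show "ev \<phi> (twist (untwist f) xs) = ev \<phi> (f xs)" .
qed (simp_all add: f)

lemma untwist_smul: "untwist (\<lambda>xs. smul c (f xs)) = (\<lambda>xs. smul c (untwist f xs))"
proof (rule ext, rule vec_eqI[where H = H])
  fix xs \<phi> show "ev \<phi> (untwist (\<lambda>xs. smul c (f xs)) xs) = ev \<phi> (smul c (untwist f xs))"
    by (simp add: lin_untwist lin_rules dual_apply_smul mul_smul1 DL_mulc)
qed (simp_all add: smul_vecs)

lemma twist_cong: "xs \<in> tuples (dim H) n \<Longrightarrow> (\<And>ys. ys \<in> tuples (dim H) n \<Longrightarrow> f ys = g ys) \<Longrightarrow> twist f xs = twist g xs"
  unfolding twist_def by (rule ext) (auto intro!: DL_cong[of xs n])
lemma untwist_cong: "xs \<in> tuples (dim H) n \<Longrightarrow> (\<And>ys. ys \<in> tuples (dim H) n \<Longrightarrow> f ys = g ys) \<Longrightarrow> untwist f xs = untwist g xs"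
  unfolding untwist_def by (rule ext) (auto intro!: DL_cong[of xs n])

lemma lin_DL: "(\<And>as bs. lin H (\<lambda>x. G x as bs)) \<Longrightarrow> lin H (\<lambda>x. DL xs (G x))"
proof (induction xs arbitrary: G)
  case (Cons a xs) then show ?case by (auto intro!: lin_sum lin_mulc2)
qed simp

end

context quasitri
begin

text \<open>\<open>QD\<close> at \<open>Si b\<close>, read with S on the second leg. It brings the
  factors produced by the definition of the cochain map to the sides where \<open>twist\<close> and
  \<open>untwist\<close> put them.\<close>

lemma Q_move: assumes F: "bilin H F"
  shows "D b (\<lambda>x y. teval H Q (\<lambda>p q. F (p \<cdot> Si y) (x \<cdot> S q))) = D b (\<lambda>x y. teval H Q (\<lambda>p q. F (Si y \<cdot> p) (S q \<cdot> x)))"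
proof -
  note F1 = bilin_left[OF F] and F2 = bilin_right[OF F]
  have "teval H Q (\<lambda>p q. D (Si b) (\<lambda>x y. F (p \<cdot> x) (S (q \<cdot> y)))) = D (Si b) (\<lambda>x y. teval H Q (\<lambda>p q. F (x \<cdot> p) (S (y \<cdot> q))))"
    using QD[of "\<lambda>s t. F s (S t)" "Si b"] by (simp add: lin_rules F1 F2)
  then have "teval H Q (\<lambda>p q. D b (\<lambda>x y. F (p \<cdot> Si y) (x \<cdot> S q))) = D b (\<lambda>x y. teval H Q (\<lambda>p q. F (Si y \<cdot> p) (S q \<cdot> x)))"
    by (simp add: D_Si lin_rules F1 F2 S_mul)
  then show ?thesis by (subst teval_swap)
qed

end

lemma rc_tuples: "xs \<in> tuples (dim H) n \<Longrightarrow> F xs \<in> vecs H \<Longrightarrow> rc H n F xs = F xs"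
  by (auto simp: rc_def vecs_def fun_eq_iff not_less)
lemma rc_cochains: "rc H n F \<in> cochains H n" by (auto simp: rc_def cochains_def)
lemma cochain_vecs: "f \<in> cochains H n \<Longrightarrow> f xs \<in> vecs H" by (auto simp: cochains_def vecs_def)
lemma cochain_rc: "f \<in> cochains H n \<Longrightarrow> rc H n f = f" by (auto simp: cochains_def rc_def fun_eq_iff not_less)
lemma rc_cong: "(\<And>xs. xs \<in> tuples (dim H) n \<Longrightarrow> F xs = G xs) \<Longrightarrow> rc H n F = rc H n G"
  by (auto simp: rc_def fun_eq_iff)

lemma dual_apply_vsum: "dual_apply H phi (vsumover Z F) = (\<Sum>z\<in>Z. dual_apply H phi (F z))"
  by (simp add: dual_apply_def vsumover_def sum_distrib_left) (rule sum.swap)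
lemma vsum_vecs: "(\<And>z. z \<in> Z \<Longrightarrow> F z \<in> vecs H) \<Longrightarrow> vsumover Z F \<in> vecs H"
  by (auto simp: vsumover_def vecs_def intro!: sum.neutral)

section \<open>The cochain maps as conjugates of degree 0 maps\<close>

context ribbon_int
begin

lemma dual_apply_T3: assumes "xs \<in> tuples (dim H) n"
  shows "ev f (vsumover (T3 H n) (\<lambda>(js, ks, ls). smul (coef3 H xs js ks ls) (G js ks ls)))
    = DL xs (\<lambda>as ls. DL as (\<lambda>js ks. ev f (G js ks ls)))"
  unfolding dual_apply_vsum T3_sum[OF assms, symmetric]
  by (rule sum.cong) (auto simp: dual_apply_smul)

lemma T3_vecs: "(\<And>js ks ls. G js ks ls \<in> vecs H) \<Longrightarrow>
  vsumover (T3 H n) (\<lambda>(js, ks, ls). smul (coef3 H xs js ks ls) (G js ks ls)) \<in> vecs H"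
  by (rule vsum_vecs) (auto intro: smul_vecs)

lemma set_tuples: "xs \<in> tuples d n \<Longrightarrow> set xs \<subseteq> {..<d}" by (simp add: tuples_def)

lemma iota_apply: assumes "xs \<in> tuples (dim H) n"
  shows "dual_apply H (iota_n H rho n f xs) x = \<rho> (f xs \<cdot> x)"
proof -
  have "dual_apply H (iota_n H rho n f xs) x = (\<Sum>b<dim H. \<rho> (f xs \<cdot> basis H b) * x b)"
    by (subst dual_apply_def) (simp add: iota_n_def rc_def assms)
  also have "\<dots> = \<rho> (f xs \<cdot> x)"
    by (subst lin_expand[of H "\<lambda>x. \<rho> (f xs \<cdot> x)" x]) (simp_all add: lin_rules mult.commute)
  finally show ?thesis .
qed

lemma Phibar_apply: assumes xs: "xs \<in> tuples (dim H) n"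
  shows "ev \<phi> (Phibar_n H R n (iota_n H rho n f) xs)
    = DL xs (\<lambda>as zs. DL as (\<lambda>ps qs. teval H Q (\<lambda>p q. \<rho> (f qs \<cdot> (p \<cdot> Si (bprod ps))) * ev \<phi> (bprod zs \<cdot> q))))"
proof -
  let ?G = "\<lambda>js ks ls. vsumover (pairs H) (\<lambda>(a, b).
          smul (Q a b * ev (iota_n H rho n f ks) (basis H a \<cdot> prodlist H (rev (map (\<lambda>j. Sinv H (basis H j)) js))))
               (prodlist H (map (basis H) ls) \<cdot> basis H b))"
  have V: "?G js ks ls \<in> vecs H" for js ks ls by (rule vsum_vecs) (auto intro: smul_vecs)
  have "ev \<phi> (Phibar_n H R n (iota_n H rho n f) xs) = DL xs (\<lambda>as ls. DL as (\<lambda>js ks. ev \<phi> (?G js ks ls)))"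
    unfolding Phibar_n_def by (subst rc_tuples[OF xs]) (intro T3_vecs V, rule dual_apply_T3[OF xs])
  also have "\<dots> = DL xs (\<lambda>as zs. DL as (\<lambda>ps qs. teval H Q (\<lambda>p q. \<rho> (f qs \<cdot> (p \<cdot> Si (bprod ps))) * ev \<phi> (bprod zs \<cdot> q))))"
  proof (rule DL_cong[OF xs], rule DL_cong)
    fix as zs ps qs assume "qs \<in> tuples (dim H) n"
    then show "ev \<phi> (?G ps qs zs) = teval H Q (\<lambda>p q. \<rho> (f qs \<cdot> (p \<cdot> Si (bprod ps))) * ev \<phi> (bprod zs \<cdot> q))"
      by (simp add: dual_apply_vsum pairs_def iota_apply prodlist_Sinv bprod_def[symmetric] case_prod_unfold dual_apply_smul teval_def sum.cartesian_product mult.assoc)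
  qed
  finally show ?thesis .
qed

text \<open>The right factors a_(3) from \<open>Phibar_n\<close> and from \<open>S_n\<close> cancel
  through the antipode. The remaining left factor a_(1) and the S^-1 inside rho belong to one
  coproduct, to which \<open>Q_move\<close> applies.\<close>

lemma frakS_eq: assumes xs: "xs \<in> tuples (dim H) n"
  shows "frakS H R rho n f xs = untwist (\<lambda>ys. S0 (twist f ys)) xs"
proof (rule vec_eqI)
  let ?h = "Phibar_n H R n (iota_n H rho n f)"
  note sx = set_tuples[OF xs]
  have insertionv: "?h ks \<in> vecs H" for ks unfolding Phibar_n_def by (rule cochain_vecs[OF rc_cochains])
  show "frakS H R rho n f xs \<in> vecs H" unfolding frakS_def S_n_def by (rule cochain_vecs[OF rc_cochains])
  fix \<phi>
  define T where "T js ps qs = teval H Q (\<lambda>p q. \<rho> (f qs \<cdot> (p \<cdot> Si (bprod ps))) * ev \<phi> (bprod js \<cdot> S q))" for js ps qs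
  \<comment> \<open>\<open>zs\<close> comes from the inner map and \<open>ls\<close> from the outer
    one. By coassociativity they are adjacent legs, so S(\<open>bprod zs\<close>)
    \<open>bprod ls\<close> is the counit of the tuple \<open>m'\<close>, which then
    disappears.\<close>
  have 1: "DL m (\<lambda>ks ls. ev \<phi> (bprod js \<cdot> S (?h ks) \<cdot> bprod ls)) = DL m (\<lambda>ps qs. T js ps qs)"
    if m: "m \<in> tuples (dim H) n" for m js
  proof -
    let ?U = "\<lambda>ps qs y. teval H Q (\<lambda>p q. \<rho> (f qs \<cdot> (p \<cdot> Si (bprod ps))) * ev \<phi> (bprod js \<cdot> (S q \<cdot> y)))"
    note sm = set_tuples[OF m]
    have "DL m (\<lambda>ks ls. ev \<phi> (bprod js \<cdot> S (?h ks) \<cdot> bprod ls))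
      = DL m (\<lambda>ks ls. DL ks (\<lambda>as zs. DL as (\<lambda>ps qs. ?U ps qs (S (bprod zs) \<cdot> bprod ls))))"
    proof (rule DL_cong[OF m])
      fix ks ls assume ks: "ks \<in> tuples (dim H) n"
      have L: "lin H (\<lambda>z. ev \<phi> (bprod js \<cdot> S z \<cdot> bprod ls))" by (simp add: lin_rules)
      show "ev \<phi> (bprod js \<cdot> S (?h ks) \<cdot> bprod ls) = DL ks (\<lambda>as zs. DL as (\<lambda>ps qs. ?U ps qs (S (bprod zs) \<cdot> bprod ls)))"
        unfolding fun_cong[OF lin_dual_apply[OF L], of "?h ks"] Phibar_apply[OF ks]
        unfolding fun_cong[OF lin_dual_apply[OF L], symmetric] by (simp add: S_mul assoc)
    qed
    also have "\<dots> = DL m (\<lambda>as m'. DL m' (\<lambda>zs ls. DL as (\<lambda>ps qs. ?U ps qs (S (bprod zs) \<cdot> bprod ls))))"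
      by (rule DL_coassoc[OF sm])
    also have "\<dots> = DL m (\<lambda>as m'. \<epsilon> (bprod m') * DL as (\<lambda>ps qs. ?U ps qs \<one>))"
    proof (rule DL_cong[OF m])
      fix as m' assume "m' \<in> tuples (dim H) n"
      note sm' = set_tuples[OF this]
      let ?V = "\<lambda>y. DL as (\<lambda>ps qs. ?U ps qs y)"
      have LV: "vlin H t \<Longrightarrow> lin H (\<lambda>y. ?V (t y))" for t
        by (rule lin_DL) (simp add: lin_rules)
      have "DL m' (\<lambda>zs ls. ?V (S (bprod zs) \<cdot> bprod ls)) = D (bprod m') (\<lambda>x y. ?V (S x \<cdot> y))"
        by (rule DL_bprod[of "\<lambda>x y. ?V (S x \<cdot> y)", OF _ sm']) (simp add: lin_rules LV)
      also have "\<dots> = \<epsilon> (bprod m') * ?V \<one>" by (rule ant_l) (rule LV, rule vlin_id)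
      finally show "DL m' (\<lambda>zs ls. ?V (S (bprod zs) \<cdot> bprod ls)) = \<epsilon> (bprod m') * ?V \<one>" .
    qed
    also have "\<dots> = DL m (\<lambda>ps qs. ?U ps qs \<one>)" by (rule DL_counit_r[OF sm])
    finally show ?thesis by (simp add: T_def one_r)
  qed
  have "ev \<phi> (frakS H R rho n f xs) = DL xs (\<lambda>as ls. DL as (\<lambda>js ks. ev \<phi> (bprod js \<cdot> S (?h ks) \<cdot> bprod ls)))"
    unfolding frakS_def S_n_def bprod_def by (subst rc_tuples[OF xs]) (intro T3_vecs mul_vecs, rule dual_apply_T3[OF xs])
  also have "\<dots> = DL xs (\<lambda>js m. DL m (\<lambda>ks ls. ev \<phi> (bprod js \<cdot> S (?h ks) \<cdot> bprod ls)))"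
    by (rule DL_coassoc[OF sx])
  also have "\<dots> = DL xs (\<lambda>js m. DL m (\<lambda>ps qs. T js ps qs))"
    by (rule DL_cong[OF xs]) (rule 1)
  also have "\<dots> = DL xs (\<lambda>a qs. DL a (\<lambda>js ps. T js ps qs))" by (rule DL_coassoc[OF sx, symmetric])
  also have "\<dots> = DL xs (\<lambda>a qs. DL a (\<lambda>js ps. ev \<phi> (S0 (f qs \<cdot> Si (bprod ps)) \<cdot> bprod js)))"
  proof (rule DL_cong[OF xs])
    fix a qs assume "a \<in> tuples (dim H) n"
    note sa = set_tuples[OF this]
    have "DL a (\<lambda>js ps. T js ps qs) = D (bprod a) (\<lambda>x y. teval H Q (\<lambda>p q. \<rho> (f qs \<cdot> (p \<cdot> Si y)) * ev \<phi> (x \<cdot> S q)))"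
      unfolding T_def using DL_bprod[of "\<lambda>x y. teval H Q (\<lambda>p q. \<rho> (f qs \<cdot> (p \<cdot> Si y)) * ev \<phi> (x \<cdot> S q))", OF _ sa]
      by (simp add: lin_rules)
    \<comment> \<open>\<open>Si y\<close> passes to the left of the first leg, next to
      \<open>f qs\<close>, and \<open>x\<close> to the right of the second: the expression becomes
      the degree 0 map at the twisted value, times the factor of \<open>untwist\<close>.\<close>
    also have "\<dots> = D (bprod a) (\<lambda>x y. teval H Q (\<lambda>p q. \<rho> (f qs \<cdot> (Si y \<cdot> p)) * ev \<phi> (S q \<cdot> x)))"
      by (rule Q_move[of "\<lambda>s t. \<rho> (f qs \<cdot> s) * ev \<phi> t"]) (simp add: lin_rules)
    also have "\<dots> = D (bprod a) (\<lambda>x y. ev \<phi> (S0 (f qs \<cdot> Si y) \<cdot> x))"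
      using lin_S0[of "\<lambda>z. ev \<phi> (z \<cdot> _)"] by (simp add: lin_rules assoc)
    also have "\<dots> = DL a (\<lambda>js ps. ev \<phi> (S0 (f qs \<cdot> Si (bprod ps)) \<cdot> bprod js))"
      using DL_bprod[of "\<lambda>x y. ev \<phi> (S0 (f qs \<cdot> Si y) \<cdot> x)", OF _ sa] by (simp add: lin_rules vlin_S0)
    finally show "DL a (\<lambda>js ps. T js ps qs) = DL a (\<lambda>js ps. ev \<phi> (S0 (f qs \<cdot> Si (bprod ps)) \<cdot> bprod js))" .
  qed
  also have "\<dots> = DL xs (\<lambda>js m. DL m (\<lambda>ps qs. ev \<phi> (S0 (f qs \<cdot> Si (bprod ps)) \<cdot> bprod js)))"
    by (rule DL_coassoc[OF sx])
  also have "\<dots> = ev \<phi> (untwist (\<lambda>ys. S0 (twist f ys)) xs)"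
    using lin_twist[of "\<lambda>z. ev \<phi> (S0 z \<cdot> bprod _)" f] by (simp add: lin_untwist lin_rules vlin_S0)
  finally show "ev \<phi> (frakS H R rho n f xs) = ev \<phi> (untwist (\<lambda>ys. S0 (twist f ys)) xs)" .
qed simp

lemma frakS_cochains: "frakS H R rho n f \<in> cochains H n"
  unfolding frakS_def S_n_def by (rule rc_cochains)

lemma frakS_rc: "frakS H R rho n f = rc H n (untwist (\<lambda>ys. S0 (twist f ys)))"
proof -
  have "frakS H R rho n f = rc H n (frakS H R rho n f)" by (rule cochain_rc[OF frakS_cochains, symmetric])
  also have "\<dots> = rc H n (untwist (\<lambda>ys. S0 (twist f ys)))" by (rule rc_cong) (rule frakS_eq)
  finally show ?thesis .
qed

text \<open>\<open>twist\<close> evaluates its argument only on tuples of the same length, so the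
  restriction by \<open>rc\<close> is invisible to it.\<close>

lemma twist_rc_untwist: assumes "\<And>ys. g ys \<in> vecs H" "xs \<in> tuples (dim H) n" shows "twist (rc H n (untwist g)) xs = g xs"
proof -
  have "twist (rc H n (untwist g)) xs = twist (untwist g) xs"
    by (rule twist_cong[OF assms(2)]) (simp add: rc_tuples)
  then show ?thesis using twist_untwist[of xs g] assms set_tuples by metis
qed

lemma twist_mulv: "twist (\<lambda>ys. z \<cdot> f ys) xs = z \<cdot> twist f xs"
proof (rule vec_eqI)
  fix \<phi> show "ev \<phi> (twist (\<lambda>ys. z \<cdot> f ys) xs) = ev \<phi> (z \<cdot> twist f xs)"
    using lin_twist[of "\<lambda>y. ev \<phi> (z \<cdot> y)" f xs] by (simp add: lin_twist lin_rules assoc)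
qed simp_all
lemma untwist_mulv: "untwist (\<lambda>ys. z \<cdot> f ys) xs = z \<cdot> untwist f xs"
proof (rule vec_eqI)
  fix \<phi> show "ev \<phi> (untwist (\<lambda>ys. z \<cdot> f ys) xs) = ev \<phi> (z \<cdot> untwist f xs)"
    using lin_untwist[of "\<lambda>y. ev \<phi> (z \<cdot> y)" f xs] by (simp add: lin_untwist lin_rules assoc)
qed simp_all
lemma frakT_inv: assumes f: "f \<in> cochains H n"
  shows "the_inv_into (cochains H n) (frakT H v n) f = frakT H w n f"
proof (rule the_inv_into_f_eq)
  have *: "frakT H w n (frakT H v n g) = g" "frakT H v n (frakT H w n g) = g" if g: "g \<in> cochains H n" for g
  proof -
    have "frakT H a n (frakT H b n g) = rc H n (\<lambda>xs. a \<cdot> (b \<cdot> g xs))" for a b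
      unfolding frakT_def by (rule rc_cong) (simp add: rc_tuples)
    moreover have "rc H n (\<lambda>xs. trunc H (g xs)) = g"
      using cochain_rc[OF g] cochain_vecs[OF g] by (simp add: trunc_id)
    ultimately show "frakT H w n (frakT H v n g) = g" "frakT H v n (frakT H w n g) = g" by (simp_all add: vwc)
  qed
  show "inj_on (frakT H v n) (cochains H n)" by (rule inj_on_inverseI[where g = "frakT H w n"]) (rule *)
  show "frakT H v n (frakT H w n f) = f" by (rule *) (rule f)
  show "frakT H w n f \<in> cochains H n" unfolding frakT_def by (rule rc_cochains)
qed

text \<open>The twist multiplies on the right, so it commutes with left multiplication by v or w and
  turns the components into \<open>S0\<close>; the degree 0 relation is then applied to each
  value.\<close>

lemma frakS_frakT_frakS: assumes f: "f \<in> cochains H n"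
  shows "frakS H R rho n (frakT H v n (frakS H R rho n f)) =
            csmul (\<rho> v)
              (the_inv_into (cochains H n) (frakT H v n)
                 (frakS H R rho n (the_inv_into (cochains H n) (frakT H v n) f)))"
proof -
  have T: "twist (frakT H z n g) xs = z \<cdot> twist g xs" if "xs \<in> tuples (dim H) n" for z g xs
  proof -
    have "twist (frakT H z n g) xs = twist (\<lambda>ys. z \<cdot> g ys) xs"
      by (rule twist_cong[OF that]) (simp add: frakT_def rc_tuples)
    then show ?thesis by (simp add: twist_mulv)
  qed
  have S: "twist (frakS H R rho n g) xs = S0 (twist g xs)" if "xs \<in> tuples (dim H) n" for g xs
    unfolding frakS_rc using twist_rc_untwist[OF _ that, of "\<lambda>ys. S0 (twist g ys)"] by simp
  have "frakS H R rho n (frakT H v n (frakS H R rho n f)) = rc H n (untwist (\<lambda>ys. smul (\<rho> v) (w \<cdot> S0 (w \<cdot> twist f ys))))"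
    unfolding frakS_rc[of n "frakT H v n _"]
    by (rule rc_cong, rule untwist_cong, assumption) (simp add: T S S0_T_S0)
  also have "\<dots> = csmul (\<rho> v) (rc H n (\<lambda>xs. w \<cdot> untwist (\<lambda>ys. S0 (w \<cdot> twist f ys)) xs))"
  proof -
    have "untwist (\<lambda>ys. smul (\<rho> v) (w \<cdot> S0 (w \<cdot> twist f ys))) = (\<lambda>xs. smul (\<rho> v) (w \<cdot> untwist (\<lambda>ys. S0 (w \<cdot> twist f ys)) xs))"
      by (rule ext) (simp add: untwist_smul untwist_mulv)
    then show ?thesis by (auto simp: rc_def csmul_def smul_def fun_eq_iff)
  qed
  also have "rc H n (\<lambda>xs. w \<cdot> untwist (\<lambda>ys. S0 (w \<cdot> twist f ys)) xs) = frakT H w n (frakS H R rho n (frakT H w n f))"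
    unfolding frakT_def[of H w n "frakS H R rho n _"]
    by (rule rc_cong, rule arg_cong[where f = "mult w"]) (simp add: frakS_eq, rule untwist_cong, assumption, simp add: T)
  finally show ?thesis using frakT_inv[OF f] frakT_inv[OF frakS_cochains] by simp
qed

end

context hopf
begin

section \<open>The homotopy\<close>

text \<open>slot a G is the cochain G with its first argument set to a.  On a scalar-valued cochain, face is the
  alternating sum of all faces but the first, with trivial right action, and insertion z is the
  alternating sum of the insertions of z.  Recursion on the argument list avoids index shifts.\<close>

definition slot :: "'k vec \<Rightarrow> (nat list \<Rightarrow> 'k) \<Rightarrow> nat list \<Rightarrow> 'k" where
  "slot a G ys = (\<Sum>k<dim H. a k * G (k # ys))"

fun face :: "(nat list \<Rightarrow> 'k) \<Rightarrow> 'k vec \<Rightarrow> nat list \<Rightarrow> 'k" where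
  "face G a [] = \<epsilon> a * G []"
| "face G a (y # ys) = slot (a \<cdot> basis H y) G ys - face (slot a G) (basis H y) ys"

fun insertion :: "'k vec \<Rightarrow> (nat list \<Rightarrow> 'k) \<Rightarrow> nat list \<Rightarrow> 'k" where
  "insertion z G [] = slot z G []"
| "insertion z G (x # xs) = slot z G (x # xs) - insertion z (slot (basis H x) G) xs"

lemma lin_slot: "vlin H t \<Longrightarrow> lin H (\<lambda>x. slot (t x) G ys)"
  unfolding slot_def by (intro lin_sum lin_mulc1 lin_coordt) auto

lemma slot_basis: "x < dim H \<Longrightarrow> slot (basis H x) G = (\<lambda>ys. G (x # ys))"
  by (simp add: slot_def sum_basis fun_eq_iff)

lemma slot_sum: "slot a (\<lambda>ys. \<Sum>i\<in>I. c i * G i ys) = (\<lambda>ys. \<Sum>i\<in>I. c i * slot a (G i) ys)"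
  unfolding slot_def sum_distrib_left by (rule ext, subst sum.swap) (simp add: mult.left_commute)

lemma slot_diff: "slot a (\<lambda>ys. G ys - G' ys) = (\<lambda>ys. slot a G ys - slot a G' ys)"
  by (rule ext) (simp add: slot_def right_diff_distrib sum_subtractf)

lemma face_sum: "face (\<lambda>ys. \<Sum>i\<in>I. c i * G i ys) a ys = (\<Sum>i\<in>I. c i * face (G i) a ys)"
proof (induction ys arbitrary: G a)
  case Nil show ?case by (simp add: sum_distrib_left mult.left_commute)
next
  case (Cons y ys) then show ?case by (simp add: slot_sum right_diff_distrib sum_subtractf)
qed

lemma face_diff: "face (\<lambda>ys. G ys - G' ys) a ys = face G a ys - face G' a ys"
  by (induction ys arbitrary: G G' a) (simp_all add: slot_diff right_diff_distrib)

lemma insertion_sum: "insertion z (\<lambda>ys. \<Sum>i\<in>I. c i * G i ys) ys = (\<Sum>i\<in>I. c i * insertion z (G i) ys)"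
  by (induction ys arbitrary: G) (simp_all add: slot_sum right_diff_distrib sum_subtractf)

lemma insertion_diff: "insertion z (\<lambda>ys. G ys - G' ys) ys = insertion z G ys - insertion z G' ys"
  by (induction ys arbitrary: G G') (simp_all add: slot_diff)

lemma face_slot: "face (slot a G) b ys = (\<Sum>k<dim H. a k * face (\<lambda>ys. G (k # ys)) b ys)"
  unfolding slot_def by (rule face_sum)
lemma insertion_slot: "insertion z (slot a G) ys = (\<Sum>k<dim H. a k * insertion z (\<lambda>ys. G (k # ys)) ys)"
  unfolding slot_def by (rule insertion_sum)

lemma lin_face: "vlin H t \<Longrightarrow> lin H (\<lambda>x. face G (t x) ys)"
proof (cases ys)
  case Nil assume "vlin H t" then show ?thesis using Nil by (simp add: lin_rules)
next
  case (Cons y zs) assume "vlin H t"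
  then show ?thesis unfolding Cons face.simps face_slot
    by (intro lin_diff lin_slot vlin_mul1 lin_sum lin_mulc1 lin_coordt) simp_all
qed

lemma slot_insertion: "slot a (insertion z G) = (\<lambda>ys. slot a (slot z G) ys - insertion z (slot a G) ys)"
proof
  fix ys
  have "slot a (insertion z G) ys = (\<Sum>k<dim H. a k * (slot z G (k # ys) - insertion z (\<lambda>ys. G (k # ys)) ys))"
    by (simp add: slot_def[of a] slot_basis)
  then show "slot a (insertion z G) ys = slot a (slot z G) ys - insertion z (slot a G) ys"
    by (simp add: insertion_slot slot_def[of a] right_diff_distrib sum_subtractf)
qed

text \<open>The recursion of \<open>face\<close> is stated for a basis vector in the next place;
  linearity of all terms extends it to an arbitrary vector z there.\<close>

lemma slot_face: "slot z (face G a) (y # ys) = slot (a \<cdot> z) G (y # ys) - face (slot a G) z (y # ys)"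
proof -
  have "slot z (face G a) (y # ys) = (\<Sum>k<dim H. z k * slot (a \<cdot> basis H k) G (y # ys)) - (\<Sum>k<dim H. z k * face (slot a G) (basis H k) (y # ys))"
    by (subst slot_def) (simp add: right_diff_distrib sum_subtractf del: face.simps(2) add: face.simps(2)[of G])
  moreover have "slot (a \<cdot> z) G (y # ys) = (\<Sum>k<dim H. z k * slot (a \<cdot> basis H k) G (y # ys))"
    by (rule lin_expand[of H "\<lambda>z. slot (a \<cdot> z) G (y # ys)"]) (intro lin_slot vlin_mul2 vlin_id)
  moreover have "face (slot a G) z (y # ys) = (\<Sum>k<dim H. z k * face (slot a G) (basis H k) (y # ys))"
    by (rule lin_expand[of H "\<lambda>z. face (slot a G) z (y # ys)"]) (intro lin_face vlin_id)
  ultimately show ?thesis by simp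
qed

text \<open>An inserted z is merged once with its left and once with its right neighbour; the signs
  are opposite and centrality makes these terms cancel between consecutive positions. What remains
  are the two ends: the merge of z with the leading argument a, and z in the last place, where the
  last face turns it into eps(z) = 1.\<close>

lemma face_insertion:
  assumes z: "\<And>x. z \<cdot> x = x \<cdot> z" "\<epsilon> z = 1" and xs: "set xs \<subseteq> {..<dim H}"
  shows "face (insertion z G) a xs = face (slot z G) a xs + insertion z (face G a) xs + slot a G xs - slot (z \<cdot> a) G xs"
  using xs
proof (induction xs arbitrary: a G)
  case Nil
  have "slot z (face G a) [] = slot (a \<cdot> z) G [] - face (slot a G) z []"
  proof -
    have "slot z (face G a) [] = (\<Sum>k<dim H. z k * slot (a \<cdot> basis H k) G []) - (\<Sum>k<dim H. z k * face (slot a G) (basis H k) [])"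
      by (subst slot_def) (simp add: right_diff_distrib sum_subtractf)
    moreover have "slot (a \<cdot> z) G [] = (\<Sum>k<dim H. z k * slot (a \<cdot> basis H k) G [])"
      by (rule lin_expand[of H "\<lambda>z. slot (a \<cdot> z) G []"]) (intro lin_slot vlin_mul2 vlin_id)
    moreover have "face (slot a G) z [] = (\<Sum>k<dim H. z k * face (slot a G) (basis H k) [])"
      by (rule lin_expand[of H "\<lambda>z. face (slot a G) z []"]) (intro lin_face vlin_id)
    ultimately show ?thesis by simp
  qed
  then show ?case by (simp add: z)
next
  case (Cons y ys)
  have y: "y < dim H" and ys: "set ys \<subseteq> {..<dim H}" using Cons.prems by auto
  have 1: "face (insertion z G) a (y # ys) = slot (a \<cdot> basis H y) (slot z G) ys - insertion z (slot (a \<cdot> basis H y) G) ys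
      - (face (slot a (slot z G)) (basis H y) ys - face (insertion z (slot a G)) (basis H y) ys)"
    by (simp add: slot_insertion face_diff)
  have 2: "insertion z (face G a) (y # ys) = slot (a \<cdot> z) G (y # ys) - (slot (z \<cdot> basis H y) (slot a G) ys - face (slot z (slot a G)) (basis H y) ys)
     - (insertion z (slot (a \<cdot> basis H y) G) ys - insertion z (face (slot a G) (basis H y)) ys)"
    by (simp add: slot_face slot_basis[OF y] insertion_diff)
  have 3: "slot (basis H y) (slot a G) ys = slot a G (y # ys)" by (simp add: slot_basis[OF y])
  show ?case unfolding 1 2 Cons.IH[OF ys, of "slot a G" "basis H y"] 3 z(1)[of a] by simp
qed

text \<open>This left action is the one by which twist transforms the left multiplication of the
  Hochschild differential.\<close>

definition act where "act a y = tevalv H (cop H a) (\<lambda>p q. q \<cdot> (y \<cdot> Si p))"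
lemma act_vecs[simp]: "act a y \<in> vecs H" by (simp add: act_def)
lemma vlin_act1: "vlin H t \<Longrightarrow> vlin H (\<lambda>x. act (t x) y)" by (simp add: act_def lin_rules)
lemma vlin_act2: "vlin H t \<Longrightarrow> vlin H (\<lambda>x. act a (t x))" by (simp add: act_def lin_rules)
lemma ev_act: "ev f (act a y) = D a (\<lambda>p q. ev f (q \<cdot> (y \<cdot> Si p)))" by (simp add: act_def dual_apply_tevalv)

text \<open>The value on the empty tuple is a default: a differential takes values in positive
  degree.\<close>

fun twisted_d :: "(nat list \<Rightarrow> 'k vec) \<Rightarrow> nat list \<Rightarrow> 'k vec" where
  "twisted_d F [] = (\<lambda>k. 0)"
| "twisted_d F (x # xs) = (\<lambda>k. if k < dim H then act (basis H x) (F xs) k - face (\<lambda>zs. F zs k) (basis H x) xs else 0)"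

definition insertionv where "insertionv z F xs = (\<lambda>k. if k < dim H then insertion z (\<lambda>zs. F zs k) xs else 0)"

lemma twisted_d_vecs[simp]: "twisted_d F xs \<in> vecs H" by (cases xs) (simp_all add: vecs_def)
lemma insertionv_vecs[simp]: "insertionv z F xs \<in> vecs H" by (simp add: insertionv_def vecs_def)

lemma ev_insertionv: "ev f (insertionv z F xs) = insertion z (\<lambda>zs. ev f (F zs)) xs"
  by (simp add: dual_apply_def insertionv_def insertion_sum)
lemma ev_twisted_d: "ev f (twisted_d F (x # xs)) = ev f (act (basis H x) (F xs)) - face (\<lambda>zs. ev f (F zs)) (basis H x) xs"
  by (simp add: dual_apply_def face_sum right_diff_distrib sum_subtractf)

lemma homotopy_Nil:
  assumes z: "\<epsilon> z = 1"
  shows "ev f (insertionv z (twisted_d F) []) = ev f (act z (F [])) - ev f (F [])"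
proof -
  have "ev f (insertionv z (twisted_d F) []) = (\<Sum>k<dim H. z k * ev f (act (basis H k) (F []))) - (\<Sum>k<dim H. z k * (\<epsilon> (basis H k) * ev f (F [])))"
    by (simp add: ev_insertionv slot_def ev_twisted_d right_diff_distrib sum_subtractf del: twisted_d.simps)
  also have "(\<Sum>k<dim H. z k * ev f (act (basis H k) (F []))) = ev f (act z (F []))"
    by (rule lin_expand[symmetric]) (simp add: lin_rules vlin_act1)
  also have "(\<Sum>k<dim H. z k * (\<epsilon> (basis H k) * ev f (F []))) = \<epsilon> z * ev f (F [])"
    by (rule lin_expand[symmetric]) (simp add: lin_rules)
  finally show ?thesis by (simp add: z)
qed

text \<open>Inserting z in front lets the first face act by z, which is the term
  \<open>act z\<close>. The first faces of all other insertions cancel against the left action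
  outside, and \<open>face_insertion\<close> removes everything else except the cochain
  itself.\<close>

lemma homotopy_Cons:
  assumes z: "\<And>x. z \<cdot> x = x \<cdot> z" "\<epsilon> z = 1" and xs: "set (x # xs) \<subseteq> {..<dim H}"
  shows "ev f (twisted_d (insertionv z F) (x # xs)) + ev f (insertionv z (twisted_d F) (x # xs)) = ev f (act z (F (x # xs))) - ev f (F (x # xs))"
proof -
  let ?G = "\<lambda>zs. ev f (F zs)"
  have x: "x < dim H" and xs': "set xs \<subseteq> {..<dim H}" using xs by auto
  have L: "lin H (\<lambda>y. ev f (act (basis H x) y))" by (simp add: lin_rules vlin_act2)
  have "ev f (act (basis H x) (insertionv z F xs)) = insertion z (\<lambda>zs. ev f (act (basis H x) (F zs))) xs"
    using ev_insertionv[of "\<lambda>k. ev f (act (basis H x) (basis H k))" z F xs] lin_dual_apply[OF L] by (metis (no_types, lifting) ext)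
  then have 1: "ev f (twisted_d (insertionv z F) (x # xs)) = insertion z (\<lambda>zs. ev f (act (basis H x) (F zs))) xs - face (insertion z ?G) (basis H x) xs"
    by (simp add: ev_twisted_d ev_insertionv del: twisted_d.simps)
  have c: "slot z (\<lambda>zs. ev f (twisted_d F zs)) (x # xs) = ev f (act z (F (x # xs))) - face ?G z (x # xs)"
  proof -
    have "slot z (\<lambda>zs. ev f (twisted_d F zs)) (x # xs) = (\<Sum>k<dim H. z k * ev f (act (basis H k) (F (x # xs)))) - (\<Sum>k<dim H. z k * face ?G (basis H k) (x # xs))"
      by (subst slot_def) (simp only: ev_twisted_d right_diff_distrib sum_subtractf)
    also have "(\<Sum>k<dim H. z k * ev f (act (basis H k) (F (x # xs)))) = ev f (act z (F (x # xs)))"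
      by (rule lin_expand[symmetric]) (simp add: lin_rules vlin_act1)
    also have "(\<Sum>k<dim H. z k * face ?G (basis H k) (x # xs)) = face ?G z (x # xs)"
      by (rule lin_expand[symmetric, where F = "\<lambda>a. face ?G a (x # xs)"]) (intro lin_face vlin_id)
    finally show ?thesis .
  qed
  have 2: "ev f (insertionv z (twisted_d F) (x # xs)) = ev f (act z (F (x # xs))) - face ?G z (x # xs)
     - (insertion z (\<lambda>zs. ev f (act (basis H x) (F zs))) xs - insertion z (face ?G (basis H x)) xs)"
    unfolding ev_insertionv insertion.simps c by (simp only: slot_basis[OF x] ev_twisted_d insertion_diff)
  show ?thesis unfolding 1 2 face_insertion[OF z xs', of ?G "basis H x"] by (simp add: slot_basis[OF x])
qed

text \<open>Here the last face multiplies from the right.  The argument Psi ys z stands for phi(f(ys) z), so that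
  the right factor can be recorded without fixing phi.\<close>

fun rface :: "(nat list \<Rightarrow> 'k vec \<Rightarrow> 'k) \<Rightarrow> 'k vec \<Rightarrow> nat list \<Rightarrow> 'k" where
  "rface \<Psi> a [] = \<Psi> [] a"
| "rface \<Psi> a (y # ys) = (\<Sum>k<dim H. (a \<cdot> basis H y) k * \<Psi> (k # ys) \<one>) - rface (\<lambda>ys z. \<Sum>k<dim H. a k * \<Psi> (k # ys) z) (basis H y) ys"

lemma rface_sum: "rface (\<lambda>ys z. \<Sum>i\<in>I. c i * \<Psi> i ys z) a ys = (\<Sum>i\<in>I. c i * rface (\<Psi> i) a ys)"
proof (induction ys arbitrary: \<Psi> a)
  case (Cons y ys)
  have s: "(\<Sum>k<dim H. b k * (\<Sum>i\<in>I. c i * g i k)) = (\<Sum>i\<in>I. c i * (\<Sum>k<dim H. b k * g i k))" for b :: "nat \<Rightarrow> 'k" and g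
    unfolding sum_distrib_left by (subst sum.swap) (simp add: mult.left_commute)
  show ?case by (simp add: s Cons.IH right_diff_distrib sum_subtractf)
qed simp

lemma rface_teval: "rface (\<lambda>ys z. teval H X (\<lambda>p q. \<Psi> p q ys z)) a ys = teval H X (\<lambda>p q. rface (\<Psi> p q) a ys)"
proof -
  have "rface (\<lambda>ys z. \<Sum>i<dim H. 1 * (\<Sum>j<dim H. X i j * \<Psi> (basis H i) (basis H j) ys z)) a ys
    = (\<Sum>i<dim H. 1 * (\<Sum>j<dim H. X i j * rface (\<Psi> (basis H i) (basis H j)) a ys))"
    unfolding rface_sum by simp
  then show ?thesis by (simp add: teval_def)
qed

lemma rface_cong:
  assumes "ys \<in> tuples (dim H) n" "\<And>zs z. zs \<in> tuples (dim H) n \<Longrightarrow> \<Psi> zs z = \<Psi>' zs z"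
  shows "rface \<Psi> a ys = rface \<Psi>' a ys"
  using assms
proof (induction ys arbitrary: n \<Psi> \<Psi>' a)
  case (Cons y ys)
  then obtain m where n: "n = Suc m" by (cases n) (auto simp: tuples_def)
  have "rface (\<lambda>ys z. \<Sum>k<dim H. a k * \<Psi> (k # ys) z) (basis H y) ys = rface (\<lambda>ys z. \<Sum>k<dim H. a k * \<Psi>' (k # ys) z) (basis H y) ys"
    using Cons.prems n by (intro Cons.IH[of m] sum.cong) (auto simp: tuples_Cons)
  moreover have "\<Psi> (k # ys) \<one> = \<Psi>' (k # ys) \<one>" if "k < dim H" for k
    using Cons.prems n that by (auto simp: tuples_Cons)
  ultimately show ?case by simp
qed (auto simp: tuples_def)

text \<open>Each face leaves the product of all arguments unchanged, with the right factor of the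
  last face included. The factor that \<open>untwist\<close> puts on the right is therefore common
  to all faces; in the second legs the last argument survives only through its counit.\<close>

lemma rface_DL:
  assumes "\<And>zs. lin H (\<Phi> zs)" "set ys \<subseteq> {..<dim H}"
  shows "rface (\<lambda>ys z. DL ys (\<lambda>as bs. \<Phi> bs (bprod as \<cdot> z))) a ys
     = D a (\<lambda>p q. DL ys (\<lambda>as bs. face (\<lambda>zs. \<Phi> zs (p \<cdot> bprod as)) q bs))"
  using assms
proof (induction ys arbitrary: \<Phi> a)
  case Nil
  then show ?case using counit_r[of "\<Phi> []" a] by (simp add: one_l one_r lin_trunc[OF Nil(1)])
next
  case (Cons y ys)
  note L = Cons.prems(1)
  note L' = lin_comp[OF L]
  have y: "y < dim H" and ys: "set ys \<subseteq> {..<dim H}" using Cons.prems by auto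
  \<comment> \<open>A linear combination of first indices with coefficients b becomes the coproduct
    of b: its first leg joins the product on the right, its second enters through
    \<open>slot\<close>.\<close>
  have head: "(\<Sum>k<dim H. b k * DL (k # us) (\<lambda>as bs. \<Phi> bs (bprod as \<cdot> z)))
     = D b (\<lambda>p q. DL us (\<lambda>as bs. slot q (\<lambda>zs. \<Phi> zs (p \<cdot> (bprod as \<cdot> z))) bs))" for b z us
  proof -
    have "D b (\<lambda>p q. DL us (\<lambda>as bs. slot q (\<lambda>zs. \<Phi> zs (p \<cdot> (bprod as \<cdot> z))) bs))
      = (\<Sum>k<dim H. b k * D (basis H k) (\<lambda>p q. DL us (\<lambda>as bs. slot q (\<lambda>zs. \<Phi> zs (p \<cdot> (bprod as \<cdot> z))) bs)))"
      by (rule lin_expand) (simp add: lin_rules)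
    also have "\<dots> = (\<Sum>k<dim H. b k * DL (k # us) (\<lambda>as bs. \<Phi> bs (bprod as \<cdot> z)))"
      by (simp add: teval_basis slot_basis assoc)
    finally show ?thesis by simp
  qed
  have t1: "(\<Sum>k<dim H. (a \<cdot> basis H y) k * DL (k # ys) (\<lambda>as bs. \<Phi> bs (bprod as \<cdot> \<one>)))
     = D a (\<lambda>p q. D (basis H y) (\<lambda>r s. DL ys (\<lambda>as bs. slot (q \<cdot> s) (\<lambda>zs. \<Phi> zs (p \<cdot> (r \<cdot> bprod as))) bs)))"
  proof -
    have "bilin H (\<lambda>p q. DL ys (\<lambda>as bs. slot q (\<lambda>zs. \<Phi> zs (p \<cdot> (bprod as \<cdot> \<one>))) bs))"
      unfolding bilin_def
    proof (intro conjI allI lin_DL)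
      show "lin H (\<lambda>x. slot y (\<lambda>zs. \<Phi> zs (x \<cdot> (bprod as \<cdot> \<one>))) bs)" for y as bs
        unfolding slot_def by (intro lin_sum lin_mulc2 L' vlin_mul1 vlin_id)
      show "lin H (\<lambda>y. slot y (\<lambda>zs. \<Phi> zs (x \<cdot> (bprod as \<cdot> \<one>))) bs)" for x as bs
        by (rule lin_slot[OF vlin_id])
    qed
    then show ?thesis unfolding head by (simp add: D_mul assoc one_r trunc_id)
  qed
  have t2: "rface (\<lambda>ys z. \<Sum>k<dim H. a k * DL (k # ys) (\<lambda>as bs. \<Phi> bs (bprod as \<cdot> z))) (basis H y) ys
     = D a (\<lambda>p q. D (basis H y) (\<lambda>r s. DL ys (\<lambda>as bs. face (slot q (\<lambda>zs. \<Phi> zs (p \<cdot> (r \<cdot> bprod as)))) s bs)))"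
  proof -
    have "rface (\<lambda>ys z. DL ys (\<lambda>as bs. slot q (\<lambda>zs. \<Phi> zs (p \<cdot> (bprod as \<cdot> z))) bs)) (basis H y) ys
       = D (basis H y) (\<lambda>r s. DL ys (\<lambda>as bs. face (slot q (\<lambda>zs. \<Phi> zs (p \<cdot> (r \<cdot> bprod as)))) s bs))" for p q
    proof -
      have Lc: "lin H (\<lambda>z. slot q (\<lambda>zs. \<Phi> zs (p \<cdot> z)) zs)" for zs
        unfolding slot_def by (intro lin_sum lin_mulc2 L' vlin_mul2 vlin_id)
      show ?thesis using Cons.IH[of "\<lambda>bs z. slot q (\<lambda>zs. \<Phi> zs (p \<cdot> z)) bs" "basis H y", OF Lc ys] by simp
    qed
    then show ?thesis unfolding head rface_teval by simp
  qed
  have "rface (\<lambda>ys z. DL ys (\<lambda>as bs. \<Phi> bs (bprod as \<cdot> z))) a (y # ys)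
     = D a (\<lambda>p q. D (basis H y) (\<lambda>r s. DL ys (\<lambda>as bs. slot (q \<cdot> s) (\<lambda>zs. \<Phi> zs (p \<cdot> (r \<cdot> bprod as))) bs)))
      - D a (\<lambda>p q. D (basis H y) (\<lambda>r s. DL ys (\<lambda>as bs. face (slot q (\<lambda>zs. \<Phi> zs (p \<cdot> (r \<cdot> bprod as)))) s bs)))"
    unfolding rface.simps t1 t2 ..
  also have "\<dots> = D a (\<lambda>p q. DL (y # ys) (\<lambda>as bs. face (\<lambda>zs. \<Phi> zs (p \<cdot> bprod as)) q bs))"
    by (simp add: teval_basis[OF y] DL_diff right_diff_distrib sum_subtractf) (simp add: teval_def sum_subtractf right_diff_distrib)
  finally show ?case .
qed

text \<open>Removing the first argument shifts every index by one and so reverses every sign, which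
  is the minus in the recursion of \<open>rface\<close>. Inner faces have the unit as right factor,
  the last face has the last argument.\<close>

lemma hoch_faces:
  assumes "x # ys \<in> tuples (dim H) (Suc n)"
  shows "(\<Sum>i\<in>{1..n}. (-1) ^ i * (\<Sum>k<dim H. mu H ((x # ys) ! (i - 1)) ((x # ys) ! i) k * \<Psi> (take (i - 1) (x # ys) @ k # drop (i + 1) (x # ys)) \<one>))
     + (-1) ^ Suc n * \<Psi> (butlast (x # ys)) (basis H (last (x # ys))) = - rface \<Psi> (basis H x) ys"
  using assms
proof (induction ys arbitrary: x n \<Psi>)
  case Nil then have "n = 0" by (auto simp: tuples_def)
  then show ?case by simp
next
  case (Cons y zs)
  then obtain m where n: "n = Suc m" by (cases n) (auto simp: tuples_def)
  have x: "x < dim H" and yz: "y # zs \<in> tuples (dim H) (Suc m)" and y: "y < dim H"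
    using Cons.prems n by (auto simp: tuples_Cons)
  let ?g = "\<lambda>i. (-1) ^ i * (\<Sum>k<dim H. mu H ((x # y # zs) ! (i - 1)) ((x # y # zs) ! i) k * \<Psi> (take (i - 1) (x # y # zs) @ k # drop (i + 1) (x # y # zs)) \<one>)"
  have "sum ?g {1..Suc m} = ?g 1 + (\<Sum>i\<in>{1..m}. ?g (Suc i))"
    by (simp add: sum.atLeast_Suc_atMost sum.shift_bounds_cl_Suc_ivl del: sum.cl_ivl_Suc)
  moreover have "?g (Suc i) = - ((-1) ^ i * (\<Sum>k<dim H. mu H ((y # zs) ! (i - 1)) ((y # zs) ! i) k * \<Psi> (x # take (i - 1) (y # zs) @ k # drop (i + 1) (y # zs)) \<one>))"
    if "i \<in> {1..m}" for i
    using that by (cases i) auto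
  ultimately have s: "sum ?g {1..n} = ?g 1 - (\<Sum>i\<in>{1..m}. (-1) ^ i * (\<Sum>k<dim H. mu H ((y # zs) ! (i - 1)) ((y # zs) ! i) k * \<Psi> (x # take (i - 1) (y # zs) @ k # drop (i + 1) (y # zs)) \<one>))"
    unfolding n by (simp add: sum_negf)
  have g1: "?g 1 = - (\<Sum>k<dim H. (basis H x \<cdot> basis H y) k * \<Psi> (k # zs) \<one>)"
    by (simp add: mul_basis x y)
  have IH: "(\<Sum>i\<in>{1..m}. (-1) ^ i * (\<Sum>k<dim H. mu H ((y # zs) ! (i - 1)) ((y # zs) ! i) k * \<Psi> (x # take (i - 1) (y # zs) @ k # drop (i + 1) (y # zs)) \<one>))
     + (-1) ^ Suc m * \<Psi> (x # butlast (y # zs)) (basis H (last (y # zs))) = - rface (\<lambda>ys z. \<Psi> (x # ys) z) (basis H y) zs"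
    by (rule Cons.IH[OF yz])
  have b: "butlast (x # y # zs) = x # butlast (y # zs)" "last (x # y # zs) = last (y # zs)" by simp_all
  have l: "(-1) ^ Suc n * \<Psi> (butlast (x # y # zs)) (basis H (last (x # y # zs)))
      = - ((-1) ^ Suc m * \<Psi> (x # butlast (y # zs)) (basis H (last (y # zs))))"
    unfolding n b by simp
  have e: "rface \<Psi> (basis H x) (y # zs) = (\<Sum>k<dim H. (basis H x \<cdot> basis H y) k * \<Psi> (k # zs) \<one>) - rface (\<lambda>ys z. \<Psi> (x # ys) z) (basis H y) zs"
    by (simp add: sum_basis x)
  show ?case unfolding s g1 l e using IH by (simp add: algebra_simps)
qed

lemma hoch_d_rface:
  assumes f: "\<And>ys. f ys \<in> vecs H" and xs: "x # ys \<in> tuples (dim H) (Suc n)"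
  shows "ev \<phi> (hoch_d H n f (x # ys)) = ev \<phi> (basis H x \<cdot> f ys) - rface (\<lambda>ys z. ev \<phi> (f ys \<cdot> z)) (basis H x) ys"
proof -
  let ?xs = "x # ys"
  let ?V = "vadd (vadd (mul H (basis H (hd ?xs)) (f (tl ?xs)))
                (vsumover {1..n} (\<lambda>i. smul ((-1) ^ i)
                   (vsumover {..<dim H} (\<lambda>k. smul (mu H (?xs ! (i - 1)) (?xs ! i) k)
                        (f (take (i - 1) ?xs @ k # drop (i + 1) ?xs)))))))
          (smul ((-1) ^ Suc n) (mul H (f (butlast ?xs)) (basis H (last ?xs))))"
  have V: "?V \<in> vecs H"
    by (intro vadd_vecs vsum_vecs smul_vecs mul_vecs f)
  have "hoch_d H n f ?xs = ?V" unfolding hoch_d_def using rc_tuples[OF xs, of "\<lambda>xs. vadd (vadd (mul H (basis H (hd xs)) (f (tl xs)))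
                (vsumover {1..n} (\<lambda>i. smul ((-1) ^ i)
                   (vsumover {..<dim H} (\<lambda>k. smul (mu H (xs ! (i - 1)) (xs ! i) k)
                        (f (take (i - 1) xs @ k # drop (i + 1) xs)))))))
          (smul ((-1) ^ Suc n) (mul H (f (butlast xs)) (basis H (last xs))))", OF V] .
  then have "ev \<phi> (hoch_d H n f ?xs) = ev \<phi> (basis H x \<cdot> f ys)
    + ((\<Sum>i\<in>{1..n}. (-1) ^ i * (\<Sum>k<dim H. mu H (?xs ! (i - 1)) (?xs ! i) k * ev \<phi> (f (take (i - 1) ?xs @ k # drop (i + 1) ?xs) \<cdot> \<one>)))
     + (-1) ^ Suc n * ev \<phi> (f (butlast ?xs) \<cdot> basis H (last ?xs)))"
    by (simp only: dual_apply_vadd dual_apply_vsum dual_apply_smul one_r dual_apply_trunc list.sel add.assoc)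
  then show ?thesis unfolding hoch_faces[OF xs, of "\<lambda>ys z. ev \<phi> (f ys \<cdot> z)"] by simp
qed

text \<open>\<open>rface_DL\<close> treats all faces but the first. For the first, the action is
  designed so that the factor x_(1) contributed by \<open>untwist\<close> restores plain left
  multiplication by x.\<close>

lemma hoch_d_untwist:
  assumes xs: "xs \<in> tuples (dim H) (Suc n)"
  shows "hoch_d H n (rc H n (untwist F)) xs = untwist (twisted_d F) xs"
proof -
  obtain x ys where xs': "xs = x # ys" and x: "x < dim H" and ys: "ys \<in> tuples (dim H) n"
    using xs by (auto simp: tuples_Suc)
  have sy: "set ys \<subseteq> {..<dim H}" using ys by (simp add: tuples_def)
  show ?thesis
  proof (rule vec_eqI)
    show "hoch_d H n (rc H n (untwist F)) xs \<in> vecs H" unfolding hoch_d_def by (rule cochain_vecs[OF rc_cochains])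
    fix \<phi>
    have "ev \<phi> (hoch_d H n (rc H n (untwist F)) xs) = ev \<phi> (basis H x \<cdot> rc H n (untwist F) ys) - rface (\<lambda>ys z. ev \<phi> (rc H n (untwist F) ys \<cdot> z)) (basis H x) ys"
      unfolding xs' by (rule hoch_d_rface) (use cochain_vecs[OF rc_cochains] xs xs' in auto)
    also have "\<dots> = ev \<phi> (basis H x \<cdot> untwist F ys) - rface (\<lambda>ys z. ev \<phi> (untwist F ys \<cdot> z)) (basis H x) ys"
    proof -
      have "rface (\<lambda>ys z. ev \<phi> (rc H n (untwist F) ys \<cdot> z)) (basis H x) ys = rface (\<lambda>ys z. ev \<phi> (untwist F ys \<cdot> z)) (basis H x) ys"
        by (rule rface_cong[OF ys]) (simp add: rc_tuples)
      then show ?thesis by (simp add: rc_tuples ys)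
    qed
    also have "rface (\<lambda>ys z. ev \<phi> (untwist F ys \<cdot> z)) (basis H x) ys
       = D (basis H x) (\<lambda>p q. DL ys (\<lambda>as bs. face (\<lambda>zs. ev \<phi> (F zs \<cdot> (p \<cdot> bprod as))) q bs))"
    proof -
      have "(\<lambda>ys z. ev \<phi> (untwist F ys \<cdot> z)) = (\<lambda>ys z. DL ys (\<lambda>as bs. ev \<phi> (F bs \<cdot> (bprod as \<cdot> z))))"
        using lin_untwist[of "\<lambda>y. ev \<phi> (y \<cdot> _)" F] by (simp add: lin_rules assoc)
      then show ?thesis using rface_DL[of "\<lambda>zs z. ev \<phi> (F zs \<cdot> z)", OF _ sy] by (simp add: lin_rules)
    qed
    also have "ev \<phi> (basis H x \<cdot> untwist F ys) = D (basis H x) (\<lambda>p q. DL ys (\<lambda>as bs. ev \<phi> (act q (F bs) \<cdot> (p \<cdot> bprod as))))"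
    proof -
      \<comment> \<open>(x_(2).y) x_(1) = x y: the S^-1 in the action meets x_(1) and collapses by
        \<open>anti_l\<close>.\<close>
      have 1: "D (basis H x) (\<lambda>p q. ev \<phi> (act q y \<cdot> (p \<cdot> c))) = ev \<phi> (basis H x \<cdot> (y \<cdot> c))" for y c
      proof -
        have "D (basis H x) (\<lambda>p q. ev \<phi> (act q y \<cdot> (p \<cdot> c))) = D (basis H x) (\<lambda>p q. D q (\<lambda>r s. ev \<phi> (s \<cdot> (y \<cdot> (Si r \<cdot> p \<cdot> c)))))"
          using teval_lin[of H "\<lambda>z. ev \<phi> (z \<cdot> (_ \<cdot> c))" "cop H _" "\<lambda>p q. q \<cdot> (y \<cdot> Si p)"] by (simp add: act_def lin_rules assoc)
        also have "\<dots> = D (basis H x) (\<lambda>m s. D m (\<lambda>p r. ev \<phi> (s \<cdot> (y \<cdot> (Si r \<cdot> p \<cdot> c)))))" by (rule coassoc[symmetric])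
        also have "\<dots> = D (basis H x) (\<lambda>m s. \<epsilon> m * ev \<phi> (s \<cdot> (y \<cdot> c)))"
          using anti_l[of "\<lambda>z. ev \<phi> (_ \<cdot> (y \<cdot> (z \<cdot> c)))"] by (simp add: lin_rules one_l)
        also have "\<dots> = ev \<phi> (basis H x \<cdot> (y \<cdot> c))" by (simp add: counit_rules lin_rules)
        finally show ?thesis .
      qed
      have "ev \<phi> (basis H x \<cdot> untwist F ys) = DL ys (\<lambda>as bs. ev \<phi> (basis H x \<cdot> (F bs \<cdot> bprod as)))"
        by (rule lin_untwist[of "\<lambda>y. ev \<phi> (basis H x \<cdot> y)"]) (simp add: lin_rules)
      also have "\<dots> = DL ys (\<lambda>as bs. D (basis H x) (\<lambda>p q. ev \<phi> (act q (F bs) \<cdot> (p \<cdot> bprod as))))" by (simp only: 1)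
      also have "\<dots> = D (basis H x) (\<lambda>p q. DL ys (\<lambda>as bs. ev \<phi> (act q (F bs) \<cdot> (p \<cdot> bprod as))))" by (rule DL_teval)
      finally show ?thesis .
    qed
    also have "D (basis H x) (\<lambda>p q. DL ys (\<lambda>as bs. ev \<phi> (act q (F bs) \<cdot> (p \<cdot> bprod as))))
       - D (basis H x) (\<lambda>p q. DL ys (\<lambda>as bs. face (\<lambda>zs. ev \<phi> (F zs \<cdot> (p \<cdot> bprod as))) q bs))
      = (\<Sum>i<dim H. \<Sum>j<dim H. delta H x i j * DL ys (\<lambda>as bs. ev \<phi> (twisted_d F (j # bs) \<cdot> (basis H i \<cdot> bprod as))))"
    proof -
      have "ev \<phi> (twisted_d F (j # bs) \<cdot> c) = ev \<phi> (act (basis H j) (F bs) \<cdot> c) - face (\<lambda>zs. ev \<phi> (F zs \<cdot> c)) (basis H j) bs" for j bs c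
      proof -
        have L: "lin H (\<lambda>z. ev \<phi> (z \<cdot> c))" by (simp add: lin_rules)
        show ?thesis using ev_twisted_d[of "\<lambda>k. ev \<phi> (basis H k \<cdot> c)" F j bs] unfolding lin_dual_apply[OF L, symmetric] .
      qed
      then show ?thesis by (simp add: teval_basis[OF x] DL_diff right_diff_distrib sum_subtractf del: twisted_d.simps)
    qed
    also have "\<dots> = ev \<phi> (untwist (twisted_d F) xs)" unfolding xs' by (simp add: lin_untwist lin_rules del: twisted_d.simps)
    finally show "ev \<phi> (hoch_d H n (rc H n (untwist F)) xs) = ev \<phi> (untwist (twisted_d F) xs)" .
  qed simp
qed

section \<open>Linearity and transport of the homotopy\<close>

lemma mul_vadd1: "vadd x y \<cdot> z = vadd (x \<cdot> z) (y \<cdot> z)"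
  by (rule vec_eqI[where H = H]) (simp_all add: vadd_vecs dual_apply_vadd lin_vadd[of "\<lambda>x. ev _ (x \<cdot> z)"] lin_rules)

lemma insertion_add: "insertion z (\<lambda>ys. G ys + G' ys) ys = insertion z G ys + insertion z G' ys"
proof -
  have "slot a (\<lambda>ys. G ys + G' ys) = (\<lambda>ys. slot a G ys + slot a G' ys)" for a G G'
    by (rule ext) (simp add: slot_def distrib_left sum.distrib)
  then show ?thesis by (induction ys arbitrary: G G') simp_all
qed
lemma insertion_mulc: "insertion z (\<lambda>ys. c * G ys) ys = c * insertion z G ys"
  using insertion_sum[of z "\<lambda>_. c" "\<lambda>_. G" "{()}"] by simp
lemma face_mulc: "face (\<lambda>ys. c * G ys) a ys = c * face G a ys"
  using face_sum[of "\<lambda>_. c" "\<lambda>_. G" "{()}"] by simp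

lemma insertion_cong:
  assumes "xs \<in> tuples (dim H) n" "\<And>ys. ys \<in> tuples (dim H) (Suc n) \<Longrightarrow> G ys = G' ys"
  shows "insertion z G xs = insertion z G' xs"
  using assms
proof (induction xs arbitrary: n G G')
  case Nil then show ?case by (auto simp: slot_def tuples_def)
next
  case (Cons x xs)
  then obtain m where n: "n = Suc m" and x: "x < dim H" and xs: "xs \<in> tuples (dim H) m"
    by (cases n) (auto simp: tuples_def)
  have "insertion z (slot (basis H x) G) xs = insertion z (slot (basis H x) G') xs"
    unfolding slot_basis[OF x] by (rule Cons.IH[OF xs]) (use Cons.prems(2) n x in \<open>auto simp: tuples_Cons\<close>)
  moreover have "slot z G (x # xs) = slot z G' (x # xs)"
    using Cons.prems unfolding slot_def by (auto simp: tuples_Cons intro!: sum.cong)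
  ultimately show ?case by simp
qed

lemma insertionv_cong: "xs \<in> tuples (dim H) n \<Longrightarrow> (\<And>ys. ys \<in> tuples (dim H) (Suc n) \<Longrightarrow> F ys = F' ys) \<Longrightarrow> insertionv z F xs = insertionv z F' xs"
  unfolding insertionv_def by (rule ext) (auto intro!: insertion_cong[of xs n])

lemma act_smul: "act a (smul c y) = smul c (act a y)"
  by (rule vec_eqI[where H = H]) (simp_all add: smul_vecs dual_apply_smul lin_smul[of "\<lambda>y. ev _ (act a y)"] lin_rules vlin_act2)

lemma twisted_d_smul: "twisted_d (\<lambda>ys. smul c (F ys)) xs = smul c (twisted_d F xs)"
  by (cases xs) (auto simp: fun_eq_iff smul_def act_smul[unfolded smul_def] face_mulc right_diff_distrib)

lemma twist_vadd: "twist (\<lambda>xs. vadd (f xs) (g xs)) = (\<lambda>xs. vadd (twist f xs) (twist g xs))"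
proof (rule ext, rule vec_eqI[where H = H])
  fix xs \<phi> show "ev \<phi> (twist (\<lambda>xs. vadd (f xs) (g xs)) xs) = ev \<phi> (vadd (twist f xs) (twist g xs))"
    by (simp add: lin_twist lin_rules dual_apply_vadd mul_vadd1 DL_add)
qed (simp_all add: vadd_vecs)
lemma untwist_vadd: "untwist (\<lambda>xs. vadd (f xs) (g xs)) = (\<lambda>xs. vadd (untwist f xs) (untwist g xs))"
proof (rule ext, rule vec_eqI[where H = H])
  fix xs \<phi> show "ev \<phi> (untwist (\<lambda>xs. vadd (f xs) (g xs)) xs) = ev \<phi> (vadd (untwist f xs) (untwist g xs))"
    by (simp add: lin_untwist lin_rules dual_apply_vadd mul_vadd1 DL_add)
qed (simp_all add: vadd_vecs)
lemma insertionv_vadd: "insertionv z (\<lambda>xs. vadd (f xs) (g xs)) = (\<lambda>xs. vadd (insertionv z f xs) (insertionv z g xs))"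
  by (rule ext, rule vec_eqI[where H = H]) (simp_all add: vadd_vecs dual_apply_vadd ev_insertionv insertion_add)

lemma twist_smul: "twist (\<lambda>xs. smul c (f xs)) = (\<lambda>xs. smul c (twist f xs))"
proof (rule ext, rule vec_eqI[where H = H])
  fix xs \<phi> show "ev \<phi> (twist (\<lambda>xs. smul c (f xs)) xs) = ev \<phi> (smul c (twist f xs))"
    by (simp add: lin_twist lin_rules dual_apply_smul mul_smul1 DL_mulc)
qed (simp_all add: smul_vecs)
lemma insertionv_smul: "insertionv z (\<lambda>xs. smul c (f xs)) = (\<lambda>xs. smul c (insertionv z f xs))"
  by (rule ext, rule vec_eqI[where H = H]) (simp_all add: smul_vecs dual_apply_smul ev_insertionv insertion_mulc)

lemma homotopy:
  assumes z: "\<And>x. z \<cdot> x = x \<cdot> z" "\<epsilon> z = 1" and xs: "xs \<in> tuples (dim H) n"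
  shows "(case n of 0 \<Rightarrow> 0 | Suc m \<Rightarrow> ev f (twisted_d (insertionv z F) xs)) + ev f (insertionv z (twisted_d F) xs) = ev f (act z (F xs)) - ev f (F xs)"
proof (cases n)
  case 0 then show ?thesis using xs homotopy_Nil[OF z(2), of f F] by (simp add: tuples_0)
next
  case (Suc m)
  then obtain x ys where "xs = x # ys" "set (x # ys) \<subseteq> {..<dim H}"
    using xs by (cases xs) (auto simp: tuples_def)
  then show ?thesis using homotopy_Cons[OF z, of x ys f F] Suc by (simp del: twisted_d.simps)
qed

lemma untwist_homotopy:
  assumes z: "\<And>x. z \<cdot> x = x \<cdot> z" "\<epsilon> z = 1" and xs: "xs \<in> tuples (dim H) n"
  shows "(case n of 0 \<Rightarrow> 0 | Suc m \<Rightarrow> ev f (untwist (twisted_d (insertionv z F)) xs)) + ev f (untwist (insertionv z (twisted_d F)) xs)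
    = ev f (untwist (\<lambda>ys. act z (F ys)) xs) - ev f (untwist F xs)"
proof -
  have "(case n of 0 \<Rightarrow> 0 | Suc m \<Rightarrow> ev f (twisted_d (insertionv z F) bs \<cdot> c)) + ev f (insertionv z (twisted_d F) bs \<cdot> c)
      = ev f (act z (F bs) \<cdot> c) - ev f (F bs \<cdot> c)" if "bs \<in> tuples (dim H) n" for bs c
  proof -
    have L: "lin H (\<lambda>y. ev f (y \<cdot> c))" by (simp add: lin_rules)
    show ?thesis using homotopy[OF z that, of "\<lambda>k. ev f (basis H k \<cdot> c)" F] unfolding lin_dual_apply[OF L, symmetric] .
  qed
  then have "DL xs (\<lambda>as bs. (case n of 0 \<Rightarrow> 0 | Suc m \<Rightarrow> ev f (twisted_d (insertionv z F) bs \<cdot> bprod as)) + ev f (insertionv z (twisted_d F) bs \<cdot> bprod as))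
     = DL xs (\<lambda>as bs. ev f (act z (F bs) \<cdot> bprod as) - ev f (F bs \<cdot> bprod as))"
    by (intro DL_cong[OF xs])
  moreover have "DL xs (\<lambda>as bs. 0) = 0" using DL_mulc[of xs 0 "\<lambda>_ _. 0"] by simp
  ultimately show ?thesis by (cases n) (simp_all add: lin_untwist lin_rules DL_add DL_diff)
qed

end

section \<open>The fourth power\<close>

context ribbon_int
begin

text \<open>S(w) = w rewrites S(w_(1)) a w_(2) as w_(2) a S^-1(w_(1)), the form used by
  \<open>act\<close>.\<close>

lemma S0_4_act: "S0 (S0 (S0 (S0 a))) = smul (lam\<^sup>2) (act w a)"
proof (rule vec_eqI)
  fix f
  have "ev f (act (S w) a) = D w (\<lambda>x y. ev f (S x \<cdot> (a \<cdot> y)))"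
    by (simp add: ev_act D_S lin_rules)
  then show "ev f (S0 (S0 (S0 (S0 a)))) = ev f (smul (lam\<^sup>2) (act w a))"
    by (simp add: S0_4 lin_rules dual_apply_smul S_w)
qed (simp_all add: smul_vecs)

lemma twist_frakS: "xs \<in> tuples (dim H) n \<Longrightarrow> twist (frakS H R rho n g) xs = S0 (twist g xs)"
  unfolding frakS_rc using twist_rc_untwist[of "\<lambda>ys. S0 (twist g ys)" xs n] by simp

lemma frakS_4: "(frakS H R rho n ^^ 4) f = rc H n (untwist (\<lambda>ys. smul (lam\<^sup>2) (act w (twist f ys))))"
proof -
  have "(frakS H R rho n ^^ 4) f = frakS H R rho n (frakS H R rho n (frakS H R rho n (frakS H R rho n f)))"
    by (simp add: numeral_eq_Suc)
  also have "\<dots> = rc H n (untwist (\<lambda>ys. smul (lam\<^sup>2) (act w (twist f ys))))"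
    by (subst frakS_rc, rule rc_cong, rule untwist_cong, assumption) (simp add: twist_frakS S0_4_act)
  finally show ?thesis .
qed

text \<open>The insertion homotopy joins the action of w to the identity; the factor lam^2 adapts it
  to the fourth power, and twisting carries it to Hochschild cochains.\<close>

definition homotopy_S4 where "homotopy_S4 n f = rc H n (untwist (\<lambda>ys. smul (lam\<^sup>2) (insertionv w (twist f) ys)))"

lemma homotopy_S4_add: "homotopy_S4 n (cadd f g) = cadd (homotopy_S4 n f) (homotopy_S4 n g)"
proof -
  have c: "cadd f g = (\<lambda>xs. vadd (f xs) (g xs))" by (simp add: cadd_def vadd_def)
  have "untwist (insertionv w (twist (cadd f g))) = (\<lambda>xs. vadd (untwist (insertionv w (twist f)) xs) (untwist (insertionv w (twist g)) xs))"
    by (simp only: c twist_vadd insertionv_vadd untwist_vadd)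
  then show ?thesis
    unfolding homotopy_S4_def untwist_smul by (auto simp: rc_def cadd_def vadd_def smul_def fun_eq_iff distrib_left)
qed

lemma homotopy_S4_smul: "homotopy_S4 n (csmul c f) = csmul c (homotopy_S4 n f)"
proof -
  have e: "csmul c f = (\<lambda>xs. smul c (f xs))" by (simp add: csmul_def smul_def)
  have "untwist (insertionv w (twist (csmul c f))) = (\<lambda>xs. smul c (untwist (insertionv w (twist f)) xs))"
    by (simp only: e twist_smul insertionv_smul untwist_smul)
  then show ?thesis
    unfolding homotopy_S4_def untwist_smul by (auto simp: rc_def csmul_def smul_def fun_eq_iff mult.left_commute)
qed

lemma cochain_untwist_twist: assumes f: "f \<in> cochains H n" shows "rc H n (untwist (twist f)) = f"
proof -
  have "rc H n (untwist (twist f)) = rc H n f"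
    by (rule rc_cong) (simp add: untwist_twist set_tuples cochain_vecs[OF f])
  then show ?thesis by (simp add: cochain_rc[OF f])
qed

lemma frakS_4_homotopic:
  assumes f: "f \<in> cochains H n"
  shows "cdiff ((frakS H R rho n ^^ 4) f) (csmul (lam\<^sup>2) f)
     = cadd (case n of 0 \<Rightarrow> czero | Suc m \<Rightarrow> hoch_d H m (homotopy_S4 m f)) (homotopy_S4 n (hoch_d H n f))"
    (is "?L = ?R")
proof -
  let ?F = "twist f"
  \<comment> \<open>Both sides vanish off the tuples of length n and beyond the dimension, so it
    suffices to compare them on tuples, where values may be tested by functionals.\<close>
  have L0: "?L = rc H n ?L"
    unfolding frakS_4 using f by (auto simp: cdiff_def csmul_def rc_def cochains_def fun_eq_iff not_less)
  have R0: "?R = rc H n ?R"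
    unfolding homotopy_S4_def by (cases n) (auto simp: cadd_def czero_def hoch_d_def rc_def fun_eq_iff)
  have "?L xs = ?R xs" if xs: "xs \<in> tuples (dim H) n" for xs
  proof (rule vec_eqI)
    have fx: "f xs = untwist ?F xs" using untwist_twist[of xs f] set_tuples[OF xs] cochain_vecs[OF f] by simp
    have 1: "homotopy_S4 n (hoch_d H n f) xs = smul (lam\<^sup>2) (untwist (insertionv w (twisted_d ?F)) xs)"
    proof -
      have "twist (hoch_d H n f) zs = twisted_d ?F zs" if zs: "zs \<in> tuples (dim H) (Suc n)" for zs
      proof -
        have "twist (hoch_d H n f) zs = twist (untwist (twisted_d ?F)) zs"
          using hoch_d_untwist[of _ n ?F] unfolding cochain_untwist_twist[OF f] by (intro twist_cong[OF zs])
        then show ?thesis by (simp add: twist_untwist set_tuples[OF zs])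
      qed
      then have "untwist (insertionv w (twist (hoch_d H n f))) xs = untwist (insertionv w (twisted_d ?F)) xs"
        by (intro untwist_cong[OF xs] insertionv_cong[of _ n])
      then show ?thesis unfolding homotopy_S4_def by (simp add: rc_tuples xs untwist_smul smul_vecs)
    qed
    have 2: "hoch_d H m (homotopy_S4 m f) xs = smul (lam\<^sup>2) (untwist (twisted_d (insertionv w ?F)) xs)" if "n = Suc m" for m
    proof -
      have "twisted_d (\<lambda>ys. smul (lam\<^sup>2) (insertionv w ?F ys)) = (\<lambda>ys. smul (lam\<^sup>2) (twisted_d (insertionv w ?F) ys))"
        by (rule ext) (rule twisted_d_smul)
      moreover have "hoch_d H m (homotopy_S4 m f) xs = untwist (twisted_d (\<lambda>ys. smul (lam\<^sup>2) (insertionv w ?F ys))) xs"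
        unfolding homotopy_S4_def by (rule hoch_d_untwist) (use xs that in simp)
      ultimately show ?thesis by (simp only: untwist_smul)
    qed
    have fv: "smul (lam\<^sup>2) (untwist G xs) \<in> vecs H" for G by (simp add: smul_vecs)
    show "?L xs \<in> vecs H" by (subst L0) (rule cochain_vecs[OF rc_cochains])
    show "?R xs \<in> vecs H" by (subst R0) (rule cochain_vecs[OF rc_cochains])
    fix \<phi>
    have "ev \<phi> (?L xs) = lam\<^sup>2 * (ev \<phi> (untwist (\<lambda>ys. act w (?F ys)) xs) - ev \<phi> (untwist ?F xs))"
    proof -
      have "?L xs = vadd (smul (lam\<^sup>2) (untwist (\<lambda>ys. act w (?F ys)) xs)) (smul (- (lam\<^sup>2)) (f xs))"
      proof -
        have "(frakS H R rho n ^^ 4) f xs = smul (lam\<^sup>2) (untwist (\<lambda>ys. act w (?F ys)) xs)"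
          unfolding frakS_4 untwist_smul by (rule rc_tuples[OF xs]) (simp add: smul_vecs)
        then show ?thesis by (simp add: cdiff_def csmul_def vadd_def) (simp add: smul_def)
      qed
      then show ?thesis by (simp add: dual_apply_vadd dual_apply_smul fx right_diff_distrib)
    qed
    also have "\<dots> = lam\<^sup>2 * ((case n of 0 \<Rightarrow> 0 | Suc m \<Rightarrow> ev \<phi> (untwist (twisted_d (insertionv w ?F)) xs)) + ev \<phi> (untwist (insertionv w (twisted_d ?F)) xs))"
      using untwist_homotopy[OF w_c(1)[symmetric] eps_w xs, of \<phi> ?F] by simp
    also have "\<dots> = ev \<phi> (?R xs)"
    proof (cases n)
      case 0
      then have "?R xs = homotopy_S4 n (hoch_d H n f) xs" by (simp add: cadd_def czero_def)
      then show ?thesis using 0 1 by (simp add: dual_apply_smul)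
    next
      case (Suc m)
      then have "?R xs = vadd (hoch_d H m (homotopy_S4 m f) xs) (homotopy_S4 n (hoch_d H n f) xs)" by (simp add: cadd_def vadd_def)
      then show ?thesis using Suc 1 2[OF Suc] by (simp add: dual_apply_smul dual_apply_vadd distrib_left)
    qed
    finally show "ev \<phi> (?L xs) = ev \<phi> (?R xs)" .
  qed
  then have "rc H n ?L = rc H n ?R" by (rule rc_cong)
  then show ?thesis using L0 R0 by simp
qed

end

theorem mainTheorem12:
  fixes H :: "('k::field, 'z) hopf_scheme" and R :: "'k ten2" and v rho :: "'k vec"
  assumes "factorizable_ribbon_hopf H R v"
      and "nonzero_right_integral H rho"
  shows "(\<forall>n. \<forall>f\<in>cochains H n.
            frakS H R rho n (frakT H v n (frakS H R rho n f)) =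
            csmul (dual_apply H rho v)
              (the_inv_into (cochains H n) (frakT H v n)
                 (frakS H R rho n (the_inv_into (cochains H n) (frakT H v n) f))))
       \<and> (\<exists>h :: nat \<Rightarrow> 'k coch \<Rightarrow> 'k coch.
            (\<forall>n. \<forall>f\<in>cochains H (Suc n). h n f \<in> cochains H n) \<and>
            (\<forall>n. \<forall>f\<in>cochains H (Suc n). \<forall>g\<in>cochains H (Suc n).
                 h n (cadd f g) = cadd (h n f) (h n g)) \<and>
            (\<forall>n c. \<forall>f\<in>cochains H (Suc n). h n (csmul c f) = csmul c (h n f)) \<and>
            (\<forall>n. \<forall>f\<in>cochains H n.
               cdiff ((frakS H R rho n ^^ 4) f)
                     (csmul ((\<Sum>a<dim H. \<Sum>b<dim H. monodromy H R a b * rho a * rho b) ^ 2) f)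
               = cadd (case n of 0 \<Rightarrow> czero | Suc m \<Rightarrow> hoch_d H m (h m f))
                      (h n (hoch_d H n f))))"
proof -
  have h: "hopf_algebra H" and q: "quasitriangular H R" and r: "ribbon_element H R v" and fa: "factorizable H R"
    using assms(1) by (auto simp: factorizable_ribbon_hopf_def)
  obtain Ri where Ri: "mul2 H R Ri = one2 H" "mul2 H Ri R = one2 H"
    "\<And>x. x \<in> vecs H \<Longrightarrow> flip2 (cop H x) = mul2 H (mul2 H R (cop H x)) Ri"
    using q unfolding quasitriangular_def by blast
  obtain w where w: "w \<in> vecs H" "mul H v w = one H" "mul H w v = one H"
    using r unfolding ribbon_element_def by blast
  interpret ribbon_int H R Ri v w rho
  proof
    show "hopf_algebra H" by (rule h)
    show "mul2 H R Ri = one2 H" "mul2 H Ri R = one2 H" by (rule Ri)+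
    show "\<And>x. x \<in> vecs H \<Longrightarrow> flip2 (cop H x) = mul2 H (mul2 H R (cop H x)) Ri" by (rule Ri)
    show "cop_left H R = mul3 H (leg13 H R) (leg23 H R)" "cop_right H R = mul3 H (leg13 H R) (leg12 H R)"
      using q unfolding quasitriangular_def by blast+
    show "v \<in> vecs H" "Sop H v = v" "counit H v = 1" "cop H v = mul2 H (tens H v v) (monodromy H R)"
      "\<And>x. x \<in> vecs H \<Longrightarrow> mul H v x = mul H x v"
      using r unfolding ribbon_element_def by blast+
    show "mul H (mul H v v) (mul H (drinfeld_u H R) (Sop H (drinfeld_u H R))) = one H"
      using r unfolding ribbon_element_def Let_def by blast
    show "w \<in> vecs H" "mul H v w = one H" "mul H w v = one H" by (rule w)+
    show "inj_on (Phibar H R) (vecs H)" using fa unfolding factorizable_def bij_betw_def by blast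
    show "\<exists>i<dim H. rho i \<noteq> 0"
      using assms(2) unfolding nonzero_right_integral_def by blast
    show "\<And>i. i < dim H \<Longrightarrow> vsumover (pairs H) (\<lambda>(a, b). smul (delta H i a b * rho a) (basis H b)) = smul (rho i) (one H)"
      using assms(2) unfolding nonzero_right_integral_def by blast
  qed
  have "\<forall>n. \<forall>f\<in>cochains H (Suc n). homotopy_S4 n f \<in> cochains H n"
    by (simp add: homotopy_S4_def rc_cochains)
  \<comment> \<open>The homotopy was built with the constant lam^2; only here does
    \<open>lam_square\<close> bring in the squared value of rho (x) rho on Q.\<close>
  then show ?thesis
    using frakS_frakT_frakS frakS_4_homotopic homotopy_S4_add homotopy_S4_smul unfolding lam_square by (intro conjI exI[of _ homotopy_S4]) blast+
qed

end
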